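(* Let $\Phi$ be an indecomposable root system of rank $>1$, $R$ an algebraically closed field, and $G_\pi(\Phi,R)$ the corresponding Chevalley group. If $A$ is a computable subfield of $R$, then the Diophantine problem in $G_\pi(\Phi,R)$ with constants from $G_\pi(\Phi,A)$ is decidable (under a proper enumeration of $G_\pi(\Phi,A)$).
   Context: A countable structure $\mathcal A$ of finite signature is computable with respect to an enumeration (surjective map) $\nu:\mathbb N\to\mathcal A$ if all basic operations and predicates of $\mathcal A$, including equality, are computable with respect to $\nu$; it is computable if it has such an enumeration. A computable subfield is a subfield that is a computable structure. A proper enumeration of $G_\pi(\Phi,A)$ is one arising from an enumeration making $A$ computable, by representing elements of $G_\pi(\Phi,A)$ as matrices over $A$. Root systems are reduced. Let $\pi$ be a faithful finite-dimensional representation of the complex semisimple Lie algebra with root system $\Phi$, with weight lattice $\Lambda_\pi$. $G_\pi(\Phi,K)$ denotes the Chevalley group of type $(\Phi,\Lambda_\pi)$ over a commutative ring $K$ with $1$, i.e. the group of $K$-points of the Chevalley--Demazure group scheme, realized as the subgroup of $\mathrm{SL}_n(K)$, $n=\dim\pi$, given by polynomial equations with integer coefficients in the matrix entries; thus $G_\pi(\Phi,A)\leqslant G_\pi(\Phi,R)$. The Diophantine problem in a group $G$ with constants from an enumerated countable subset $C$ is decidable if there is an algorithm which, given a finite system of group equations with coefficients in $C$ (presented through the enumeration), decides whether the system has a solution in $G$. *)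

theory Defs
  imports
    "HOL-Analysis.Analysis"
    "HOL-Algebra.Generated_Groups"
    "HOL-Library.Poly_Mapping"
    "HOL-Library.Nat_Bijection"
begin

section \<open>Root systems\<close>

definition cartan_number :: "'e::euclidean_space \<Rightarrow> 'e \<Rightarrow> real" where
  "cartan_number \<beta> \<alpha> = 2 * (\<beta> \<bullet> \<alpha>) / (\<alpha> \<bullet> \<alpha>)"

text \<open>Reduced root systems; the roots span the ambient Euclidean space.\<close>

definition root_system :: "'e::euclidean_space set \<Rightarrow> bool" where
  "root_system \<Phi> \<longleftrightarrow>
     finite \<Phi> \<and> 0 \<notin> \<Phi> \<and> span \<Phi> = UNIV \<and>
     (\<forall>\<alpha>\<in>\<Phi>. \<forall>c. c *\<^sub>R \<alpha> \<in> \<Phi> \<longleftrightarrow> c = 1 \<or> c = -1) \<and>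
     (\<forall>\<alpha>\<in>\<Phi>. \<forall>\<beta>\<in>\<Phi>. \<beta> - cartan_number \<beta> \<alpha> *\<^sub>R \<alpha> \<in> \<Phi>) \<and>
     (\<forall>\<alpha>\<in>\<Phi>. \<forall>\<beta>\<in>\<Phi>. cartan_number \<beta> \<alpha> \<in> \<int>)"

definition indecomposable :: "'e::euclidean_space set \<Rightarrow> bool" where
  "indecomposable \<Phi> \<longleftrightarrow>
     \<Phi> \<noteq> {} \<and>
     \<not> (\<exists>\<Phi>1 \<Phi>2. \<Phi>1 \<noteq> {} \<and> \<Phi>2 \<noteq> {} \<and> \<Phi> = \<Phi>1 \<union> \<Phi>2 \<and>
          (\<forall>\<alpha>\<in>\<Phi>1. \<forall>\<beta>\<in>\<Phi>2. \<alpha> \<bullet> \<beta> = 0))"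


section \<open>Complex semisimple Lie algebras and Chevalley bases\<close>

locale complex_lie_algebra = vector_space scale
  for scale :: "complex \<Rightarrow> 'g::ab_group_add \<Rightarrow> 'g" +
  fixes bracket :: "'g \<Rightarrow> 'g \<Rightarrow> 'g"
  assumes bracket_add_left: "bracket (x + y) z = bracket x z + bracket y z"
    and bracket_add_right: "bracket x (y + z) = bracket x y + bracket x z"
    and bracket_scale_left: "bracket (scale c x) y = scale c (bracket x y)"
    and bracket_scale_right: "bracket x (scale c y) = scale c (bracket x y)"
    and bracket_self: "bracket x x = 0"
    and jacobi: "bracket x (bracket y z) + bracket y (bracket z x) + bracket z (bracket x y) = 0"
begin

definition bracket_span :: "'g set \<Rightarrow> 'g set \<Rightarrow> 'g set" where
  "bracket_span S T = span {bracket x y | x y. x \<in> S \<and> y \<in> T}"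

definition lie_ideal :: "'g set \<Rightarrow> bool" where
  "lie_ideal I \<longleftrightarrow> subspace I \<and> (\<forall>x. \<forall>y\<in>I. bracket x y \<in> I)"

definition solvable :: "'g set \<Rightarrow> bool" where
  "solvable I \<longleftrightarrow> (\<exists>k. ((\<lambda>J. bracket_span J J) ^^ k) I = {0})"

definition nilpotent :: "'g set \<Rightarrow> bool" where
  "nilpotent I \<longleftrightarrow> (\<exists>k. (bracket_span I ^^ k) I = {0})"

definition semisimple :: bool where
  "semisimple \<longleftrightarrow>
     (\<exists>X. finite X \<and> span X = UNIV) \<and>
     (\<forall>I. lie_ideal I \<and> solvable I \<longrightarrow> I = {0})"

definition cartan_subalgebra :: "'g set \<Rightarrow> bool" where
  "cartan_subalgebra H \<longleftrightarrow>
     subspace H \<and> (\<forall>x\<in>H. \<forall>y\<in>H. bracket x y \<in> H) \<and> nilpotent H \<and>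
     (\<forall>x. (\<forall>h\<in>H. bracket x h \<in> H) \<longrightarrow> x \<in> H)"

text \<open>
  Linear functionals on \<open>H\<close> are represented by functions on the whole algebra of which only
  the values on \<open>H\<close> matter.
\<close>

definition functional_on :: "'g set \<Rightarrow> ('g \<Rightarrow> complex) \<Rightarrow> bool" where
  "functional_on H \<omega> \<longleftrightarrow>
     (\<forall>h\<in>H. \<forall>h'\<in>H. \<omega> (h + h') = \<omega> h + \<omega> h') \<and>
     (\<forall>c. \<forall>h\<in>H. \<omega> (scale c h) = c * \<omega> h)"

definition is_root :: "'g set \<Rightarrow> ('g \<Rightarrow> complex) \<Rightarrow> bool" where
  "is_root H \<omega> \<longleftrightarrow>
     functional_on H \<omega> \<and> (\<exists>h\<in>H. \<omega> h \<noteq> 0) \<and>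
     (\<exists>x. x \<noteq> 0 \<and> (\<forall>h\<in>H. bracket h x = scale (\<omega> h) x))"

text \<open>
  \<open>\<rho>\<close> is an isomorphism of root systems from \<open>\<Phi>\<close> onto the root system of the algebra with
  respect to \<open>H\<close>: an injective real-linear map from the ambient space of \<open>\<Phi>\<close> to the dual of
  \<open>H\<close> carrying \<open>\<Phi>\<close> onto the set of roots.
\<close>

definition root_system_iso ::
    "'e::euclidean_space set \<Rightarrow> 'g set \<Rightarrow> ('e \<Rightarrow> 'g \<Rightarrow> complex) \<Rightarrow> bool" where
  "root_system_iso \<Phi> H \<rho> \<longleftrightarrow>
     (\<forall>v. functional_on H (\<rho> v)) \<and>
     (\<forall>h\<in>H. linear (\<lambda>v. \<rho> v h)) \<and>
     (\<forall>v. (\<forall>h\<in>H. \<rho> v h = 0) \<longrightarrow> v = 0) \<and>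
     (\<forall>\<alpha>\<in>\<Phi>. is_root H (\<rho> \<alpha>)) \<and>
     (\<forall>\<omega>. is_root H \<omega> \<longrightarrow> (\<exists>\<alpha>\<in>\<Phi>. \<forall>h\<in>H. \<rho> \<alpha> h = \<omega> h))"

text \<open>
  The root vectors of a Chevalley basis. Its remaining members are the coroots
  \<open>[e \<alpha>, e (-\<alpha>)]\<close> for simple \<open>\<alpha>\<close>, so they are determined by \<open>e\<close>. The second clause says that
  \<open>[e \<alpha>, e (-\<alpha>)]\<close> is the coroot of \<open>\<alpha>\<close>; the third that the structure constants satisfy
  \<open>N (-\<alpha>) (-\<beta>) = - N \<alpha> \<beta>\<close>.
\<close>

definition chevalley_basis ::
    "'e::euclidean_space set \<Rightarrow> 'g set \<Rightarrow> ('e \<Rightarrow> 'g \<Rightarrow> complex) \<Rightarrow> ('e \<Rightarrow> 'g) \<Rightarrow> bool" where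
  "chevalley_basis \<Phi> H \<rho> e \<longleftrightarrow>
     (\<forall>\<alpha>\<in>\<Phi>. \<forall>h\<in>H. bracket h (e \<alpha>) = scale (\<rho> \<alpha> h) (e \<alpha>)) \<and>
     (\<forall>\<alpha>\<in>\<Phi>. bracket (e \<alpha>) (e (-\<alpha>)) \<in> H \<and>
        (\<forall>\<beta>\<in>\<Phi>. \<rho> \<beta> (bracket (e \<alpha>) (e (-\<alpha>))) = of_real (cartan_number \<beta> \<alpha>))) \<and>
     (\<exists>N. \<forall>\<alpha>\<in>\<Phi>. \<forall>\<beta>\<in>\<Phi>. \<alpha> + \<beta> \<in> \<Phi> \<longrightarrow>
        bracket (e \<alpha>) (e \<beta>) = scale (N \<alpha> \<beta>) (e (\<alpha> + \<beta>)) \<and>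
        N (-\<alpha>) (-\<beta>) = - N \<alpha> \<beta>)"

definition faithful_representation :: "('g \<Rightarrow> complex^'n^'n) \<Rightarrow> bool" where
  "faithful_representation \<pi> \<longleftrightarrow>
     (\<forall>x y. \<pi> (x + y) = \<pi> x + \<pi> y) \<and>
     (\<forall>c x. \<pi> (scale c x) = (\<chi> i j. c * \<pi> x $ i $ j)) \<and>
     (\<forall>x y. \<pi> (bracket x y) = \<pi> x ** \<pi> y - \<pi> y ** \<pi> x) \<and>
     inj \<pi>"

end


section \<open>Chevalley groups\<close>

definition divided_power :: "complex^'n^'n \<Rightarrow> nat \<Rightarrow> complex^'n^'n" where
  "divided_power M k = (\<chi> i j. (((**) M ^^ k) (mat 1)) $ i $ j / fact k)"

text \<open>The series is a finite sum where it is used, \<open>M\<close> being nilpotent there.\<close>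

definition exp_matrix :: "complex \<Rightarrow> complex^'n^'n \<Rightarrow> complex^'n^'n" where
  "exp_matrix t M = (\<chi> i j. suminf (\<lambda>k. t ^ k * divided_power M k $ i $ j))"

text \<open>
  The columns of \<open>B\<close> form a basis of a lattice in \<open>\<complex>\<^sup>n\<close> stable under all divided powers
  \<open>X \<alpha> ^ k / k!\<close> of the operators \<open>X \<alpha> = \<pi> (e \<alpha>)\<close>, that is, under the Kostant form of the
  universal enveloping algebra.
\<close>

definition lattice_of :: "complex^'n^'n \<Rightarrow> (complex^'n) set" where
  "lattice_of B = {B *v z | z. \<forall>i. z $ i \<in> \<int>}"

definition admissible_lattice_basis ::
    "'e set \<Rightarrow> ('e \<Rightarrow> complex^'n^'n) \<Rightarrow> complex^'n^'n \<Rightarrow> bool" where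
  "admissible_lattice_basis \<Phi> X B \<longleftrightarrow>
     invertible B \<and>
     (\<forall>\<alpha>\<in>\<Phi>. \<forall>k. \<forall>v\<in>lattice_of B. divided_power (X \<alpha>) k *v v \<in> lattice_of B)"

definition matrix_group :: "('k::comm_ring_1^'n^'n) set \<Rightarrow> ('k^'n^'n) monoid" where
  "matrix_group S = \<lparr>carrier = S, mult = (**), one = mat 1\<rparr>"

text \<open>
  The complex Chevalley group, generated by the root elements \<open>exp (t X \<alpha>)\<close>, written in the
  coordinates given by the lattice basis.
\<close>

definition complex_chevalley_group ::
    "'e set \<Rightarrow> ('e \<Rightarrow> complex^'n^'n) \<Rightarrow> complex^'n^'n \<Rightarrow> (complex^'n^'n) set" where
  "complex_chevalley_group \<Phi> X B =
     generate (matrix_group {M. invertible M})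
       {matrix_inv B ** exp_matrix t (X \<alpha>) ** B | t \<alpha>. \<alpha> \<in> \<Phi>}"

text \<open>Integer polynomials in the variables \<open>'v\<close>, as finitely supported maps on monomials.\<close>

definition eval_poly :: "(('v \<Rightarrow>\<^sub>0 nat) \<Rightarrow>\<^sub>0 int) \<Rightarrow> ('v \<Rightarrow> 'k::comm_ring_1) \<Rightarrow> 'k" where
  "eval_poly p x =
     (\<Sum>m\<in>Poly_Mapping.keys p. of_int (Poly_Mapping.lookup p m) *
        (\<Prod>v\<in>Poly_Mapping.keys m. x v ^ Poly_Mapping.lookup m v))"

definition entries :: "'k^'n^'m \<Rightarrow> 'm \<times> 'n \<Rightarrow> 'k" where
  "entries M = (\<lambda>(i, j). M $ i $ j)"

text \<open>
  The points over a subring \<open>K\<close> of the Chevalley--Demazure group scheme: its coordinate ring is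
  the ring of functions on the complex group generated over the integers by the matrix entries
  in an admissible lattice basis, so its points are the common zeros of all integer polynomials
  that vanish on the complex group.
\<close>

definition chevalley_group ::
    "'e set \<Rightarrow> ('e \<Rightarrow> complex^'n^'n) \<Rightarrow> complex^'n^'n \<Rightarrow> 'k::comm_ring_1 set \<Rightarrow> ('k^'n^'n) set" where
  "chevalley_group \<Phi> X B K =
     {M. (\<forall>i j. M $ i $ j \<in> K) \<and> det M = 1 \<and>
         (\<forall>p. (\<forall>g\<in>complex_chevalley_group \<Phi> X B. eval_poly p (entries g) = 0)
              \<longrightarrow> eval_poly p (entries M) = 0)}"


section \<open>Computability\<close>

text \<open>
  General recursive functions (Kleene): only lists of length \<open>n\<close> are meaningful arguments of
  \<open>f\<close> in \<open>recursive n f\<close>, and minimisation is applied to regular functions only.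
\<close>

inductive recursive :: "nat \<Rightarrow> (nat list \<Rightarrow> nat) \<Rightarrow> bool" where
  zero: "recursive n (\<lambda>xs. 0)"
| succ: "recursive 1 (\<lambda>xs. Suc (xs ! 0))"
| proj: "i < n \<Longrightarrow> recursive n (\<lambda>xs. xs ! i)"
| comp: "recursive (length gs) f \<Longrightarrow> (\<forall>g\<in>set gs. recursive n g) \<Longrightarrow>
    recursive n (\<lambda>xs. f (map (\<lambda>g. g xs) gs))"
| prec: "recursive n f \<Longrightarrow> recursive (Suc (Suc n)) g \<Longrightarrow>
    recursive (Suc n) (\<lambda>xs. rec_nat (f (tl xs)) (\<lambda>k r. g (k # r # tl xs)) (hd xs))"
| mini: "recursive (Suc n) f \<Longrightarrow> (\<forall>xs. length xs = n \<longrightarrow> (\<exists>k. f (k # xs) = 0)) \<Longrightarrow>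
    recursive n (\<lambda>xs. LEAST k. f (k # xs) = 0)"

definition computable_operation :: "(nat \<Rightarrow> 'a) \<Rightarrow> nat \<Rightarrow> ('a list \<Rightarrow> 'a) \<Rightarrow> bool" where
  "computable_operation \<nu> k F \<longleftrightarrow>
     (\<exists>f. recursive k f \<and> (\<forall>xs. length xs = k \<longrightarrow> F (map \<nu> xs) = \<nu> (f xs)))"

definition computable_predicate :: "(nat \<Rightarrow> 'a) \<Rightarrow> nat \<Rightarrow> ('a list \<Rightarrow> bool) \<Rightarrow> bool" where
  "computable_predicate \<nu> k P \<longleftrightarrow>
     (\<exists>f. recursive k f \<and> (\<forall>xs. length xs = k \<longrightarrow> f xs = of_bool (P (map \<nu> xs))))"

text \<open>Fields are structures in the signature of rings; computability of inversion follows.\<close>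

definition computable_enumeration :: "(nat \<Rightarrow> 'r::field) \<Rightarrow> 'r set \<Rightarrow> bool" where
  "computable_enumeration \<nu> A \<longleftrightarrow>
     range \<nu> = A \<and>
     computable_operation \<nu> 0 (\<lambda>xs. 0) \<and>
     computable_operation \<nu> 0 (\<lambda>xs. 1) \<and>
     computable_operation \<nu> 2 (\<lambda>xs. xs ! 0 + xs ! 1) \<and>
     computable_operation \<nu> 1 (\<lambda>xs. - (xs ! 0)) \<and>
     computable_operation \<nu> 2 (\<lambda>xs. xs ! 0 * xs ! 1) \<and>
     computable_predicate \<nu> 2 (\<lambda>xs. xs ! 0 = xs ! 1)"

definition is_subfield :: "'r::field set \<Rightarrow> bool" where
  "is_subfield A \<longleftrightarrow>
     0 \<in> A \<and> 1 \<in> A \<and>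
     (\<forall>x\<in>A. \<forall>y\<in>A. x + y \<in> A \<and> x * y \<in> A) \<and>
     (\<forall>x\<in>A. - x \<in> A \<and> inverse x \<in> A)"

definition computable_subfield :: "'r::field set \<Rightarrow> bool" where
  "computable_subfield A \<longleftrightarrow> is_subfield A \<and> (\<exists>\<nu>. computable_enumeration \<nu> A)"

text \<open>
  Enumerations of a set \<open>S\<close> of matrices over \<open>A\<close> under which a number effectively presents the
  entries of the matrix it enumerates.
\<close>

definition proper_enumeration :: "'r::field set \<Rightarrow> ('r^'n^'n) set \<Rightarrow> (nat \<Rightarrow> 'r^'n^'n) \<Rightarrow> bool" where
  "proper_enumeration A S \<mu> \<longleftrightarrow>
     range \<mu> = S \<and>
     (\<exists>\<nu>. computable_enumeration \<nu> A \<and>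
        (\<forall>i j. \<exists>f. recursive 1 f \<and> (\<forall>k. \<mu> k $ i $ j = \<nu> (f [k]))))"


section \<open>The Diophantine problem in a group\<close>

text \<open>Group words in variables and constants, the latter presented by numbers.\<close>

datatype letter = Var nat | Var_inv nat | Const nat | Const_inv nat

type_synonym equation = "letter list \<times> letter list"

primrec letter_value ::
    "('a, 'b) monoid_scheme \<Rightarrow> (nat \<Rightarrow> 'a) \<Rightarrow> (nat \<Rightarrow> 'a) \<Rightarrow> letter \<Rightarrow> 'a" where
  "letter_value G c \<sigma> (Var i) = \<sigma> i"
| "letter_value G c \<sigma> (Var_inv i) = inv\<^bsub>G\<^esub> (\<sigma> i)"
| "letter_value G c \<sigma> (Const k) = c k"
| "letter_value G c \<sigma> (Const_inv k) = inv\<^bsub>G\<^esub> (c k)"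

definition word_value ::
    "('a, 'b) monoid_scheme \<Rightarrow> (nat \<Rightarrow> 'a) \<Rightarrow> (nat \<Rightarrow> 'a) \<Rightarrow> letter list \<Rightarrow> 'a" where
  "word_value G c \<sigma> w = foldr (\<lambda>l g. letter_value G c \<sigma> l \<otimes>\<^bsub>G\<^esub> g) w \<one>\<^bsub>G\<^esub>"

definition has_solution :: "('a, 'b) monoid_scheme \<Rightarrow> (nat \<Rightarrow> 'a) \<Rightarrow> equation list \<Rightarrow> bool" where
  "has_solution G c S \<longleftrightarrow>
     (\<exists>\<sigma>. (\<forall>i. \<sigma> i \<in> carrier G) \<and>
        (\<forall>(u, w)\<in>set S. word_value G c \<sigma> u = word_value G c \<sigma> w))"

primrec letter_code :: "letter \<Rightarrow> nat" where
  "letter_code (Var i) = 4 * i"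
| "letter_code (Var_inv i) = 4 * i + 1"
| "letter_code (Const k) = 4 * k + 2"
| "letter_code (Const_inv k) = 4 * k + 3"

definition word_code :: "letter list \<Rightarrow> nat" where
  "word_code w = list_encode (map letter_code w)"

definition system_code :: "equation list \<Rightarrow> nat" where
  "system_code S = list_encode (map (\<lambda>(u, w). prod_encode (word_code u, word_code w)) S)"

definition diophantine_decidable :: "('a, 'b) monoid_scheme \<Rightarrow> (nat \<Rightarrow> 'a) \<Rightarrow> bool" where
  "diophantine_decidable G c \<longleftrightarrow>
     (\<exists>f. recursive 1 f \<and> (\<forall>S. f [system_code S] = of_bool (has_solution G c S)))"

end

theory Submission
  imports Defs "HOL-Library.Function_Algebras"
begin

text \<open>
  The group of points over \<open>R\<close> is the zero set of finitely many integer polynomials in the matrix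
  entries, by Hilbert's basis theorem, and it is closed under adjugates because the complex group
  consists of matrices of determinant 1: the root elements are unipotent, as \<open>X ^ k / k!\<close> is both
  integral in the lattice basis and small for large \<open>k\<close>. Hence a finite system of group equations is
  effectively a finite system of polynomial equations over \<open>A\<close>, inverses being expressed by
  adjugates. Its solvability in the algebraically closed field \<open>R\<close> is decided by eliminating the
  variables one at a time; univariate systems over a field are handled by pseudo-division, branching
  on whether the leading coefficients vanish, so that no polynomial need be in normal form.
\<close>

section \<open>Computable functions\<close>

text \<open>The finite list of defining polynomials is obtained by a pure existence argument and
  then built into the algorithm as fixed data: the decision procedure only has to exist, so it never
  computes that list.

  Inverses in words are taken in the group of points over \<open>R\<close>, about which only its
  equations are known. That the adjugate satisfies them again is inherited from the complex group,
  where inverses exist, by substituting adjugate entries into an integer polynomial, a construction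
  that makes sense over both rings at once.

  Elements of \<open>A\<close> are known through codes that need not be unique. Elimination
  therefore computes formally with coefficients and is justified by values alone; the zero test of
  \<open>A\<close> is applied only after all variables are gone. The field \<open>R\<close> itself
  is never enumerated and enters through the existence of roots and its infinitude.\<close>

text \<open>
  Unlike \<open>recursive\<close>, the following predicate does not depend on the values at lists of the
  wrong length.
\<close>

definition rec_fun :: "nat \<Rightarrow> (nat list \<Rightarrow> nat) \<Rightarrow> bool" where
  "rec_fun n f \<longleftrightarrow> (\<exists>g. recursive n g \<and> (\<forall>xs. length xs = n \<longrightarrow> g xs = f xs))"

section \<open>Closure of general recursive functions under arithmetic and pairing\<close>

lemma rec_fun_cong:
  assumes "rec_fun n f" and "\<And>xs. length xs = n \<Longrightarrow> f xs = g xs"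
  shows "rec_fun n g"
  using assms unfolding rec_fun_def by metis

lemma rec_fun_recursive: "recursive n f \<Longrightarrow> rec_fun n f"
  unfolding rec_fun_def by blast

lemma rec_fun_proj: "i < n \<Longrightarrow> rec_fun n (\<lambda>xs. xs ! i)"
  by (intro rec_fun_recursive recursive.proj)

lemma rec_fun_comp:
  assumes "rec_fun (length gs) f" and "\<And>g. g \<in> set gs \<Longrightarrow> rec_fun n g"
  shows "rec_fun n (\<lambda>xs. f (map (\<lambda>g. g xs) gs))"
proof -
  obtain f' where f': "recursive (length gs) f'" "\<And>xs. length xs = length gs \<Longrightarrow> f' xs = f xs"
    using assms(1) unfolding rec_fun_def by blast
  have "\<forall>g\<in>set gs. \<exists>h. recursive n h \<and> (\<forall>xs. length xs = n \<longrightarrow> h xs = g xs)"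
    using assms(2) unfolding rec_fun_def by blast
  then obtain G where G: "\<And>g. g \<in> set gs \<Longrightarrow> recursive n (G g)"
      "\<And>g xs. g \<in> set gs \<Longrightarrow> length xs = n \<Longrightarrow> G g xs = g xs"
    by metis
  have "recursive n (\<lambda>xs. f' (map (\<lambda>g. g xs) (map G gs)))"
    by (rule recursive.comp) (use f'(1) G(1) in auto)
  moreover have "f' (map (\<lambda>g. g xs) (map G gs)) = f (map (\<lambda>g. g xs) gs)" if "length xs = n" for xs
  proof -
    have "map (\<lambda>g. g xs) (map G gs) = map (\<lambda>g. g xs) gs"
      using G(2) that by simp
    then show ?thesis by (simp only: f'(2) length_map)
  qed
  ultimately show ?thesis unfolding rec_fun_def by blast
qed

lemma rec_fun_comp1: "rec_fun 1 f \<Longrightarrow> rec_fun n g \<Longrightarrow> rec_fun n (\<lambda>xs. f [g xs])"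
  using rec_fun_comp[of "[g]" f n] by simp

lemma rec_fun_comp2:
  "rec_fun 2 f \<Longrightarrow> rec_fun n g \<Longrightarrow> rec_fun n h \<Longrightarrow> rec_fun n (\<lambda>xs. f [g xs, h xs])"
  using rec_fun_comp[of "[g, h]" f n] by (auto simp: numeral_2_eq_2)

lemma rec_fun_Suc: "rec_fun n f \<Longrightarrow> rec_fun n (\<lambda>xs. Suc (f xs))"
  using rec_fun_comp1[OF rec_fun_recursive[OF recursive.succ], of n f] by simp

lemma rec_fun_const: "rec_fun n (\<lambda>xs. c)"
proof (induction c)
  case 0
  show ?case by (intro rec_fun_recursive recursive.zero)
qed (rule rec_fun_Suc)

lemma rec_fun_prec:
  assumes "rec_fun n f" and "rec_fun (Suc (Suc n)) g"
  shows "rec_fun (Suc n) (\<lambda>xs. rec_nat (f (tl xs)) (\<lambda>k r. g (k # r # tl xs)) (hd xs))"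
proof -
  obtain f' g' where *: "recursive n f'" "\<And>xs. length xs = n \<Longrightarrow> f' xs = f xs"
     "recursive (Suc (Suc n)) g'" "\<And>xs. length xs = Suc (Suc n) \<Longrightarrow> g' xs = g xs"
    using assms unfolding rec_fun_def by blast
  have "recursive (Suc n) (\<lambda>xs. rec_nat (f' (tl xs)) (\<lambda>k r. g' (k # r # tl xs)) (hd xs))"
    by (rule recursive.prec) fact+
  moreover have "rec_nat (f' (tl xs)) (\<lambda>k r. g' (k # r # tl xs)) m
      = rec_nat (f (tl xs)) (\<lambda>k r. g (k # r # tl xs)) m" if "length xs = Suc n" for xs m
    using that by (induction m) (auto simp: *)
  ultimately show ?thesis unfolding rec_fun_def by blast
qed

lemma rec_fun_mini:
  assumes "rec_fun (Suc n) f" and "\<And>xs. length xs = n \<Longrightarrow> \<exists>k. f (k # xs) = 0"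
  shows "rec_fun n (\<lambda>xs. LEAST k. f (k # xs) = 0)"
proof -
  obtain f' where *: "recursive (Suc n) f'" "\<And>xs. length xs = Suc n \<Longrightarrow> f' xs = f xs"
    using assms unfolding rec_fun_def by blast
  have "recursive n (\<lambda>xs. LEAST k. f' (k # xs) = 0)"
    by (rule recursive.mini) (use * assms(2) in auto)
  moreover have "(LEAST k. f' (k # xs) = 0) = (LEAST k. f (k # xs) = 0)" if "length xs = n" for xs
    using that * by simp
  ultimately show ?thesis unfolding rec_fun_def by blast
qed

text \<open>\<open>prec\<close> recurses on the head of the list and sees only its tail as
  parameters. Prefixing \<open>t\<close> to the list of all projections and composing frees
  both.\<close>

lemma rec_fun_rec_nat:
  assumes b: "rec_fun n b" and s: "rec_fun (Suc (Suc n)) s" and t: "rec_fun n t"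
  shows "rec_fun n (\<lambda>xs. rec_nat (b xs) (\<lambda>k r. s (k # r # xs)) (t xs))"
proof -
  let ?gs = "t # map (\<lambda>i xs. xs ! i) [0..<n]"
  let ?F = "\<lambda>xs. rec_nat (b (tl xs)) (\<lambda>k r. s (k # r # tl xs)) (hd xs)"
  have "rec_fun n (\<lambda>xs. ?F (map (\<lambda>g. g xs) ?gs))"
    by (rule rec_fun_comp) (use rec_fun_prec[OF b s] t in \<open>auto intro: rec_fun_proj\<close>)
  then show ?thesis
  proof (rule rec_fun_cong)
    fix xs :: "nat list" assume "length xs = n"
    then have "map (\<lambda>g. g xs) ?gs = t xs # xs"
      by (auto simp: comp_def intro: nth_equalityI)
    then show "?F (map (\<lambda>g. g xs) ?gs) = rec_nat (b xs) (\<lambda>k r. s (k # r # xs)) (t xs)"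
      by (simp only: list.sel)
  qed
qed

lemma rec_fun_add:
  assumes "rec_fun n f" "rec_fun n g"
  shows "rec_fun n (\<lambda>xs. f xs + g xs)"
proof -
  have "rec_fun n (\<lambda>xs. rec_nat (f xs) (\<lambda>k r. Suc ((k # r # xs) ! 1)) (g xs))"
    by (rule rec_fun_rec_nat) (intro assms rec_fun_Suc rec_fun_proj | simp)+
  moreover have "rec_nat a (\<lambda>k r. Suc ((k # r # xs) ! 1)) m = a + m" for a m :: nat and xs
    by (induction m) auto
  ultimately show ?thesis by simp
qed

lemma rec_fun_diff:
  assumes "rec_fun n f" "rec_fun n g"
  shows "rec_fun n (\<lambda>xs. f xs - g xs)"
proof -
  have pred: "rec_fun m (\<lambda>xs. h xs - Suc 0)" if "rec_fun m h" for h m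
  proof -
    have "rec_fun m (\<lambda>xs. rec_nat 0 (\<lambda>k r. (k # r # xs) ! 0) (h xs))"
      by (rule rec_fun_rec_nat) (intro that rec_fun_proj rec_fun_const | simp)+
    moreover have "rec_nat 0 (\<lambda>k r. (k # r # xs) ! 0) i = i - Suc 0" for i :: nat and xs
      by (cases i) auto
    ultimately show ?thesis by simp
  qed
  have "rec_fun n (\<lambda>xs. rec_nat (f xs) (\<lambda>k r. (k # r # xs) ! 1 - Suc 0) (g xs))"
    by (rule rec_fun_rec_nat) (intro assms pred rec_fun_proj | simp)+
  moreover have "rec_nat a (\<lambda>k r. (k # r # xs) ! 1 - Suc 0) m = a - m" for a m :: nat and xs
    by (induction m) auto
  ultimately show ?thesis by simp
qed

lemma rec_fun_triangle:
  assumes "rec_fun n f"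
  shows "rec_fun n (\<lambda>xs. triangle (f xs))"
proof -
  have "rec_fun n (\<lambda>xs. rec_nat 0 (\<lambda>k r. (k # r # xs) ! 1 + Suc ((k # r # xs) ! 0)) (f xs))"
    by (rule rec_fun_rec_nat) (intro assms rec_fun_add rec_fun_Suc rec_fun_proj rec_fun_const | simp)+
  moreover have "rec_nat 0 (\<lambda>k r. (k # r # xs) ! 1 + Suc ((k # r # xs) ! 0)) m = triangle m" for m xs
    by (induction m) auto
  ultimately show ?thesis by simp
qed

lemma rec_fun_prod_encode:
  "rec_fun n f \<Longrightarrow> rec_fun n g \<Longrightarrow> rec_fun n (\<lambda>xs. prod_encode (f xs, g xs))"
  unfolding prod_encode_def by (simp add: rec_fun_add rec_fun_triangle)

text \<open>\<open>prod_encode (m, n)\<close> is \<open>triangle (m + n) + m\<close>, so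
  \<open>m + n\<close> is the index of the diagonal containing \<open>z\<close>: the first
  \<open>k\<close> for which \<open>triangle (k + 1)\<close> exceeds \<open>z\<close>. Truncated
  subtraction turns this inequality into the zero that minimisation looks for.\<close>

lemma sum_prod_decode:
  "fst (prod_decode z) + snd (prod_decode z) = (LEAST k. Suc z - triangle (Suc k) = 0)"
proof -
  obtain m n where z: "z = prod_encode (m, n)"
    by (metis prod_decode_inverse surj_pair)
  have mono: "triangle i \<le> triangle j" if "i \<le> j" for i j
    using that by (induction rule: dec_induct) auto
  have "(LEAST k. Suc z - triangle (Suc k) = 0) = m + n"
  proof (rule Least_equality)
    show "Suc z - triangle (Suc (m + n)) = 0"
      by (simp add: z prod_encode_def)
    fix k assume k: "Suc z - triangle (Suc k) = 0"
    show "m + n \<le> k"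
    proof (rule ccontr)
      assume "\<not> m + n \<le> k"
      then have "triangle (Suc k) \<le> triangle (m + n)" by (intro mono) simp
      with k show False by (simp add: z prod_encode_def)
    qed
  qed
  then show ?thesis by (simp add: z)
qed

lemma rec_fun_prod_decode:
  assumes "rec_fun n f"
  shows "rec_fun n (\<lambda>xs. fst (prod_decode (f xs)))" "rec_fun n (\<lambda>xs. snd (prod_decode (f xs)))"
proof -
  let ?d = "\<lambda>xs. LEAST k. (\<lambda>ys. Suc (ys ! 1) - triangle (Suc (ys ! 0))) (k # xs) = 0"
  \<comment> \<open>Regularity of the minimisation: \<open>k = z\<close> is always large enough,
    since \<open>triangle (Suc z)\<close> is at least \<open>Suc z\<close>.\<close>
  have "\<exists>k. Suc ((k # xs) ! 1) - triangle (Suc ((k # xs) ! 0)) = 0" for xs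
    by (rule exI[of _ "xs ! 0"]) simp
  then have "rec_fun 1 ?d"
    by (intro rec_fun_mini rec_fun_diff rec_fun_Suc rec_fun_triangle rec_fun_proj) auto
  from rec_fun_comp1[OF this assms]
  have d: "rec_fun n (\<lambda>xs. fst (prod_decode (f xs)) + snd (prod_decode (f xs)))"
    by (simp add: sum_prod_decode)
  have f: "fst (prod_decode z) = z - triangle (fst (prod_decode z) + snd (prod_decode z))" for z
  proof -
    have "z = prod_encode (fst (prod_decode z), snd (prod_decode z))" by simp
    then show ?thesis unfolding prod_encode_def by (simp only: prod.case)
  qed
  from rec_fun_diff[OF assms rec_fun_triangle[OF d]]
  show *: "rec_fun n (\<lambda>xs. fst (prod_decode (f xs)))"
    by (simp add: f[symmetric])
  from rec_fun_diff[OF d *] show "rec_fun n (\<lambda>xs. snd (prod_decode (f xs)))"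
    by simp
qed

section \<open>Computability on coded data types\<close>

text \<open>Codings are bijections with the numbers, so no domain of valid codes has to be decided.
  The instances use the same pairing and list coding as \<open>system_code\<close>.\<close>

class coded =
  fixes enc :: "'a \<Rightarrow> nat" and dec :: "nat \<Rightarrow> 'a"
  assumes dec_enc [simp]: "dec (enc x) = x" and enc_dec [simp]: "enc (dec n) = n"

instantiation nat :: coded
begin
definition enc_nat_def [simp]: "enc = (id :: nat \<Rightarrow> nat)"
definition dec_nat_def [simp]: "dec = (id :: nat \<Rightarrow> nat)"
instance by standard simp_all
end

instantiation prod :: (coded, coded) coded
begin
definition "enc p = prod_encode (enc (fst p), enc (snd p))"
definition "dec n = (dec (fst (prod_decode n)), dec (snd (prod_decode n)))"
instance by standard (simp_all add: enc_prod_def dec_prod_def)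
end

instantiation list :: (coded) coded
begin
definition "enc xs = list_encode (map enc xs)"
definition "dec n = map dec (list_decode n)"
instance by standard (simp_all add: enc_list_def dec_list_def comp_def)
end

definition computable :: "('a::coded \<Rightarrow> 'b::coded) \<Rightarrow> bool" where
  "computable f \<longleftrightarrow> rec_fun 1 (\<lambda>xs. enc (f (dec (xs ! 0))))"

abbreviation decidable :: "('a::coded \<Rightarrow> bool) \<Rightarrow> bool" where
  "decidable P \<equiv> computable (\<lambda>x. of_bool (P x) :: nat)"

text \<open>Closure rules of the form \<open>computable f\<close> implies
  \<open>computable (\<lambda>x. F (f x))\<close>, so that \<open>intro comp\<close> proves
  computability by following the syntax of a term.\<close>

named_theorems comp

lemma computable_compose:
  assumes "computable f" "computable g"
  shows "computable (\<lambda>x. f (g x))"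
  using rec_fun_comp1[OF assms[unfolded computable_def]] by (simp add: computable_def)

lemma computable_id [comp]: "computable (\<lambda>x. x)"
  by (simp add: computable_def rec_fun_proj)

lemma computable_const [comp]: "computable (\<lambda>x. c)"
  by (simp add: computable_def rec_fun_const)

lemma computable_Pair [comp]: "computable f \<Longrightarrow> computable g \<Longrightarrow> computable (\<lambda>x. (f x, g x))"
  by (auto simp: computable_def enc_prod_def intro: rec_fun_prod_encode)

text \<open>Turns computability of an uncurried function into a closure rule with arbitrary
  computable arguments.\<close>

lemma computable_app2:
  assumes "computable (\<lambda>p. f (fst p) (snd p))" "computable a" "computable b"
  shows "computable (\<lambda>x. f (a x) (b x))"
  using computable_compose[OF assms(1) computable_Pair[OF assms(2,3)]] by simp

lemma computable_app3:
  assumes "computable (\<lambda>p. f (fst p) (fst (snd p)) (snd (snd p)))"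
    "computable a" "computable b" "computable c"
  shows "computable (\<lambda>x. f (a x) (b x) (c x))"
  using computable_compose[OF assms(1) computable_Pair[OF assms(2) computable_Pair[OF assms(3,4)]]]
  by simp

lemma computable_fst [comp]: "computable f \<Longrightarrow> computable (\<lambda>x. fst (f x))"
  using rec_fun_prod_decode(1)[of 1 "\<lambda>xs. enc (f (dec (xs ! 0)))"]
  by (simp add: computable_def enc_prod_def)

lemma computable_snd [comp]: "computable f \<Longrightarrow> computable (\<lambda>x. snd (f x))"
  using rec_fun_prod_decode(2)[of 1 "\<lambda>xs. enc (f (dec (xs ! 0)))"]
  by (simp add: computable_def enc_prod_def)

lemma computable_enc [comp]: "computable f \<Longrightarrow> computable (\<lambda>x. enc (f x))"
  by (simp add: computable_def)

lemma computable_dec [comp]: "computable f \<Longrightarrow> computable (\<lambda>x. dec (f x))"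
  by (simp add: computable_def)

lemma computable_Suc [comp]: "computable f \<Longrightarrow> computable (\<lambda>x. Suc (f x))"
  by (simp add: computable_def rec_fun_Suc)

lemma computable_add [comp]:
  "computable f \<Longrightarrow> computable g \<Longrightarrow> computable (\<lambda>x. f x + g x :: nat)"
  by (simp add: computable_def rec_fun_add)

lemma computable_diff [comp]:
  "computable f \<Longrightarrow> computable g \<Longrightarrow> computable (\<lambda>x. f x - g x :: nat)"
  by (simp add: computable_def rec_fun_diff)

lemma computable_recursive1:
  assumes "recursive 1 f" "computable g"
  shows "computable (\<lambda>x. f [g x])"
  using assms rec_fun_comp1[OF rec_fun_recursive[OF assms(1)]]
  by (simp add: computable_def)

lemma computable_recursive2:
  assumes "recursive 2 f" "computable g" "computable h"
  shows "computable (\<lambda>x. f [g x, h x])"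
  using assms rec_fun_comp2[OF rec_fun_recursive[OF assms(1)]]
  by (simp add: computable_def)

text \<open>Since \<open>computable\<close> speaks of unary functions, the parameter, the counter
  and the previous value are packed into one code before the step is applied.\<close>

lemma computable_rec_nat [comp]:
  assumes b: "computable b" and s: "computable (\<lambda>p. s (fst p) (fst (snd p)) (snd (snd p)))"
    and t: "computable t"
  shows "computable (\<lambda>x. rec_nat (b x) (s x) (t x))"
proof -
  let ?s = "\<lambda>p. s (fst p) (fst (snd p)) (snd (snd p))"
  let ?S = "\<lambda>ys. enc (s (dec (ys ! 2)) (ys ! 0) (dec (ys ! 1)))"
  have "rec_fun (Suc (Suc 1)) (\<lambda>ys. (\<lambda>xs. enc (?s (dec (xs ! 0))))
      [prod_encode (ys ! 2, prod_encode (ys ! 0, ys ! 1))])"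
    by (rule rec_fun_comp1[OF s[unfolded computable_def]])
      (use rec_fun_proj[of 0 2] in \<open>simp_all add: numeral_2_eq_2 rec_fun_prod_encode rec_fun_proj\<close>)
  then have "rec_fun (Suc (Suc 1)) ?S"
    by (simp add: dec_prod_def)
  from rec_fun_rec_nat[OF b[unfolded computable_def] this t[unfolded computable_def]]
  have "rec_fun 1 (\<lambda>xs. rec_nat (enc (b (dec (xs ! 0)))) (\<lambda>k r. ?S (k # r # xs)) (t (dec (xs ! 0))))"
    by simp
  moreover have "rec_nat (enc (b x)) (\<lambda>k r. ?S (k # r # xs)) m = enc (rec_nat (b x) (s x) m)"
    if "x = dec (xs ! 0)" for x xs m
    by (induction m) (auto simp: that)
  ultimately show ?thesis
    by (simp add: computable_def)
qed

lemma computable_if [comp]: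
  assumes "decidable P" "computable f" "computable g"
  shows "computable (\<lambda>x. if P x then f x else g x)"
proof -
  have "computable (\<lambda>x. rec_nat (g x) (\<lambda>_ _. f x) (of_bool (P x)))"
    by (intro comp assms computable_compose[OF assms(2)])
  moreover have "rec_nat (g x) (\<lambda>_ _. f x) (of_bool (P x)) = (if P x then f x else g x)" for x
    by simp
  ultimately show ?thesis by simp
qed

lemma decidable_not [comp]:
  assumes "decidable P" shows "decidable (\<lambda>x. \<not> P x)"
proof -
  have "computable (\<lambda>x. 1 - (of_bool (P x) :: nat))"
    by (intro comp assms)
  moreover have "1 - (of_bool (P x) :: nat) = of_bool (\<not> P x)" for x
    by simp
  ultimately show ?thesis by simp
qed

lemma decidable_le [comp]:
  fixes f g :: "'a::coded \<Rightarrow> nat"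
  assumes "computable f" "computable g"
  shows "decidable (\<lambda>x. f x \<le> g x)"
proof -
  have "computable (\<lambda>x. 1 - (f x - g x))"
    by (intro comp assms)
  moreover have "1 - (f x - g x) = of_bool (f x \<le> g x)" for x
    by simp
  ultimately show ?thesis by simp
qed

lemma computable_mult [comp]:
  fixes f g :: "'a::coded \<Rightarrow> nat"
  assumes "computable f" "computable g"
  shows "computable (\<lambda>x. f x * g x)"
proof -
  have "computable (\<lambda>x. rec_nat 0 (\<lambda>_ r. r + f x) (g x))"
    by (intro comp assms computable_compose[OF assms(1)])
  moreover have "rec_nat 0 (\<lambda>_ r. r + f x) m = f x * m" for x m
    by (induction m) auto
  ultimately show ?thesis by simp
qed

lemma decidable_conj [comp]:
  assumes "decidable P" "decidable Q"
  shows "decidable (\<lambda>x. P x \<and> Q x)"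
  unfolding of_bool_conj by (intro comp assms)

lemma decidable_disj [comp]:
  assumes "decidable P" "decidable Q" shows "decidable (\<lambda>x. P x \<or> Q x)"
proof -
  have "decidable (\<lambda>x. \<not> (\<not> P x \<and> \<not> Q x))" by (intro comp assms)
  then show ?thesis by simp
qed

lemma decidable_less [comp]:
  fixes f g :: "'a::coded \<Rightarrow> nat"
  assumes "computable f" "computable g"
  shows "decidable (\<lambda>x. f x < g x)"
  using decidable_le[OF computable_Suc[OF assms(1)] assms(2)] by (simp add: Suc_le_eq)

lemma decidable_eq_nat [comp]:
  fixes f g :: "'a::coded \<Rightarrow> nat"
  assumes "computable f" "computable g"
  shows "decidable (\<lambda>x. f x = g x)"
  using decidable_conj[OF decidable_le[OF assms] decidable_le[OF assms(2,1)]]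
  by (simp add: order.eq_iff[symmetric])

lemma computable_funpow [comp]:
  fixes f :: "'a::coded \<Rightarrow> 'b::coded \<Rightarrow> 'b"
  assumes "computable (\<lambda>p. f (fst p) (snd p))" "computable n" "computable a"
  shows "computable (\<lambda>x. (f x ^^ n x) (a x))"
proof -
  have "computable (\<lambda>x. rec_nat (a x) (\<lambda>_ r. f x r) (n x))"
    by (intro comp assms(2,3) computable_app2[OF assms(1)])
  moreover have "rec_nat (a x) (\<lambda>_ r. f x r) m = (f x ^^ m) (a x)" for x m
    by (induction m) auto
  ultimately show ?thesis by simp
qed

lemma computable_Cons [comp]: "computable f \<Longrightarrow> computable g \<Longrightarrow> computable (\<lambda>x. f x # g x)"
proof -
  assume fg: "computable f" "computable g"
  have "computable (\<lambda>x. dec (Suc (enc (enc (f x), enc (g x)))) :: 'b list)"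
    by (intro comp fg)
  moreover have "enc (a # as) = Suc (enc (enc a, enc as))" for a :: 'b and as
    by (simp add: enc_list_def enc_prod_def)
  then have "dec (Suc (enc (enc a, enc as))) = a # as" for a :: 'b and as
    by (metis dec_enc)
  ultimately show ?thesis by simp
qed

lemma computable_case_list [comp]:
  assumes n: "computable n" and c: "computable (\<lambda>p. c (fst p) (fst (snd p)) (snd (snd p)))"
    and l: "computable l"
  shows "computable (\<lambda>x. case l x of [] \<Rightarrow> n x | y # ys \<Rightarrow> c x y ys)"
proof -
  let ?y = "\<lambda>xs. dec (fst (dec (enc xs - 1) :: nat \<times> nat))"
  let ?ys = "\<lambda>xs. dec (snd (dec (enc xs - 1) :: nat \<times> nat))"
  have "computable (\<lambda>x. if enc (l x) = 0 then n x else c x (?y (l x)) (?ys (l x)))"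
    by (intro comp n l computable_app3[OF c])
  moreover have "(if enc (l x) = 0 then n x else c x (?y (l x)) (?ys (l x)))
     = (case l x of [] \<Rightarrow> n x | y # ys \<Rightarrow> c x y ys)" for x
    by (cases "l x") (simp_all add: enc_list_def dec_list_def dec_prod_def comp_def)
  ultimately show ?thesis by simp
qed

text \<open>Supplies a computable bound for the number of rounds needed to run through a
  list.\<close>

lemma length_le_enc: "length xs \<le> enc xs"
proof (induction xs)
  case (Cons a xs)
  then show ?case
    using le_prod_encode_2[of "enc xs" "enc a"] by (simp add: enc_list_def)
qed simp

text \<open>The fold is a loop on pairs (accumulator, rest of the list), run
  \<open>enc (l x)\<close> times; surplus rounds are harmless because a state with empty rest is
  fixed.\<close>

lemma computable_foldl [comp]:
  assumes f: "computable (\<lambda>p. f (fst p) (fst (snd p)) (snd (snd p)))"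
    and a: "computable a" and l: "computable l"
  shows "computable (\<lambda>x. foldl (f x) (a x) (l x))"
proof -
  let ?step = "\<lambda>x r. case snd r of [] \<Rightarrow> r | y # ys \<Rightarrow> (f x (fst r) y, ys)"
  have "computable (\<lambda>x. fst ((?step x ^^ enc (l x)) (a x, l x)))"
    by (intro comp a l computable_app3[OF f])
  moreover have "fst ((?step x ^^ n) (b, xs)) = foldl (f x) b xs" if "length xs \<le> n" for x n b xs
    using that
  proof (induction n arbitrary: b xs)
    case (Suc n)
    have nil: "(?step x ^^ m) (b, []) = (b, [])" for m b by (induction m) auto
    show ?case
    proof (cases xs)
      case Nil
      then show ?thesis using nil[of "Suc n" b] by simp
    next
      case (Cons y ys)
      then show ?thesis using Suc by (simp add: funpow_Suc_right del: funpow.simps)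
    qed
  qed simp
  ultimately show ?thesis by (simp add: length_le_enc)
qed

lemma computable_rev [comp]:
  assumes "computable l" shows "computable (\<lambda>x. rev (l x))"
proof -
  have "computable (\<lambda>x. foldl (\<lambda>a b. b # a) [] (l x))"
    by (intro comp assms)
  then show ?thesis by (simp add: foldl_conv_fold fold_Cons_rev)
qed

lemma computable_foldr [comp]:
  assumes f: "computable (\<lambda>p. f (fst p) (fst (snd p)) (snd (snd p)))"
    and l: "computable l" and a: "computable a"
  shows "computable (\<lambda>x. foldr (f x) (l x) (a x))"
  unfolding foldr_conv_foldl
  by (intro comp a l computable_app3[OF f])

lemma computable_append [comp]:
  assumes "computable f" "computable g" shows "computable (\<lambda>x. f x @ g x)"
proof -
  have "computable (\<lambda>x. foldr (#) (f x) (g x))"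
    by (intro comp assms)
  moreover have "foldr (#) xs ys = xs @ ys" for xs ys :: "'b list"
    by (induction xs) auto
  ultimately show ?thesis by simp
qed

lemma computable_map [comp]:
  assumes "computable (\<lambda>p. f (fst p) (snd p))" "computable l"
  shows "computable (\<lambda>x. map (f x) (l x))"
proof -
  have "computable (\<lambda>x. foldr (\<lambda>a r. f x a # r) (l x) [])"
    by (intro comp assms(2) computable_app2[OF assms(1)])
  moreover have "foldr (\<lambda>a r. f x a # r) xs [] = map (f x) xs" for x xs
    by (induction xs) auto
  ultimately show ?thesis by simp
qed

lemma computable_filter [comp]:
  assumes "decidable (\<lambda>p. P (fst p) (snd p))" "computable l"
  shows "computable (\<lambda>x. filter (P x) (l x))"
proof -
  have "computable (\<lambda>x. foldr (\<lambda>a r. if P x a then a # r else r) (l x) [])"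
    by (intro comp assms(2) computable_app2[OF assms(1)])
  moreover have "foldr (\<lambda>a r. if P x a then a # r else r) xs [] = filter (P x) xs" for x xs
    by (induction xs) auto
  ultimately show ?thesis by simp
qed

lemma computable_concat [comp]: "computable f \<Longrightarrow> computable (\<lambda>x. concat (f x))"
  unfolding concat_conv_foldr by (intro comp)

lemma computable_length [comp]:
  assumes "computable f" shows "computable (\<lambda>x. length (f x))"
proof -
  have "computable (\<lambda>x. foldr (\<lambda>_ n. Suc n) (f x) 0)"
    by (intro comp assms)
  moreover have "foldr (\<lambda>_ n. Suc n) xs 0 = length xs" for xs :: "'b list"
    by (induction xs) auto
  ultimately show ?thesis by simp
qed

lemma computable_tl [comp]: "computable f \<Longrightarrow> computable (\<lambda>x. tl (f x))"
  unfolding tl_def by (intro comp)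

lemma computable_drop [comp]:
  assumes "computable n" "computable f" shows "computable (\<lambda>x. drop (n x) (f x))"
proof -
  have "computable (\<lambda>x. (tl ^^ n x) (f x))"
    by (intro comp assms)
  moreover have "(tl ^^ n) xs = drop n xs" for n and xs :: "'b list"
    by (induction n) (auto simp: drop_Suc tl_drop)
  ultimately show ?thesis by simp
qed

lemma computable_upt [comp]:
  assumes "computable n" shows "computable (\<lambda>x. [0..<n x])"
proof -
  have "computable (\<lambda>x. rec_nat [] (\<lambda>k r. r @ [k]) (n x))"
    by (intro comp assms)
  moreover have "rec_nat [] (\<lambda>k r. r @ [k]) m = [0..<m]" for m
    by (induction m) auto
  ultimately show ?thesis by simp
qed

lemma computable_replicate [comp]:
  assumes "computable n" "computable f" shows "computable (\<lambda>x. replicate (n x) (f x))"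
proof -
  have "computable (\<lambda>x. map (\<lambda>_. f x) [0..<n x])"
    by (intro comp assms(1) computable_compose[OF assms(2)])
  moreover have "map (\<lambda>_. f x) [0..<m] = replicate m (f x)" for m x
    by (induction m) (auto simp: replicate_append_same)
  ultimately show ?thesis by simp
qed

text \<open>For finite families of functions that are fixed outside the computation, such as the
  defining equations of the group.\<close>

lemma computable_map_fixed:
  assumes "\<And>F. F \<in> set Fs \<Longrightarrow> computable (F :: 'a::coded \<Rightarrow> 'b::coded)"
  shows "computable (\<lambda>x. map (\<lambda>F. F x) Fs)"
  using assms by (induction Fs) (auto intro!: comp)

lemma decidable_list_all [comp]:
  assumes "decidable (\<lambda>p. P (fst p) (snd p))" "computable l"
  shows "decidable (\<lambda>x. list_all (P x) (l x))"
proof -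
  have "decidable (\<lambda>x. length (filter (P x) (l x)) = length (l x))"
    by (intro comp assms)
  moreover have "length (filter (P x) xs) = length xs \<longleftrightarrow> list_all (P x) xs" for x xs
    using length_filter_less[of _ xs "P x"] by (auto simp: list_all_iff less_le)
  ultimately show ?thesis by simp
qed

lemma decidable_list_ex [comp]:
  assumes "decidable (\<lambda>p. P (fst p) (snd p))" "computable l"
  shows "decidable (\<lambda>x. list_ex (P x) (l x))"
proof -
  have "decidable (\<lambda>x. 0 < length (filter (P x) (l x)))"
    by (intro comp assms)
  then show ?thesis by (simp add: list_ex_iff filter_empty_conv)
qed

lemma computable_nth_default [comp]:
  assumes "computable n" "computable f"
  shows "computable (\<lambda>x. nth_default d (f x) (n x))"
proof -
  have "computable (\<lambda>x. case drop (n x) (f x) of [] \<Rightarrow> d | y # _ \<Rightarrow> y)"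
    by (intro comp assms)
  moreover have "(case drop m xs of [] \<Rightarrow> d | y # _ \<Rightarrow> y) = nth_default d xs m" for m xs
    by (auto simp: nth_default_def hd_drop_conv_nth[symmetric] split: list.split)
  ultimately show ?thesis by simp
qed

section \<open>Elimination of quantifiers\<close>

text \<open>If the field were finite, the product of all \<open>X - a\<close>, increased by 1, would
  be a nonconstant polynomial without roots.\<close>

lemma infinite_UNIV_alg_closed: "infinite (UNIV :: 'r::alg_closed_field set)"
proof
  assume fin: "finite (UNIV :: 'r set)"
  define p where "p = (\<Prod>a\<in>UNIV. [:-a, 1:]) + (1 :: 'r poly)"
  have deg: "degree (\<Prod>a\<in>UNIV. [:-a, 1::'r:]) = card (UNIV :: 'r set)"
    by (subst degree_prod_eq_sum_degree) auto
  have "0 < card (UNIV :: 'r set)" using fin by (simp add: card_gt_0_iff)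
  then have "degree p > 0"
    unfolding p_def using deg by (subst degree_add_eq_left) auto
  then obtain x where "poly p x = 0"
    using alg_closed_imp_poly_has_root by blast
  moreover have "poly (\<Prod>a\<in>UNIV. [:-a, 1:]) x = 0"
    unfolding poly_prod using fin by (auto intro!: bexI[of _ x])
  ultimately show False by (simp add: p_def)
qed

lemma ex_nonzero_value:
  fixes p :: "'r::alg_closed_field poly"
  assumes "p \<noteq> 0" shows "\<exists>x. poly p x \<noteq> 0"
proof (rule ccontr)
  assume "\<not> ?thesis"
  then have "{x. poly p x = 0} = UNIV" by auto
  then show False by (metis assms infinite_UNIV_alg_closed poly_roots_finite)
qed

text \<open>The polynomial \<open>p\<close> splits into \<open>degree p\<close> linear factors, each
  of which divides \<open>g\<close>.\<close>

lemma dvd_power_degree: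
  fixes p g :: "'r::alg_closed_field poly"
  assumes "p \<noteq> 0" "\<And>x. poly p x = 0 \<Longrightarrow> poly g x = 0"
  shows "p dvd g ^ degree p"
  using assms
proof (induction "degree p" arbitrary: p)
  case 0
  then have "is_unit p" by (simp add: is_unit_iff_degree)
  then show ?case by (rule unit_imp_dvd)
next
  case (Suc n)
  then obtain c where c: "poly p c = 0"
    using alg_closed_imp_poly_has_root[of p] by auto
  then obtain q where q: "p = [:-c, 1:] * q"
    by (auto simp: poly_eq_0_iff_dvd)
  have "q \<noteq> 0" using q Suc.prems by auto
  have "degree p = Suc (degree q)"
    unfolding q using \<open>q \<noteq> 0\<close> by (subst degree_mult_eq) auto
  then have n: "n = degree q" using Suc.hyps by simp
  have "q dvd g ^ degree q"
    by (rule Suc.hyps(1)[OF n \<open>q \<noteq> 0\<close>]) (use Suc.prems q in auto)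
  moreover have "[:-c, 1:] dvd g"
    using Suc.prems(2)[OF c] by (simp add: poly_eq_0_iff_dvd)
  ultimately have "[:-c, 1:] * q dvd g * g ^ degree q"
    by (rule mult_dvd_mono[rotated])
  then show ?case
    using q \<open>degree p = Suc (degree q)\<close> by simp
qed

text \<open>
  Multivariate polynomials are lists of terms (coefficient, exponents); univariate polynomials
  over them are lists of coefficients, the leading one first.
\<close>

type_synonym mpoly = "(nat \<times> nat list) list"
type_synonym upoly = "mpoly list"

section \<open>Term lists and the separation of one variable\<close>

text \<open>Exponent lists are understood as continued by zeros. Thus the number of variables is
  never fixed, and one monomial has many representations.\<close>

definition mono :: "(nat \<Rightarrow> 'r::comm_semiring_1) \<Rightarrow> nat list \<Rightarrow> 'r" where
  "mono \<sigma> e = (\<Prod>i<length e. \<sigma> i ^ (e ! i))"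

lemma mono_eq:
  assumes "length e \<le> n"
  shows "mono \<sigma> e = (\<Prod>i<n. \<sigma> i ^ nth_default 0 e i)"
  unfolding mono_def
  by (rule prod.mono_neutral_cong_left) (use assms in \<open>auto simp: nth_default_def\<close>)

lemma mono_split: "mono \<sigma> e = \<sigma> 0 ^ nth_default 0 e 0 * mono (\<lambda>i. \<sigma> (Suc i)) (tl e)"
proof (cases e)
  case Nil
  then show ?thesis by (simp add: mono_def)
next
  case (Cons k e')
  then show ?thesis by (simp add: mono_def prod.lessThan_Suc_shift del: prod.lessThan_Suc)
qed

definition expo_add :: "nat list \<Rightarrow> nat list \<Rightarrow> nat list" where
  "expo_add e f = map (\<lambda>i. nth_default 0 e i + nth_default 0 f i) [0..<length e + length f]"

lemma mono_expo_add: "mono \<sigma> (expo_add e f) = mono \<sigma> e * mono \<sigma> f"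
proof -
  have "mono \<sigma> (expo_add e f)
      = (\<Prod>i<length e + length f. \<sigma> i ^ (nth_default 0 e i + nth_default 0 f i))"
    by (subst mono_eq[of _ "length e + length f"])
      (auto simp: expo_add_def nth_default_def intro!: prod.cong)
  also have "\<dots> = mono \<sigma> e * mono \<sigma> f"
    by (simp add: mono_eq[of e "length e + length f"] mono_eq[of f "length e + length f"]
        power_add prod.distrib)
  finally show ?thesis .
qed

definition term_split :: "mpoly \<Rightarrow> nat \<Rightarrow> mpoly" where
  "term_split p i = map (\<lambda>m. (fst m, tl (snd m))) (filter (\<lambda>m. nth_default 0 (snd m) 0 = i) p)"

text \<open>The sum of all exponents of variable 0 is used as a bound for the degree, so leading
  coefficients may well be zero; the elimination allows for this.\<close>

definition usplit :: "mpoly \<Rightarrow> upoly" where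
  "usplit p = map (term_split p)
     (rev [0..<Suc (foldr (\<lambda>m d. nth_default 0 (snd m) 0 + d) p 0)])"

text \<open>Horner's scheme in the first variable: the accumulated polynomial is multiplied by it,
  and the next coefficient, with its variables shifted up, is added.\<close>

definition unsplit :: "upoly \<Rightarrow> mpoly" where
  "unsplit u = foldl (\<lambda>p a. map (\<lambda>m. (fst m, Suc (nth_default 0 (snd m) 0) # tl (snd m))) p @
     map (\<lambda>m. (fst m, 0 # snd m)) a) [] u"

primrec hpoly :: "'r::comm_ring_1 list \<Rightarrow> 'r poly" where
  "hpoly [] = 0"
| "hpoly (c # cs) = monom c (length cs) + hpoly cs"

lemma coeff_hpoly:
  "coeff (hpoly cs) i = (if i < length cs then cs ! (length cs - 1 - i) else 0)"
proof (induction cs)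
  case (Cons c cs)
  consider "i < length cs" | "i = length cs" | "i > length cs" by linarith
  then show ?case
  proof cases
    case 1
    then have "(c # cs) ! (length cs - i) = cs ! (length cs - 1 - i)"
      by (subst nth_Cons_pos) auto
    with 1 Cons show ?thesis by simp
  qed (use Cons in simp_all)
qed simp

lemma degree_hpoly: "degree (hpoly cs) \<le> length cs - 1"
  by (rule degree_le) (auto simp: coeff_hpoly)

lemma hpoly_snoc: "hpoly (cs @ [c]) = hpoly cs * [:0, 1:] + [:c:]"
  by (rule poly_eqI) (auto simp: coeff_hpoly coeff_pCons nth_append split: nat.split)

lemma hpoly_eq_0_iff: "hpoly cs = 0 \<longleftrightarrow> (\<forall>c\<in>set cs. c = 0)"
proof
  assume 0: "hpoly cs = 0"
  show "\<forall>c\<in>set cs. c = 0"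
  proof
    fix c assume "c \<in> set cs"
    then obtain j where j: "j < length cs" "c = cs ! j" by (auto simp: in_set_conv_nth)
    have "coeff (hpoly cs) (length cs - 1 - j) = c"
      using j by (simp add: coeff_hpoly)
    with 0 show "c = 0" by simp
  qed
qed (induction cs, auto)

text \<open>The operations on codes obey the ring laws only after applying \<open>\<nu>\<close>,
  since an element may have several codes.\<close>

locale coded_ring =
  fixes \<nu> :: "nat \<Rightarrow> 'r::comm_ring_1"
    and cadd cmul :: "nat \<Rightarrow> nat \<Rightarrow> nat" and cneg :: "nat \<Rightarrow> nat" and czero cunit :: nat
  assumes \<nu>_add: "\<nu> (cadd a b) = \<nu> a + \<nu> b"
    and \<nu>_mul: "\<nu> (cmul a b) = \<nu> a * \<nu> b"
    and \<nu>_neg: "\<nu> (cneg a) = - \<nu> a"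
    and \<nu>_zero: "\<nu> czero = 0"
    and \<nu>_one: "\<nu> cunit = 1"
begin

definition ev :: "(nat \<Rightarrow> 'r) \<Rightarrow> mpoly \<Rightarrow> 'r" where
  "ev \<sigma> p = (\<Sum>m\<leftarrow>p. \<nu> (fst m) * mono \<sigma> (snd m))"

definition mneg :: "mpoly \<Rightarrow> mpoly" where
  "mneg p = map (\<lambda>m. (cneg (fst m), snd m)) p"

definition mmul :: "mpoly \<Rightarrow> mpoly \<Rightarrow> mpoly" where
  "mmul p q = concat (map (\<lambda>m. map (\<lambda>m'. (cmul (fst m) (fst m'), expo_add (snd m) (snd m'))) q) p)"

definition mconst :: "nat \<Rightarrow> mpoly" where
  "mconst c = [(c, [])]"

lemma ev_Nil [simp]: "ev \<sigma> [] = 0"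
  by (simp add: ev_def)

lemma ev_Cons: "ev \<sigma> (m # p) = \<nu> (fst m) * mono \<sigma> (snd m) + ev \<sigma> p"
  by (simp add: ev_def)

lemma ev_append [simp]: "ev \<sigma> (p @ q) = ev \<sigma> p + ev \<sigma> q"
  by (simp add: ev_def)

lemma ev_mneg [simp]: "ev \<sigma> (mneg p) = - ev \<sigma> p"
  by (induction p) (auto simp: mneg_def ev_Cons \<nu>_neg)

lemma ev_mmul [simp]: "ev \<sigma> (mmul p q) = ev \<sigma> p * ev \<sigma> q"
proof (induction p)
  case (Cons m p)
  have "ev \<sigma> (map (\<lambda>m'. (cmul (fst m) (fst m'), expo_add (snd m) (snd m'))) q)
      = \<nu> (fst m) * mono \<sigma> (snd m) * ev \<sigma> q"
    by (induction q) (auto simp: ev_Cons \<nu>_mul mono_expo_add algebra_simps)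
  with Cons show ?case
    by (simp add: mmul_def ev_Cons algebra_simps)
qed (simp add: mmul_def)

lemma ev_mconst [simp]: "ev \<sigma> (mconst c) = \<nu> c"
  by (simp add: mconst_def ev_Cons mono_def)

definition uev :: "(nat \<Rightarrow> 'r) \<Rightarrow> upoly \<Rightarrow> 'r poly" where
  "uev \<tau> u = hpoly (map (ev \<tau>) u)"

text \<open>Each term is collected at exactly one index, its own exponent of variable 0, and the
  bound in \<open>usplit\<close> exceeds all these exponents.\<close>

lemma poly_uev_usplit:
  "poly (uev (\<lambda>i. \<sigma> (Suc i)) (usplit p)) (\<sigma> 0) = ev \<sigma> p"
proof -
  let ?\<tau> = "\<lambda>i. \<sigma> (Suc i)"
  let ?e = "\<lambda>m :: nat \<times> nat list. nth_default 0 (snd m) 0"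
  let ?D = "foldr (\<lambda>m d. ?e m + d) p 0"
  have 1: "poly (hpoly (map f (rev [0..<n]))) x = (\<Sum>i<n. f i * x ^ i)" for f :: "nat \<Rightarrow> 'r" and n x
    by (induction n) (auto simp: poly_monom algebra_simps)
  have 2: "?e m < Suc ?D" if "m \<in> set p" for m
    using that by (induction p) (auto simp: less_Suc_eq_le)
  have 3: "(\<Sum>i<n. ev ?\<tau> (term_split p i) * \<sigma> 0 ^ i) = ev \<sigma> p" if "\<And>m. m \<in> set p \<Longrightarrow> ?e m < n" for n
    using that
  proof (induction p)
    case (Cons m p)
    have "ev ?\<tau> (term_split (m # p) i) = (if ?e m = i then \<nu> (fst m) * mono ?\<tau> (tl (snd m)) else 0)
        + ev ?\<tau> (term_split p i)" for i
      by (simp add: term_split_def ev_Cons)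
    then have "(\<Sum>i<n. ev ?\<tau> (term_split (m # p) i) * \<sigma> 0 ^ i)
       = (\<Sum>i<n. (if ?e m = i then \<nu> (fst m) * mono ?\<tau> (tl (snd m)) * \<sigma> 0 ^ i else 0))
         + (\<Sum>i<n. ev ?\<tau> (term_split p i) * \<sigma> 0 ^ i)"
      by (subst sum.distrib[symmetric]) (auto intro!: sum.cong simp: algebra_simps)
    also have "(\<Sum>i<n. (if ?e m = i then \<nu> (fst m) * mono ?\<tau> (tl (snd m)) * \<sigma> 0 ^ i else 0))
       = \<nu> (fst m) * mono \<sigma> (snd m)"
      using Cons.prems[of m] by (simp add: mono_split[of \<sigma> "snd m"] mult_ac)
    finally show ?case using Cons by (simp add: ev_Cons)
  qed (simp add: term_split_def)
  show ?thesis
    unfolding uev_def usplit_def map_map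
    using 1[of "ev ?\<tau> \<circ> term_split p" "Suc ?D" "\<sigma> 0"] 3[OF 2] by (simp del: upt_Suc)
qed

lemma ev_unsplit: "ev \<sigma> (unsplit u) = poly (uev (\<lambda>i. \<sigma> (Suc i)) u) (\<sigma> 0)"
proof (induction u rule: rev_induct)
  case (snoc a u)
  have 1: "ev \<sigma> (map (\<lambda>m. (fst m, Suc (nth_default 0 (snd m) 0) # tl (snd m))) p) = \<sigma> 0 * ev \<sigma> p" for p
    by (induction p) (auto simp: ev_Cons mono_split[of \<sigma>] algebra_simps)
  have 2: "ev \<sigma> (map (\<lambda>m. (fst m, 0 # snd m)) p) = ev (\<lambda>i. \<sigma> (Suc i)) p" for p
    by (induction p) (auto simp: ev_Cons mono_split[of \<sigma> "0 # _"])
  from snoc show ?case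
    by (simp add: unsplit_def uev_def hpoly_snoc 1 2)
qed (simp add: unsplit_def uev_def)

section \<open>Pseudo-division\<close>

text \<open>One step of pseudo-division by \<open>a # p\<close>: \<open>a\<close> times the dividend
  minus \<open>b\<close> times a shift of the divisor. Leading coefficients come first, so the shift
  amounts to padding \<open>p\<close> with zeros at its end, and the cancelled head is simply
  dropped. Lengths of lists thus play the part of degrees.\<close>

definition ured :: "mpoly \<Rightarrow> upoly \<Rightarrow> upoly \<Rightarrow> upoly" where
  "ured a p u = (case u of [] \<Rightarrow> [] | b # q \<Rightarrow> if length q < length p then u
     else map (\<lambda>i. mmul a (nth_default [] q i) @ mneg (mmul b (nth_default [] p i))) [0..<length q])"

lemma length_ured: "length u > length p \<Longrightarrow> length (ured a p u) = length u - 1"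
  by (auto simp: ured_def split: list.split)

lemma ured_short: "length u \<le> length p \<Longrightarrow> ured a p u = u"
  by (auto simp: ured_def split: list.split)

lemma uev_ured:
  assumes "length p \<le> length q"
  shows "uev \<tau> (ured a p (b # q)) = smult (ev \<tau> a) (uev \<tau> (b # q))
           - monom (ev \<tau> b) (length q - length p) * uev \<tau> (a # p)"
proof (rule poly_eqI)
  fix i
  let ?l = "length q" and ?k = "length p"
  have nd: "ev \<tau> (nth_default [] v j) = nth_default 0 (map (ev \<tau>) v) j" for v j
    by (simp add: nth_default_def)
  have "coeff (uev \<tau> (ured a p (b # q))) i =
    (if i < ?l then ev \<tau> a * ev \<tau> (q ! (?l - 1 - i)) -
       (if ?l - 1 - i < ?k then ev \<tau> b * ev \<tau> (p ! (?l - 1 - i)) else 0) else 0)"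
    using assms diff_less[of "Suc i" ?l] by (auto simp: ured_def uev_def coeff_hpoly nth_default_def)
  also have "\<dots> = coeff (smult (ev \<tau> a) (uev \<tau> (b # q))
           - monom (ev \<tau> b) (length q - length p) * uev \<tau> (a # p)) i"
  proof -
    have c1: "coeff (uev \<tau> (b # q)) i = (if i < ?l then ev \<tau> (q ! (?l - 1 - i))
        else if i = ?l then ev \<tau> b else 0)"
      by (auto simp: uev_def coeff_hpoly)
    \<comment> \<open>The shift aligns both coefficient lists at their heads, which is why
      \<open>p\<close> and \<open>q\<close> are read at the same position
      \<open>?l - 1 - i\<close>.\<close>
    have c2: "coeff (monom (ev \<tau> b) (?l - ?k) * uev \<tau> (a # p)) i =
       (if i < ?l - ?k then 0 else if i < ?l then ev \<tau> b * ev \<tau> (p ! (?l - 1 - i))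
         else if i = ?l then ev \<tau> b * ev \<tau> a else 0)"
    proof (cases "i < ?l - ?k")
      case True
      then show ?thesis by (simp add: coeff_monom_mult)
    next
      case False
      have "?k - 1 - (i - (?l - ?k)) = ?l - 1 - i" if "i < ?l"
        using False assms that by linarith
      moreover have "i + ?k - ?l < ?k" if "i < ?l"
        using False assms that by linarith
      ultimately show ?thesis
        using False assms by (auto simp: coeff_monom_mult uev_def coeff_hpoly)
    qed
    show ?thesis
      unfolding coeff_diff coeff_smult c1 c2 using assms by (auto simp: mult.commute)
  qed
  finally show "coeff (uev \<tau> (ured a p (b # q))) i = coeff (smult (ev \<tau> a) (uev \<tau> (b # q))
           - monom (ev \<tau> b) (length q - length p) * uev \<tau> (a # p)) i" .
qed

text \<open>Each round shortens the dividend until it is no longer than \<open>p\<close>, after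
  which \<open>ured\<close> leaves it alone; hence \<open>length u\<close> rounds suffice.\<close>

definition urem :: "mpoly \<Rightarrow> upoly \<Rightarrow> upoly \<Rightarrow> upoly" where
  "urem a p u = (ured a p ^^ length u) u"

lemma length_urem: "length (urem a p u) \<le> length p"
proof -
  have "length ((ured a p ^^ n) u) \<le> max (length p) (length u - n)" for n
  proof (induction n)
    case (Suc n)
    let ?v = "(ured a p ^^ n) u"
    show ?case
      using Suc length_ured[of p ?v a] ured_short[of ?v p a]
      by (cases "length ?v > length p") auto
  qed simp
  from this[of "length u"] show ?thesis by (simp add: urem_def)
qed

text \<open>The pseudo-remainder is congruent to a power of the leading coefficient times the
  dividend. The exponent and the quotient may depend on \<open>\<tau>\<close>; only their existence
  is used.\<close>

lemma uev_urem: "\<exists>k Q. uev \<tau> (urem a p u) = smult (ev \<tau> a ^ k) (uev \<tau> u) - Q * uev \<tau> (a # p)"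
proof -
  have "\<exists>k Q. uev \<tau> ((ured a p ^^ n) u) = smult (ev \<tau> a ^ k) (uev \<tau> u) - Q * uev \<tau> (a # p)" for n
  proof (induction n)
    case 0
    have "uev \<tau> ((ured a p ^^ 0) u) = smult (ev \<tau> a ^ 0) (uev \<tau> u) - 0 * uev \<tau> (a # p)"
      by simp
    then show ?case by blast
  next
    case (Suc n)
    let ?v = "(ured a p ^^ n) u"
    obtain k Q where IH: "uev \<tau> ?v = smult (ev \<tau> a ^ k) (uev \<tau> u) - Q * uev \<tau> (a # p)"
      using Suc by blast
    show ?case
    proof (cases "length ?v \<le> length p")
      case True
      then show ?thesis using IH by (auto simp: ured_short)
    next
      case False
      then obtain b q where v: "?v = b # q" "length p \<le> length q" by (cases ?v) auto
      have "uev \<tau> ((ured a p ^^ Suc n) u)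
          = smult (ev \<tau> a) (uev \<tau> ?v) - monom (ev \<tau> b) (length q - length p) * uev \<tau> (a # p)"
        using uev_ured[OF v(2), of \<tau> a b] v(1) by simp
      also have "\<dots> = smult (ev \<tau> a ^ Suc k) (uev \<tau> u) - (smult (ev \<tau> a) Q
            + monom (ev \<tau> b) (length q - length p)) * uev \<tau> (a # p)"
        unfolding IH by (simp add: algebra_simps smult_diff_right)
      finally show ?thesis by blast
    qed
  qed
  then show ?thesis by (simp add: urem_def)
qed

definition mpower :: "mpoly \<Rightarrow> nat \<Rightarrow> mpoly" where
  "mpower g n = (mmul g ^^ n) (mconst cunit)"

lemma ev_mpower [simp]: "ev \<sigma> (mpower g n) = ev \<sigma> g ^ n"
  by (induction n) (auto simp: mpower_def \<nu>_one)

section \<open>Elimination of one variable\<close>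

text \<open>All inequations are multiplied into a single one, as is possible in a field. In a state,
  the \<open>conj\<close> collects conditions on the remaining variables, the \<open>mpoly\<close>
  is an inequation that may still contain the eliminated variable, and the \<open>upoly\<close> list
  holds the equations in that variable.\<close>

type_synonym conj = "mpoly list \<times> mpoly"
type_synonym state = "conj \<times> mpoly \<times> upoly list"

definition sat :: "(nat \<Rightarrow> 'r) \<Rightarrow> conj \<Rightarrow> bool" where
  "sat \<sigma> C \<longleftrightarrow> (\<forall>p\<in>set (fst C). ev \<sigma> p = 0) \<and> ev \<sigma> (snd C) \<noteq> 0"

definition holds :: "(nat \<Rightarrow> 'r) \<Rightarrow> state \<Rightarrow> bool" where
  "holds \<tau> s \<longleftrightarrow> sat \<tau> (fst s) \<and>
     (\<exists>x. (\<forall>p\<in>set (snd (snd s)). poly (uev \<tau> p) x = 0) \<and> ev (case_nat x \<tau>) (fst (snd s)) \<noteq> 0)"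

text \<open>
  The first equation is made shorter when its leading coefficient vanishes, and otherwise serves
  to reduce the second one. A single equation \<open>p = 0\<close> with nonvanishing leading coefficient is
  compatible with \<open>g \<noteq> 0\<close> iff \<open>p\<close> does not divide \<open>g ^ degree p\<close>.
\<close>

definition step :: "state \<Rightarrow> state list" where
  "step s = (let C = fst s; g = fst (snd s) in
     case snd (snd s) of [] \<Rightarrow> [s] | P # ps \<Rightarrow>
     (case P of [] \<Rightarrow> [(C, g, ps)] | a # p \<Rightarrow>
       (case ps of
         [] \<Rightarrow> [((a # fst C, snd C), g, [p]),
                ((fst C, mmul a (snd C)), unsplit (urem a p (usplit (mpower g (length p)))), [])]
       | q # qs \<Rightarrow> if length q \<le> length p then [(C, g, q # P # qs)] else
           [((a # fst C, snd C), g, p # q # qs),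
            ((fst C, mmul a (snd C)), g, P # ured a p q # qs)])))"

definition size_bound :: "upoly list \<Rightarrow> nat" where
  "size_bound ps = foldr (\<lambda>p n. Suc (length p) + n) ps 0"

text \<open>Doubling the size leaves room for one extra unit, which pays for exchanging the first
  two equations when the first is longer.\<close>

definition state_rank :: "upoly list \<Rightarrow> nat" where
  "state_rank ps = 2 * size_bound ps + (case ps of p # q # _ \<Rightarrow> of_bool (length q < length p) | _ \<Rightarrow> 0)"

lemma state_rank_le: "state_rank ps \<le> 2 * size_bound ps + 1"
  by (auto simp: state_rank_def split: list.split)

text \<open>An exchange loses the extra unit; every other move removes at least 2 from the doubled
  size and regains at most 1. Truncated subtraction covers finished states, which
  \<open>step\<close> keeps.\<close>

lemma state_rank_step:
  assumes "s' \<in> set (step s)"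
  shows "state_rank (snd (snd s')) \<le> state_rank (snd (snd s)) - 1"
proof -
  obtain C g ps where s: "s = (C, g, ps)" by (cases s) auto
  show ?thesis
  proof (cases ps)
    case Nil
    then show ?thesis using assms by (simp add: s step_def state_rank_def size_bound_def)
  next
    case ps: (Cons P qs)
    show ?thesis
    proof (cases P)
      case Nil
      have "state_rank qs \<le> 2 * size_bound qs + 1"
        by (rule state_rank_le)
      then show ?thesis using assms
        by (auto simp: s ps Nil step_def size_bound_def state_rank_def[of "[] # qs"])
    next
      case P: (Cons a p)
      show ?thesis
      proof (cases qs)
        case Nil
        then show ?thesis using assms
          by (auto simp: s ps P step_def state_rank_def size_bound_def)
      next
        case qs: (Cons q rs)
        show ?thesis
          using assms state_rank_le[of "p # q # rs"] state_rank_le[of "(a # p) # ured a p q # rs"]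
          by (auto simp: s ps P qs step_def size_bound_def length_ured state_rank_def[of "_ # _ # _"]
              split: if_splits)
      qed
    qed
  qed
qed

definition steps :: "state list \<Rightarrow> state list" where
  "steps L = concat (map step L)"

lemma state_rank_steps:
  assumes "s' \<in> set ((steps ^^ n) L)" "\<And>s. s \<in> set L \<Longrightarrow> state_rank (snd (snd s)) \<le> n"
  shows "snd (snd s') = []"
proof -
  have "s' \<in> set ((steps ^^ k) L) \<Longrightarrow> state_rank (snd (snd s')) \<le> n - k" for k s'
  proof (induction k arbitrary: s')
    case (Suc k)
    then have "s' \<in> set (steps ((steps ^^ k) L))" by simp
    then obtain s where s: "s \<in> set ((steps ^^ k) L)" "s' \<in> set (step s)"
      unfolding steps_def[of "(steps ^^ k) L"] set_concat set_map by blast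
    from state_rank_step[OF s(2)] Suc.IH[OF s(1)] show ?case by linarith
  qed (use assms(2) in simp)
  from this[OF assms(1)] have "state_rank (snd (snd s')) = 0" by simp
  then show ?thesis
    by (cases "snd (snd s')") (auto simp: state_rank_def size_bound_def)
qed

end

locale coded_field = coded_ring \<nu> cadd cmul cneg czero cunit
  for \<nu> :: "nat \<Rightarrow> 'r::alg_closed_field" and cadd cmul cneg czero cunit
begin

text \<open>Without equations left, a nonvanishing point exists iff the polynomial is nonzero, the
  field being infinite.\<close>

lemma holds_final:
  "(\<exists>x. ev (case_nat x \<tau>) g \<noteq> 0) \<longleftrightarrow> (\<exists>c\<in>set (usplit g). ev \<tau> c \<noteq> 0)"
proof -
  have "(\<exists>x. ev (case_nat x \<tau>) g \<noteq> 0) \<longleftrightarrow> (\<exists>x. poly (uev \<tau> (usplit g)) x \<noteq> 0)"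
    using poly_uev_usplit[of "case_nat _ \<tau>" g] by simp
  also have "\<dots> \<longleftrightarrow> uev \<tau> (usplit g) \<noteq> 0"
    using ex_nonzero_value[of "uev \<tau> (usplit g)"] by (cases "uev \<tau> (usplit g) = 0") auto
  also have "\<dots> \<longleftrightarrow> (\<exists>c\<in>set (usplit g). ev \<tau> c \<noteq> 0)"
    by (simp add: uev_def hpoly_eq_0_iff)
  finally show ?thesis .
qed

text \<open>With \<open>P\<close> and \<open>G\<close> the values of \<open>a # p\<close> and
  \<open>g\<close>, the remainder \<open>r\<close> of \<open>G ^ degree P\<close> modulo
  \<open>P\<close> decides the question. At a root of \<open>P\<close> outside the zeros of
  \<open>G\<close>, \<open>r\<close> is nonzero. If every root of \<open>P\<close> is a root of
  \<open>G\<close>, then \<open>P\<close> divides the power and hence \<open>r\<close>, which has at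
  most \<open>degree P\<close> coefficients and so must vanish.\<close>

lemma root_avoiding:
  assumes a: "ev \<tau> a \<noteq> 0"
  shows "(\<exists>x. poly (uev \<tau> (a # p)) x = 0 \<and> ev (case_nat x \<tau>) g \<noteq> 0) \<longleftrightarrow>
    (\<exists>x. ev (case_nat x \<tau>) (unsplit (urem a p (usplit (mpower g (length p))))) \<noteq> 0)"
    (is "?lhs \<longleftrightarrow> (\<exists>x. ev _ (unsplit ?r) \<noteq> 0)")
proof -
  define P where "P = uev \<tau> (a # p)"
  define G where "G = uev \<tau> (usplit g)"
  have cP: "coeff P (length p) = ev \<tau> a"
    by (simp add: P_def uev_def coeff_hpoly)
  then have P0: "P \<noteq> 0" using a by auto
  have degP: "degree P = length p"
    using degree_hpoly[of "map (ev \<tau>) (a # p)"] le_degree[of P "length p"] cP a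
    by (simp add: P_def uev_def)
  have G: "ev (case_nat x \<tau>) g = poly G x" for x
    using poly_uev_usplit[of "case_nat x \<tau>" g] by (simp add: G_def)
  \<comment> \<open>The result of \<open>usplit\<close> is known only through its values; two
    polynomials agreeing everywhere on an infinite field are equal.\<close>
  have pw: "uev \<tau> (usplit (mpower g (length p))) = G ^ length p"
  proof (rule ccontr)
    assume "uev \<tau> (usplit (mpower g (length p))) \<noteq> G ^ length p"
    then obtain x where "poly (uev \<tau> (usplit (mpower g (length p))) - G ^ length p) x \<noteq> 0"
      using ex_nonzero_value[of "uev \<tau> (usplit (mpower g (length p))) - G ^ length p"] by auto
    then show False
      using poly_uev_usplit[of "case_nat x \<tau>" "mpower g (length p)"] by (simp add: G[symmetric])
  qed
  obtain k Q where r: "uev \<tau> ?r = smult (ev \<tau> a ^ k) (G ^ length p) - Q * P"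
    using uev_urem[of \<tau> a p "usplit (mpower g (length p))"] by (auto simp: pw P_def)
  have ev_r: "ev (case_nat x \<tau>) (unsplit ?r) = poly (uev \<tau> ?r) x" for x
    by (simp add: ev_unsplit)
  show ?thesis
  proof
    assume ?lhs
    then obtain x where "poly P x = 0" "poly G x \<noteq> 0" by (auto simp: P_def G)
    then have "poly (uev \<tau> ?r) x \<noteq> 0" using a by (simp add: r)
    then show "\<exists>x. ev (case_nat x \<tau>) (unsplit ?r) \<noteq> 0" by (auto simp: ev_r)
  next
    assume "\<exists>x. ev (case_nat x \<tau>) (unsplit ?r) \<noteq> 0"
    then have r0: "uev \<tau> ?r \<noteq> 0" by (auto simp: ev_r)
    show ?lhs
    proof (rule ccontr)
      assume "\<not> ?lhs"
      then have "\<And>x. poly P x = 0 \<Longrightarrow> poly G x = 0" by (auto simp: P_def G)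
      from dvd_power_degree[OF P0 this] have "P dvd uev \<tau> ?r"
        by (simp add: r degP dvd_diff dvd_smult)
      from dvd_imp_degree_le[OF this r0] have deg: "length p \<le> degree (uev \<tau> ?r)"
        by (simp add: degP)
      have "?r \<noteq> []" using r0 by (auto simp: uev_def)
      with deg length_urem[of a p] degree_hpoly[of "map (ev \<tau>) ?r"] show False
        by (cases ?r) (auto simp: uev_def, metis Suc_n_not_le_n length_Cons order_trans)
    qed
  qed
qed

lemma holds_step: "holds \<tau> s \<longleftrightarrow> (\<exists>s'\<in>set (step s). holds \<tau> s')"
proof -
  obtain es n g ps where s: "s = ((es, n), g, ps)" by (cases s) auto
  show ?thesis
  proof (cases ps)
    case Nil
    then show ?thesis by (simp add: s step_def)
  next
    case ps: (Cons P qs)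
    show ?thesis
    proof (cases P)
      case Nil
      then show ?thesis by (simp add: s ps step_def holds_def uev_def)
    next
      case P: (Cons a p)
      have z: "uev \<tau> (a # p) = uev \<tau> p" if "ev \<tau> a = 0" using that by (simp add: uev_def)
      show ?thesis
      proof (cases qs)
        case Nil
        then show ?thesis
          using root_avoiding[of \<tau> a p g] z
          by (cases "ev \<tau> a = 0") (simp_all add: s ps P step_def holds_def sat_def)
      next
        case qs: (Cons q rs)
        show ?thesis
        proof (cases "length q \<le> length p")
          case True
          then show ?thesis by (auto simp: s ps P qs step_def holds_def)
        next
          case False
          then obtain b q' where q: "q = b # q'" "length p \<le> length q'" by (cases q) auto
          \<comment> \<open>At a root of the first polynomial, reduction multiplies the second by
            \<open>ev \<tau> a\<close>, so where this is nonzero the common roots do not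
            change.\<close>
          have "poly (uev \<tau> (ured a p q)) x = ev \<tau> a * poly (uev \<tau> q) x"
            if "poly (uev \<tau> (a # p)) x = 0" for x
            using uev_ured[OF q(2), of \<tau> a b] that by (simp add: q(1))
          then show ?thesis
            using False z
            by (cases "ev \<tau> a = 0") (auto simp: s ps P qs step_def holds_def sat_def)
        qed
      qed
    qed
  qed
qed

text \<open>The number of rounds bounds the initial \<open>state_rank\<close>, so no univariate
  equation survives. The eliminated variable then occurs only in one inequation, solvable iff some
  coefficient is nonzero; this gives one alternative per coefficient.\<close>

definition elim :: "conj \<Rightarrow> conj list" where
  "elim C = (let ps = map usplit (fst C) in
     concat (map (\<lambda>s. map (\<lambda>c. (fst (fst s), mmul c (snd (fst s)))) (usplit (fst (snd s))))
       ((steps ^^ (2 * size_bound ps + 1)) [(([], mconst cunit), snd C, ps)])))"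

lemma sat_elim: "(\<exists>x. sat (case_nat x \<tau>) C) \<longleftrightarrow> (\<exists>C'\<in>set (elim C). sat \<tau> C')"
proof -
  define ps where "ps = map usplit (fst C)"
  define L where "L = (steps ^^ (2 * size_bound ps + 1)) [(([], mconst cunit), snd C, ps)]"
  have iter: "(\<exists>s\<in>set ((steps ^^ n) M). holds \<tau> s) \<longleftrightarrow> (\<exists>s\<in>set M. holds \<tau> s)" for n M
  proof (induction n)
    case (Suc n)
    have "(\<exists>s\<in>set (steps N). holds \<tau> s) \<longleftrightarrow> (\<exists>s\<in>set N. holds \<tau> s)" for N
      by (simp add: steps_def holds_step[symmetric])
    with Suc show ?case by simp
  qed simp
  have "(\<exists>x. sat (case_nat x \<tau>) C) \<longleftrightarrow> holds \<tau> (([], mconst cunit), snd C, ps)"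
    using poly_uev_usplit[of "case_nat _ \<tau>"]
    by (simp add: holds_def sat_def ps_def \<nu>_one)
  also have "\<dots> \<longleftrightarrow> (\<exists>s\<in>set L. holds \<tau> s)"
    unfolding L_def iter by simp
  also have "\<dots> \<longleftrightarrow> (\<exists>s\<in>set L. sat \<tau> (fst s) \<and> (\<exists>c\<in>set (usplit (fst (snd s))). ev \<tau> c \<noteq> 0))"
  proof (rule bex_cong[OF refl])
    fix s assume "s \<in> set L"
    then have "snd (snd s) = []"
      unfolding L_def by (rule state_rank_steps) (use state_rank_le[of ps] in simp)
    then show "holds \<tau> s \<longleftrightarrow> sat \<tau> (fst s) \<and> (\<exists>c\<in>set (usplit (fst (snd s))). ev \<tau> c \<noteq> 0)"
      by (simp add: holds_def holds_final)
  qed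
  also have "\<dots> \<longleftrightarrow> (\<exists>C'\<in>set (elim C). sat \<tau> C')"
    by (auto simp: elim_def L_def ps_def Let_def sat_def)
  finally show ?thesis .
qed

section \<open>Elimination of all variables\<close>

definition elims :: "nat \<Rightarrow> conj \<Rightarrow> conj list" where
  "elims n C = ((\<lambda>L. concat (map elim L)) ^^ n) [C]"

text \<open>Setting all variables from \<open>n\<close> on to 0 makes the quantifier finite: after
  \<open>n\<close> eliminations the zero assignment is the only one left.\<close>

lemma sat_elims:
  "(\<exists>\<sigma>. (\<forall>i\<ge>n. \<sigma> i = 0) \<and> sat \<sigma> C) \<longleftrightarrow> (\<exists>C'\<in>set (elims n C). sat (\<lambda>_. 0) C')"
proof -
  have "(\<exists>C\<in>set L. \<exists>\<sigma>. (\<forall>i\<ge>n. \<sigma> i = 0) \<and> sat \<sigma> C) \<longleftrightarrow>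
      (\<exists>C'\<in>set (((\<lambda>L. concat (map elim L)) ^^ n) L). sat (\<lambda>_. 0) C')" for L
  proof (induction n arbitrary: L)
    case 0
    have "(\<forall>i. \<sigma> i = 0) \<longleftrightarrow> \<sigma> = (\<lambda>_. 0)" for \<sigma> :: "nat \<Rightarrow> 'r" by auto
    then show ?case by simp
  next
    case (Suc n)
    have "(\<exists>\<sigma>. (\<forall>i\<ge>Suc n. \<sigma> i = 0) \<and> sat \<sigma> C) \<longleftrightarrow>
        (\<exists>C'\<in>set (elim C). \<exists>\<tau>. (\<forall>i\<ge>n. \<tau> i = 0) \<and> sat \<tau> C')" for C
    proof
      assume "\<exists>\<sigma>. (\<forall>i\<ge>Suc n. \<sigma> i = 0) \<and> sat \<sigma> C"
      then obtain \<sigma> where \<sigma>: "\<forall>i\<ge>Suc n. \<sigma> i = 0" "sat \<sigma> C" by blast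
      have "\<sigma> = case_nat (\<sigma> 0) (\<lambda>i. \<sigma> (Suc i))" by (auto split: nat.split)
      then have "\<exists>x. sat (case_nat x (\<lambda>i. \<sigma> (Suc i))) C" using \<sigma>(2) by metis
      then show "\<exists>C'\<in>set (elim C). \<exists>\<tau>. (\<forall>i\<ge>n. \<tau> i = 0) \<and> sat \<tau> C'"
        unfolding sat_elim using \<sigma>(1) by (auto intro!: bexI exI[of _ "\<lambda>i. \<sigma> (Suc i)"])
    next
      assume "\<exists>C'\<in>set (elim C). \<exists>\<tau>. (\<forall>i\<ge>n. \<tau> i = 0) \<and> sat \<tau> C'"
      then obtain \<tau> where \<tau>: "\<forall>i\<ge>n. \<tau> i = 0" "\<exists>C'\<in>set (elim C). sat \<tau> C'" by blast
      from \<tau>(2) obtain x where "sat (case_nat x \<tau>) C" unfolding sat_elim[symmetric] by blast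
      then show "\<exists>\<sigma>. (\<forall>i\<ge>Suc n. \<sigma> i = 0) \<and> sat \<sigma> C"
        using \<tau>(1) by (intro exI[of _ "case_nat x \<tau>"]) (auto split: nat.split)
    qed
    then have "(\<exists>C\<in>set L. \<exists>\<sigma>. (\<forall>i\<ge>Suc n. \<sigma> i = 0) \<and> sat \<sigma> C) \<longleftrightarrow>
       (\<exists>C'\<in>set (concat (map elim L)). \<exists>\<tau>. (\<forall>i\<ge>n. \<tau> i = 0) \<and> sat \<tau> C')"
      by auto
    also have "\<dots> \<longleftrightarrow> (\<exists>C'\<in>set (((\<lambda>L. concat (map elim L)) ^^ Suc n) L). sat (\<lambda>_. 0) C')"
      unfolding Suc.IH by (simp add: funpow_Suc_right del: funpow.simps)
    finally show ?case .
  qed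
  from this[of "[C]"] show ?thesis by (simp add: elims_def)
qed

text \<open>A code of the value at the zero assignment, where only terms with all exponents 0
  survive; to it the zero test on codes applies.\<close>

definition const_value :: "mpoly \<Rightarrow> nat" where
  "const_value p = foldr (\<lambda>m c. if list_all (\<lambda>k. k = 0) (snd m) then cadd (fst m) c else c) p czero"

lemma \<nu>_const_value: "\<nu> (const_value p) = ev (\<lambda>_. 0) p"
proof (induction p)
  case (Cons m p)
  have "mono (\<lambda>_. 0 :: 'r) e = (if list_all (\<lambda>k. k = 0) e then 1 else 0)" for e
    unfolding mono_def list_all_length by (auto simp: power_0_left)
  with Cons show ?case
    by (simp add: const_value_def ev_Cons \<nu>_add)
qed (simp add: const_value_def \<nu>_zero)

end

locale computable_field = coded_field \<nu> cadd cmul cneg czero cunit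
  for \<nu> :: "nat \<Rightarrow> 'r::alg_closed_field" and cadd cmul cneg czero cunit +
  assumes computable_cadd': "computable (\<lambda>p. cadd (fst p) (snd p))"
    and computable_cmul': "computable (\<lambda>p. cmul (fst p) (snd p))"
    and computable_cneg': "computable cneg"
    and decidable_zero': "decidable (\<lambda>c. \<nu> c = 0)"
begin

lemmas computable_cadd [comp] = computable_app2[OF computable_cadd']
lemmas computable_cmul [comp] = computable_app2[OF computable_cmul']
lemmas computable_cneg [comp] = computable_compose[OF computable_cneg']
lemmas decidable_zero [comp] = computable_compose[OF decidable_zero']

lemma computable_expo_add [comp]:
  "computable f \<Longrightarrow> computable g \<Longrightarrow> computable (\<lambda>x. expo_add (f x) (g x))"
  by (rule computable_app2) (unfold expo_add_def, intro comp)

lemma computable_usplit [comp]: "computable f \<Longrightarrow> computable (\<lambda>x. usplit (f x))"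
  by (rule computable_compose) (unfold usplit_def term_split_def, intro comp)

lemma computable_unsplit [comp]: "computable f \<Longrightarrow> computable (\<lambda>x. unsplit (f x))"
  by (rule computable_compose) (unfold unsplit_def, intro comp)

lemma computable_mneg [comp]: "computable f \<Longrightarrow> computable (\<lambda>x. mneg (f x))"
  by (rule computable_compose) (unfold mneg_def, intro comp)

lemma computable_mconst [comp]: "computable f \<Longrightarrow> computable (\<lambda>x. mconst (f x))"
  by (rule computable_compose) (unfold mconst_def, intro comp)

lemma computable_mmul [comp]:
  "computable f \<Longrightarrow> computable g \<Longrightarrow> computable (\<lambda>x. mmul (f x) (g x))"
  by (rule computable_app2) (unfold mmul_def, intro comp)

lemma computable_ured [comp]:
  "computable f \<Longrightarrow> computable g \<Longrightarrow> computable h \<Longrightarrow> computable (\<lambda>x. ured (f x) (g x) (h x))"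
  by (rule computable_app3) (unfold ured_def, intro comp)

lemma computable_urem [comp]:
  "computable f \<Longrightarrow> computable g \<Longrightarrow> computable h \<Longrightarrow> computable (\<lambda>x. urem (f x) (g x) (h x))"
  by (rule computable_app3) (unfold urem_def, intro comp)

lemma computable_mpower [comp]:
  "computable f \<Longrightarrow> computable g \<Longrightarrow> computable (\<lambda>x. mpower (f x) (g x))"
  by (rule computable_app2) (unfold mpower_def, intro comp)

lemma computable_step [comp]: "computable f \<Longrightarrow> computable (\<lambda>x. step (f x))"
  by (rule computable_compose) (unfold step_def Let_def, intro comp)

lemma computable_steps [comp]: "computable f \<Longrightarrow> computable (\<lambda>x. steps (f x))"
  by (rule computable_compose) (unfold steps_def, intro comp)

lemma computable_size_bound [comp]: "computable f \<Longrightarrow> computable (\<lambda>x. size_bound (f x))"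
  by (rule computable_compose) (unfold size_bound_def, intro comp)

lemma computable_elim [comp]: "computable f \<Longrightarrow> computable (\<lambda>x. elim (f x))"
  by (rule computable_compose) (unfold elim_def Let_def, intro comp)

lemma computable_elims [comp]:
  "computable f \<Longrightarrow> computable g \<Longrightarrow> computable (\<lambda>x. elims (f x) (g x))"
  by (rule computable_app2) (unfold elims_def, intro comp)

lemma computable_const_value [comp]: "computable f \<Longrightarrow> computable (\<lambda>x. const_value (f x))"
  by (rule computable_compose) (unfold const_value_def, intro comp)

lemma decidable_ev_0 [comp]: "computable f \<Longrightarrow> decidable (\<lambda>x. ev (\<lambda>_. 0) (f x) = 0)"
  unfolding \<nu>_const_value[symmetric] by (intro comp)

lemma decidable_sat_0 [comp]: "computable f \<Longrightarrow> decidable (\<lambda>x. sat (\<lambda>_. 0) (f x))"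
  unfolding sat_def list_all_iff[symmetric] by (intro comp)

lemma decidable_solvable:
  assumes "computable n" "computable C"
  shows "decidable (\<lambda>x. \<exists>\<sigma>. (\<forall>i\<ge>n x. \<sigma> i = 0) \<and> sat \<sigma> (C x))"
  unfolding sat_elims list_ex_iff[symmetric] by (intro comp assms)

end

section \<open>Finite generation of polynomial systems\<close>

text \<open>Rings are sets inside one fixed ring type, so that adjoining an element changes the set
  but not the type.\<close>

definition subring :: "'a::comm_ring_1 set \<Rightarrow> bool" where
  "subring S \<longleftrightarrow> 0 \<in> S \<and> 1 \<in> S \<and> (\<forall>x\<in>S. - x \<in> S) \<and> (\<forall>x\<in>S. \<forall>y\<in>S. x + y \<in> S \<and> x * y \<in> S)"

lemma subringD:
  assumes "subring S"
  shows "0 \<in> S" "1 \<in> S" "x \<in> S \<Longrightarrow> - x \<in> S" "x \<in> S \<Longrightarrow> y \<in> S \<Longrightarrow> x + y \<in> S"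
    "x \<in> S \<Longrightarrow> y \<in> S \<Longrightarrow> x * y \<in> S"
  using assms by (auto simp: subring_def)

inductive_set generated_ideal :: "'a::comm_ring_1 set \<Rightarrow> 'a set \<Rightarrow> 'a set" for S X where
  zero: "0 \<in> generated_ideal S X"
| add: "s \<in> S \<Longrightarrow> x \<in> X \<Longrightarrow> y \<in> generated_ideal S X \<Longrightarrow> s * x + y \<in> generated_ideal S X"

lemma generated_ideal_mono: "X \<subseteq> Y \<Longrightarrow> generated_ideal S X \<subseteq> generated_ideal S Y"
proof
  fix z assume "X \<subseteq> Y" "z \<in> generated_ideal S X"
  from this(2,1) show "z \<in> generated_ideal S Y"
    by induction (auto intro: generated_ideal.intros)
qed

lemma generated_ideal_plus:
  assumes "x \<in> generated_ideal S X" "y \<in> generated_ideal S X"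
  shows "x + y \<in> generated_ideal S X"
  using assms by induction (auto intro: generated_ideal.intros simp: add.assoc)

lemma generated_ideal_mult:
  assumes "x \<in> generated_ideal S X" "subring S" "s \<in> S"
  shows "s * x \<in> generated_ideal S X"
  using assms
proof induction
  case (add a x y)
  then have "(s * a) * x + s * y \<in> generated_ideal S X"
    by (intro generated_ideal.add) (auto intro: subringD)
  then show ?case by (simp add: algebra_simps)
qed (simp add: generated_ideal.zero)

lemma generated_ideal_base:
  assumes "x \<in> X" "subring S" shows "x \<in> generated_ideal S X"
  using generated_ideal.add[OF subringD(2) assms(1) generated_ideal.zero] assms by simp

lemma generated_ideal_trans:
  assumes "x \<in> generated_ideal S Y" "Y \<subseteq> generated_ideal S X" "subring S"
  shows "x \<in> generated_ideal S X"
  using assms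
  by induction (auto intro!: generated_ideal.zero generated_ideal_plus generated_ideal_mult)

lemma generated_ideal_finite:
  assumes "x \<in> generated_ideal S X"
  shows "\<exists>F\<subseteq>X. finite F \<and> x \<in> generated_ideal S F"
  using assms
proof induction
  case (add s x y)
  then obtain F where F: "F \<subseteq> X" "finite F" "y \<in> generated_ideal S F" by blast
  have "y \<in> generated_ideal S (insert x F)"
    using F(3) generated_ideal_mono[of F "insert x F" S] by blast
  then have "s * x + y \<in> generated_ideal S (insert x F)"
    using add.hyps by (intro generated_ideal.add) auto
  then show ?case using F add.hyps by (intro exI[of _ "insert x F"]) auto
qed (auto intro: generated_ideal.zero)

text \<open>Stated for arbitrary subsets with generators taken from the subset itself: a finite part
  of the given equations is wanted, not generators of their ideal.\<close>

definition noetherian :: "'a::comm_ring_1 set \<Rightarrow> bool" where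
  "noetherian S \<longleftrightarrow> subring S \<and> (\<forall>X\<subseteq>S. \<exists>F\<subseteq>X. finite F \<and> X \<subseteq> generated_ideal S F)"

text \<open>Polynomial expressions in \<open>t\<close> over \<open>S\<close> of formal degree less
  than \<open>d\<close>.\<close>

primrec below :: "'a::comm_ring_1 set \<Rightarrow> 'a \<Rightarrow> nat \<Rightarrow> 'a set" where
  "below S t 0 = {0}"
| "below S t (Suc d) = {p + s * t ^ d | p s. p \<in> below S t d \<and> s \<in> S}"

definition adjoin :: "'a::comm_ring_1 set \<Rightarrow> 'a \<Rightarrow> 'a set" where
  "adjoin S t = (\<Union>d. below S t d)"

context
  fixes S :: "'a::comm_ring_1 set" and t :: 'a
  assumes S: "subring S"
begin

lemma below_SucI: "p \<in> below S t d \<Longrightarrow> s \<in> S \<Longrightarrow> p + s * t ^ d \<in> below S t (Suc d)"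
  by auto

lemma below_plus: "p \<in> below S t d \<Longrightarrow> q \<in> below S t d \<Longrightarrow> p + q \<in> below S t d"
proof (induction d arbitrary: p q)
  case (Suc d)
  then obtain p' s q' r where pq: "p = p' + s * t ^ d" "q = q' + r * t ^ d"
    "p' \<in> below S t d" "q' \<in> below S t d" "s \<in> S" "r \<in> S" by auto
  then have eq: "p + q = (p' + q') + (s + r) * t ^ d"
    by (simp add: algebra_simps)
  show ?case
    unfolding eq by (intro below_SucI Suc.IH subringD(4)[OF S] pq)
qed simp

lemma below_scale: "r \<in> S \<Longrightarrow> p \<in> below S t d \<Longrightarrow> r * p \<in> below S t d"
proof (induction d arbitrary: p)
  case (Suc d)
  then obtain p' s where p: "p = p' + s * t ^ d" "p' \<in> below S t d" "s \<in> S" by auto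
  then have eq: "r * p = r * p' + (r * s) * t ^ d"
    by (simp add: algebra_simps)
  show ?case
    unfolding eq by (intro below_SucI Suc.IH subringD(5)[OF S] p Suc.prems)
qed simp

lemma below_zero: "0 \<in> below S t d"
proof (induction d)
  case (Suc d)
  then show ?case using subringD(1)[OF S] by (auto intro!: exI[of _ 0])
qed simp

lemma below_Suc: "p \<in> below S t d \<Longrightarrow> p \<in> below S t (Suc d)"
  using below_SucI[of p d 0] subringD(1)[OF S] by simp

lemma below_mono: "d \<le> e \<Longrightarrow> p \<in> below S t d \<Longrightarrow> p \<in> below S t e"
  by (induction rule: dec_induct) (auto simp: below_Suc simp del: below.simps)

lemma below_shift: "p \<in> below S t d \<Longrightarrow> t * p \<in> below S t (Suc d)"
proof (induction d arbitrary: p)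
  case 0
  then show ?case using below_zero[of 1] by simp
next
  case (Suc d)
  then obtain p' s where p: "p = p' + s * t ^ d" "p' \<in> below S t d" "s \<in> S" by auto
  then have "t * p = t * p' + s * t ^ Suc d" by (simp add: algebra_simps)
  then show ?case
    unfolding below.simps(2)[of S t "Suc d"] using Suc.IH[OF p(2)] p(3) by blast
qed

lemma below_shift_power: "p \<in> below S t d \<Longrightarrow> t ^ k * p \<in> below S t (d + k)"
  by (induction k) (auto simp: mult.assoc dest: below_shift simp del: below.simps)

lemma base_adjoin: "s \<in> S \<Longrightarrow> s \<in> adjoin S t"
  unfolding adjoin_def by (rule UN_I[of 1]) auto

lemma adjoin_plus:
  assumes "p \<in> adjoin S t" "q \<in> adjoin S t" shows "p + q \<in> adjoin S t"
proof -
  obtain d e where "p \<in> below S t d" "q \<in> below S t e"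
    using assms by (auto simp: adjoin_def)
  then have "p \<in> below S t (max d e)" "q \<in> below S t (max d e)"
    by (auto intro: below_mono[rotated])
  then show ?thesis using below_plus by (auto simp: adjoin_def)
qed

lemma adjoin_shift: "p \<in> adjoin S t \<Longrightarrow> t ^ k * p \<in> adjoin S t"
  using below_shift_power by (fastforce simp: adjoin_def)

lemma subring_adjoin: "subring (adjoin S t)"
proof -
  have scale: "s * p \<in> adjoin S t" if "s \<in> S" "p \<in> adjoin S t" for s p
    using that below_scale by (auto simp: adjoin_def)
  have "p * q \<in> adjoin S t" if "p \<in> below S t d" "q \<in> adjoin S t" for p q d
    using that(1)
  proof (induction d arbitrary: p)
    case 0
    then show ?case using base_adjoin subringD(1)[OF S] by simp
  next
    case (Suc d)
    then obtain p' s where p: "p = p' + s * t ^ d" "p' \<in> below S t d" "s \<in> S" by auto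
    have "p' * q + s * (t ^ d * q) \<in> adjoin S t"
      using Suc.IH[OF p(2)] scale[OF p(3) adjoin_shift[OF that(2)]] by (rule adjoin_plus)
    then show ?case by (simp add: p(1) algebra_simps)
  qed
  then have mult: "p * q \<in> adjoin S t" if "p \<in> adjoin S t" "q \<in> adjoin S t" for p q
    using that unfolding adjoin_def by blast
  have "- p \<in> adjoin S t" if "p \<in> adjoin S t" for p
    using scale[of "-1" p] that subringD(2,3)[OF S] by simp
  then show ?thesis
    unfolding subring_def using mult adjoin_plus base_adjoin subringD[OF S] by blast
qed

lemma generator_adjoin: "t \<in> adjoin S t"
  using adjoin_shift[OF base_adjoin[OF subringD(2)[OF S]], of 1] by simp

text \<open>
  Hilbert's basis theorem; as \<open>t\<close> need not be transcendental, elements have no well-defined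
  leading coefficient, and \<open>L d\<close> collects all the possible ones.
\<close>

lemma ideal_adjoin_finitely_generated:
  assumes noeth: "noetherian S" and I: "I \<subseteq> adjoin S t" "0 \<in> I"
    "\<And>x y. x \<in> I \<Longrightarrow> y \<in> I \<Longrightarrow> x + y \<in> I" "\<And>r x. r \<in> adjoin S t \<Longrightarrow> x \<in> I \<Longrightarrow> r * x \<in> I"
  shows "\<exists>G\<subseteq>I. finite G \<and> I \<subseteq> generated_ideal (adjoin S t) G"
proof -
  let ?R = "adjoin S t"
  define L where "L d = {s \<in> S. \<exists>p\<in>below S t d. p + s * t ^ d \<in> I}" for d
  have t: "t ^ k \<in> ?R" for k
    using adjoin_shift[OF base_adjoin[OF subringD(2)[OF S]], of k] by simp
  have L_Suc: "L d \<subseteq> L (Suc d)" for d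
  proof
    fix s assume "s \<in> L d"
    then obtain p where p: "s \<in> S" "p \<in> below S t d" "p + s * t ^ d \<in> I" by (auto simp: L_def)
    have "t * (p + s * t ^ d) \<in> I" using p(3) generator_adjoin I(4) by blast
    then have "t * p + s * t ^ Suc d \<in> I" by (simp add: algebra_simps)
    then show "s \<in> L (Suc d)" using p below_shift by (auto simp: L_def simp del: below.simps)
  qed
  have L_mono: "L d \<subseteq> L e" if "d \<le> e" for d e
    using that lift_Suc_mono_le[of L, OF L_Suc] by blast
  have "(\<Union>d. L d) \<subseteq> S" by (auto simp: L_def)
  \<comment> \<open>The chain condition: finitely many coefficients generate the union of the chain,
    and all of them occur in a single \<open>L D\<close>, so generators of \<open>L D\<close> serve
    for every later degree.\<close>
  then obtain F where F: "F \<subseteq> (\<Union>d. L d)" "finite F" "(\<Union>d. L d) \<subseteq> generated_ideal S F"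
    using noeth unfolding noetherian_def by meson
  obtain D where D: "F \<subseteq> L D"
  proof -
    have "\<forall>s\<in>F. \<exists>d. s \<in> L d" using F(1) by blast
    then obtain \<delta> where "\<And>s. s \<in> F \<Longrightarrow> s \<in> L (\<delta> s)" by metis
    \<comment> \<open>Inserting 0 keeps the maximum meaningful when \<open>F\<close> is
      empty.\<close>
    then have "F \<subseteq> L (Max (insert 0 (\<delta> ` F)))"
      using F(2) L_mono[of "\<delta> _" "Max (insert 0 (\<delta> ` F))"] by (auto intro!: Max_ge)
    then show ?thesis by (rule that)
  qed
  have "\<forall>d. \<exists>F\<subseteq>L d. finite F \<and> L d \<subseteq> generated_ideal S F"
    using noeth unfolding noetherian_def by (auto simp: L_def)
  then obtain \<Phi> where \<Phi>: "\<And>d. \<Phi> d \<subseteq> L d" "\<And>d. finite (\<Phi> d)" "\<And>d. L d \<subseteq> generated_ideal S (\<Phi> d)"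
    by metis
  have L_gen: "L d \<subseteq> generated_ideal S (\<Phi> (min d D))" for d
  proof (cases "d \<le> D")
    case True
    then show ?thesis using \<Phi>(3)[of d] by (simp add: min_absorb1)
  next
    case False
    have "L d \<subseteq> generated_ideal S F" using F(3) by blast
    then show ?thesis
      using False generated_ideal_trans[of _ S F "\<Phi> D", OF _ _ S] D \<Phi>(3)[of D]
      by (auto simp: min_def)
  qed
  have "\<forall>d. \<forall>s\<in>L d. \<exists>w. w \<in> I \<and> (\<exists>p\<in>below S t d. w = p + s * t ^ d)"
    by (auto simp: L_def)
  then obtain w where w: "\<And>d s. s \<in> L d \<Longrightarrow> w d s \<in> I"
      "\<And>d s. s \<in> L d \<Longrightarrow> \<exists>p\<in>below S t d. w d s = p + s * t ^ d"
    by metis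
  define G where "G = (\<Union>d\<le>D. w d ` \<Phi> d)"
  have "finite G" using \<Phi>(2) by (simp add: G_def)
  moreover have "G \<subseteq> I" using \<Phi>(1) w(1) unfolding G_def by blast
  ultimately have G: "finite G" "G \<subseteq> I" by auto
  have gen_I: "generated_ideal ?R G \<subseteq> I"
  proof
    fix x assume "x \<in> generated_ideal ?R G"
    then show "x \<in> I"
    proof induction
      case (add s x y)
      then have "s * x \<in> I" using G(2) I(4) by blast
      then show ?case using add.IH by (rule I(3))
    qed (rule I(2))
  qed
  \<comment> \<open>A combination of chosen leading coefficients is realised by the same combination
    of the ideal elements \<open>w d x\<close>.\<close>
  have lead: "\<exists>p\<in>below S t d. p + s * t ^ d \<in> generated_ideal ?R G"
    if "s \<in> generated_ideal S (\<Phi> d)" "d \<le> D" for s d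
    using that
  proof induction
    case zero
    then show ?case using below_zero by (auto intro!: bexI[of _ 0] generated_ideal.zero)
  next
    case (add r x y)
    then obtain p where p: "p \<in> below S t d" "p + y * t ^ d \<in> generated_ideal ?R G" by blast
    obtain q where q: "q \<in> below S t d" "w d x = q + x * t ^ d"
      using w(2)[of x d] \<Phi>(1) add.hyps by blast
    have "w d x \<in> G" using add by (auto simp: G_def)
    then have "r * w d x + (p + y * t ^ d) \<in> generated_ideal ?R G"
      using p(2) add.hyps base_adjoin by (intro generated_ideal.add)
    moreover have "r * w d x + (p + y * t ^ d) = (r * q + p) + (r * x + y) * t ^ d"
      by (simp add: q(2) algebra_simps)
    moreover have "r * q + p \<in> below S t d"
      using p q add.hyps by (intro below_plus below_scale)
    ultimately show ?case by metis
  qed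
  have "q \<in> generated_ideal ?R G" if "q \<in> below S t d" "q \<in> I" for q d
    using that
  proof (induction d arbitrary: q)
    case 0
    then show ?case by (simp add: generated_ideal.zero)
  next
    case (Suc d)
    then obtain p s where p: "q = p + s * t ^ d" "p \<in> below S t d" "s \<in> S" by auto
    \<comment> \<open>Generators were kept only up to degree \<open>D\<close>; for larger
      \<open>d\<close> a combination of degree \<open>D\<close> is multiplied by a power of
      \<open>t\<close> to cancel the leading term of \<open>q\<close>.\<close>
    define e where "e = min d D"
    have e: "e \<le> d" "e \<le> D" by (auto simp: e_def)
    have "s \<in> L d" using p Suc.prems by (auto simp: L_def)
    then have "s \<in> generated_ideal S (\<Phi> e)" using L_gen e_def by auto
    then obtain p' where p': "p' \<in> below S t e" "p' + s * t ^ e \<in> generated_ideal ?R G"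
      using lead e by blast
    define g where "g = t ^ (d - e) * (p' + s * t ^ e)"
    have g: "g \<in> generated_ideal ?R G"
      unfolding g_def using p'(2) subring_adjoin t by (rule generated_ideal_mult)
    have "t ^ (d - e) * (s * t ^ e) = s * t ^ d"
      using e(1) by (simp add: mult.left_commute power_add[symmetric])
    then have g_eq: "g = t ^ (d - e) * p' + s * t ^ d"
      by (simp add: g_def distrib_left)
    have "t ^ (d - e) * p' \<in> below S t d"
      using below_shift_power[OF p'(1), of "d - e"] e(1) by simp
    then have "q + (-1) * g \<in> below S t d"
      using below_plus[OF p(2) below_scale[of "-1"]] subringD(2,3)[OF S] by (simp add: p(1) g_eq)
    moreover have "(-1) * g \<in> I"
      using g gen_I base_adjoin[of "-1"] subringD(2,3)[OF S] by (intro I(4)) auto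
    then have "q + (-1) * g \<in> I" using Suc.prems(2) I(3) by blast
    ultimately have "(q + (-1) * g) + g \<in> generated_ideal ?R G"
      by (rule generated_ideal_plus[OF Suc.IH g])
    then show ?case by simp
  qed
  then have "I \<subseteq> generated_ideal ?R G"
    using I(1) by (auto simp: adjoin_def)
  with G show ?thesis by blast
qed

end

text \<open>The ideal generated by \<open>X\<close> has finitely many generators, and each of them
  involves only finitely many elements of \<open>X\<close>.\<close>

lemma noetherian_adjoin:
  assumes S: "noetherian S" shows "noetherian (adjoin S t)"
proof -
  have sub: "subring S" using S by (simp add: noetherian_def)
  note R = subring_adjoin[OF sub, of t]
  have "\<exists>F\<subseteq>X. finite F \<and> X \<subseteq> generated_ideal (adjoin S t) F" if X: "X \<subseteq> adjoin S t" for X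
  proof -
    let ?I = "generated_ideal (adjoin S t) X"
    have "?I \<subseteq> adjoin S t"
    proof
      fix x assume "x \<in> ?I"
      then show "x \<in> adjoin S t"
        by induction (use X subringD[OF R] in auto)
    qed
    then obtain G where G: "G \<subseteq> ?I" "finite G" "?I \<subseteq> generated_ideal (adjoin S t) G"
      using ideal_adjoin_finitely_generated[OF sub S, of ?I t] generated_ideal.zero
        generated_ideal_plus generated_ideal_mult[OF _ R] by metis
    have "\<forall>g\<in>G. \<exists>F\<subseteq>X. finite F \<and> g \<in> generated_ideal (adjoin S t) F"
      using G(1) generated_ideal_finite by blast
    then obtain \<Phi> where \<Phi>: "\<And>g. g \<in> G \<Longrightarrow> \<Phi> g \<subseteq> X" "\<And>g. g \<in> G \<Longrightarrow> finite (\<Phi> g)"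
       "\<And>g. g \<in> G \<Longrightarrow> g \<in> generated_ideal (adjoin S t) (\<Phi> g)" by metis
    let ?F = "\<Union>g\<in>G. \<Phi> g"
    have "G \<subseteq> generated_ideal (adjoin S t) ?F"
      using \<Phi>(3) generated_ideal_mono[of "\<Phi> _" ?F "adjoin S t"] by blast
    then have "?I \<subseteq> generated_ideal (adjoin S t) ?F"
      using G(3) generated_ideal_trans[OF _ _ R] by blast
    moreover have "X \<subseteq> ?I" using generated_ideal_base[OF _ R] by blast
    ultimately show ?thesis
      using \<Phi>(1,2) G(2) by (intro exI[of _ ?F]) auto
  qed
  with R show ?thesis by (simp add: noetherian_def)
qed

text \<open>Functions instead of formal polynomials suffice because only common zeros matter. The
  coordinate functions are adjoined to the field of constants.\<close>

definition polynomial_functions :: "'v list \<Rightarrow> (('v \<Rightarrow> 'r::field) \<Rightarrow> 'r) set" where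
  "polynomial_functions vs = foldr (\<lambda>v S. adjoin S (\<lambda>x. x v)) vs (range (\<lambda>c x. c))"

lemma noetherian_polynomial_functions:
  "noetherian (polynomial_functions vs :: (('v \<Rightarrow> 'r::field) \<Rightarrow> 'r) set)"
proof (induction vs)
  case Nil
  let ?K = "range (\<lambda>(c::'r) (x::'v \<Rightarrow> 'r). c)"
  have sub: "subring ?K"
    by (auto simp: subring_def zero_fun_def one_fun_def plus_fun_def times_fun_def fun_Compl_def)
  have "\<exists>F\<subseteq>X. finite F \<and> X \<subseteq> generated_ideal ?K F" if X: "X \<subseteq> ?K" for X
  proof (cases "X \<subseteq> {0}")
    case True
    then show ?thesis
      by (intro exI[of _ "{}"]) (auto intro: generated_ideal.zero)
  next
    case False
    then obtain c where c: "(\<lambda>x. c) \<in> X" "c \<noteq> 0" using X by (auto simp: zero_fun_def)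
    have "X \<subseteq> generated_ideal ?K {\<lambda>x. c}"
    proof
      fix f assume "f \<in> X"
      then obtain d where d: "f = (\<lambda>x. d)" using X by auto
      have "(\<lambda>x. d / c) * (\<lambda>x. c) + 0 \<in> generated_ideal ?K {\<lambda>x. c}"
        by (intro generated_ideal.intros) auto
      then show "f \<in> generated_ideal ?K {\<lambda>x. c}"
        using c(2) by (simp add: d times_fun_def)
    qed
    with c show ?thesis by (intro exI[of _ "{\<lambda>x. c}"]) auto
  qed
  with sub show ?case by (simp add: polynomial_functions_def noetherian_def)
next
  case (Cons v vs)
  then show ?case by (simp add: polynomial_functions_def noetherian_adjoin)
qed

lemmas subring_polynomial_functions =
  noetherian_polynomial_functions[unfolded noetherian_def, THEN conjunct1]

lemma const_polynomial_functions: "(\<lambda>x. c) \<in> polynomial_functions vs"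
proof (induction vs)
  case (Cons v vs)
  then show ?case
    using base_adjoin[OF subring_polynomial_functions[of vs]]
    by (simp add: polynomial_functions_def)
qed (simp add: polynomial_functions_def)

lemma var_polynomial_functions: "v \<in> set vs \<Longrightarrow> (\<lambda>x. x v) \<in> polynomial_functions vs"
proof (induction vs)
  case (Cons w vs)
  then show ?case
    using base_adjoin[OF subring_polynomial_functions[of vs]]
      generator_adjoin[OF subring_polynomial_functions[of vs]]
    by (cases "v = w") (auto simp: polynomial_functions_def)
qed simp

lemma finite_subsystem:
  fixes X :: "(('v \<Rightarrow> 'r::field) \<Rightarrow> 'r) set"
  assumes "X \<subseteq> polynomial_functions vs"
  shows "\<exists>F\<subseteq>X. finite F \<and> (\<forall>x. (\<forall>f\<in>F. f x = 0) \<longrightarrow> (\<forall>f\<in>X. f x = 0))"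
proof -
  obtain F where F: "F \<subseteq> X" "finite F" "X \<subseteq> generated_ideal (polynomial_functions vs) F"
    using noetherian_polynomial_functions[of vs] assms unfolding noetherian_def by meson
  have "f x = 0" if "f \<in> generated_ideal (polynomial_functions vs) F" "\<forall>f\<in>F. f x = 0" for f x
    using that by induction auto
  with F show ?thesis by blast
qed

section \<open>Integer polynomial functions\<close>

text \<open>An integer polynomial, given by the functions it defines over two rings.\<close>

inductive int_poly :: "(('v \<Rightarrow> 'a::comm_ring_1) \<Rightarrow> 'a) \<Rightarrow> (('v \<Rightarrow> 'b::comm_ring_1) \<Rightarrow> 'b) \<Rightarrow> bool" where
  const: "int_poly (\<lambda>x. of_int c) (\<lambda>x. of_int c)"
| var: "int_poly (\<lambda>x. x v) (\<lambda>x. x v)"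
| add: "int_poly f h \<Longrightarrow> int_poly f' h' \<Longrightarrow> int_poly (\<lambda>x. f x + f' x) (\<lambda>x. h x + h' x)"
| mult: "int_poly f h \<Longrightarrow> int_poly f' h' \<Longrightarrow> int_poly (\<lambda>x. f x * f' x) (\<lambda>x. h x * h' x)"

lemma int_poly_0: "int_poly (\<lambda>x. 0) (\<lambda>x. 0)"
  using int_poly.const[of 0] by simp

lemma int_poly_1: "int_poly (\<lambda>x. 1) (\<lambda>x. 1)"
  using int_poly.const[of 1] by simp

lemma int_poly_sum:
  "(\<And>i. i \<in> I \<Longrightarrow> int_poly (f i) (h i)) \<Longrightarrow> int_poly (\<lambda>x. \<Sum>i\<in>I. f i x) (\<lambda>x. \<Sum>i\<in>I. h i x)"
  by (induction I rule: infinite_finite_induct) (simp_all add: int_poly_0 int_poly.add)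

lemma int_poly_prod:
  "(\<And>i. i \<in> I \<Longrightarrow> int_poly (f i) (h i)) \<Longrightarrow> int_poly (\<lambda>x. \<Prod>i\<in>I. f i x) (\<lambda>x. \<Prod>i\<in>I. h i x)"
  by (induction I rule: infinite_finite_induct) (simp_all add: int_poly_1 int_poly.mult)

lemma int_poly_power: "int_poly f h \<Longrightarrow> int_poly (\<lambda>x. f x ^ n) (\<lambda>x. h x ^ n)"
  by (induction n) (simp_all add: int_poly_1 int_poly.mult)

lemma int_poly_eval_poly: "int_poly (eval_poly p) (eval_poly p)"
  unfolding eval_poly_def
  by (intro int_poly_sum int_poly.mult int_poly_prod int_poly_power int_poly.const int_poly.var)

lemma int_poly_det:
  assumes "\<And>i j. int_poly (f i j) (h i j)"
  shows "int_poly (\<lambda>x. det (\<chi> i j. f i j x)) (\<lambda>x. det (\<chi> i j. h i j x))"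
  unfolding det_def vec_lambda_beta
  by (intro int_poly_sum int_poly.mult int_poly_prod int_poly.const assms)

lemma int_poly_compose:
  assumes "int_poly f h" "\<And>v. int_poly (F v) (H v)"
  shows "int_poly (\<lambda>x. f (\<lambda>v. F v x)) (\<lambda>x. h (\<lambda>v. H v x))"
  using assms(1) by induction (intro int_poly.intros assms(2) | assumption)+

text \<open>Makes the index sets independent of the supports, so that expressions for several
  polynomials can be combined termwise.\<close>

lemma eval_poly_eq:
  assumes "finite M" "Poly_Mapping.keys p \<subseteq> M"
  shows "eval_poly p (x :: 'v::finite \<Rightarrow> 'k::comm_ring_1) =
    (\<Sum>m\<in>M. of_int (Poly_Mapping.lookup p m) * (\<Prod>v\<in>UNIV. x v ^ Poly_Mapping.lookup m v))"
proof -
  have "(\<Prod>v\<in>Poly_Mapping.keys m. x v ^ Poly_Mapping.lookup m v)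
      = (\<Prod>v\<in>UNIV. x v ^ Poly_Mapping.lookup m v)" for m :: "'v \<Rightarrow>\<^sub>0 nat"
    by (rule prod.mono_neutral_left) (auto simp: in_keys_iff)
  then show ?thesis
    unfolding eval_poly_def
    by (simp, intro sum.mono_neutral_left) (use assms in \<open>auto simp: in_keys_iff\<close>)
qed

lemma eval_poly_add:
  "eval_poly (p + q) (x :: 'v::finite \<Rightarrow> 'k::comm_ring_1) = eval_poly p x + eval_poly q x"
proof -
  let ?M = "Poly_Mapping.keys p \<union> Poly_Mapping.keys q"
  have "finite ?M" by simp
  moreover have "Poly_Mapping.keys (p + q) \<subseteq> ?M" by (rule keys_add)
  ultimately show ?thesis
    by (simp add: eval_poly_eq[of ?M] lookup_add distrib_right sum.distrib)
qed

lemma eval_poly_single: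
  "eval_poly (Poly_Mapping.single m c) (x :: 'v::finite \<Rightarrow> 'k::comm_ring_1) =
    of_int c * (\<Prod>v\<in>UNIV. x v ^ Poly_Mapping.lookup m v)"
  by (subst eval_poly_eq[of "{m}"]) auto

lemma eval_poly_var:
  "eval_poly (Poly_Mapping.single (Poly_Mapping.single v 1) 1) = (\<lambda>x :: 'v::finite \<Rightarrow> 'k::comm_ring_1. x v)"
proof
  fix x :: "'v \<Rightarrow> 'k"
  have "(\<Prod>w\<in>UNIV. x w ^ Poly_Mapping.lookup (Poly_Mapping.single v 1) w) = x v"
    by (subst prod.mono_neutral_right[of _ "{v}"]) (auto simp: lookup_single when_def)
  then show "eval_poly (Poly_Mapping.single (Poly_Mapping.single v 1) 1) x = x v"
    by (simp only: eval_poly_single of_int_1 mult_1)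
qed

lemma eval_poly_sum:
  "finite I \<Longrightarrow> eval_poly (\<Sum>i\<in>I. p i) (x :: 'v::finite \<Rightarrow> 'k::comm_ring_1) = (\<Sum>i\<in>I. eval_poly (p i) x)"
  by (induction I rule: finite_induct) (simp_all add: eval_poly_add, simp add: eval_poly_def)

lemma eval_poly_mult:
  "eval_poly p x * eval_poly q (x :: 'v::finite \<Rightarrow> 'k::comm_ring_1) =
    eval_poly (\<Sum>m\<in>Poly_Mapping.keys p. \<Sum>n\<in>Poly_Mapping.keys q.
      Poly_Mapping.single (m + n) (Poly_Mapping.lookup p m * Poly_Mapping.lookup q n)) x"
  by (simp add: eval_poly_sum eval_poly_single lookup_add power_add prod.distrib
      eval_poly_eq[of "Poly_Mapping.keys p" p] eval_poly_eq[of "Poly_Mapping.keys q" q]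
      sum_product mult_ac)

text \<open>One integer polynomial serves both rings. This carries vanishing on the complex group
  over to matrices over another ring.\<close>

lemma int_poly_imp_eval_poly:
  fixes f :: "('v::finite \<Rightarrow> 'a::comm_ring_1) \<Rightarrow> 'a" and h :: "('v \<Rightarrow> 'b::comm_ring_1) \<Rightarrow> 'b"
  assumes "int_poly f h"
  shows "\<exists>p. f = eval_poly p \<and> h = eval_poly p"
  using assms
proof induction
  case (const c)
  show ?case
    by (rule exI[of _ "Poly_Mapping.single 0 c"]) (auto simp: eval_poly_single)
next
  case (var v)
  show ?case
    by (rule exI[of _ "Poly_Mapping.single (Poly_Mapping.single v 1) 1"]) (simp only: eval_poly_var simp_thms)
next
  case (add f h f' h')
  then obtain p q where "f = eval_poly p" "h = eval_poly p" "f' = eval_poly q" "h' = eval_poly q"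
    by blast
  then show ?case by (intro exI[of _ "p + q"]) (simp add: fun_eq_iff eval_poly_add)
next
  case (mult f h f' h')
  then obtain p q where pq: "f = eval_poly p" "h = eval_poly p" "f' = eval_poly q" "h' = eval_poly q"
    by blast
  show ?case
    unfolding pq eval_poly_mult by (rule exI, rule conjI, rule refl, rule refl)
qed

section \<open>Adjugates\<close>

text \<open>Entry \<open>(i, j)\<close> is the numerator in Cramer's rule for the
  \<open>i\<close>-th coordinate of the solution of \<open>M x = e_j\<close>, an integer polynomial
  in the entries of \<open>M\<close>.\<close>

definition adjugate :: "'k::comm_ring_1^'n^'n \<Rightarrow> 'k^'n^'n" where
  "adjugate M = (\<chi> i j. det (\<chi> k l. if l = i then (if k = j then 1 else 0) else M $ k $ l))"

lemma matrix_mul_adjugate: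
  fixes M :: "'k::field^'n^'n"
  assumes "det M = 1"
  shows "M ** adjugate M = mat 1" "adjugate M ** M = mat 1"
proof -
  show "M ** adjugate M = mat 1"
  proof (intro vec_eq_iff[THEN iffD2] allI)
    fix i j
    define b :: "'k^'n" where "b = (\<chi> k. if k = j then 1 else 0)"
    have "M *v (\<chi> k. det (\<chi> i l. if l = k then b $ i else M $ i $ l) / det M) = b"
      by (subst cramer) (simp_all add: assms)
    then have "(M *v (\<chi> k. adjugate M $ k $ j)) $ i = b $ i"
      by (simp add: assms adjugate_def b_def cong: if_cong)
    then show "(M ** adjugate M) $ i $ j = mat 1 $ i $ j"
      by (simp add: matrix_matrix_mult_def matrix_vector_mult_def b_def mat_def)
  qed
  then show "adjugate M ** M = mat 1"
    by (simp add: matrix_left_right_inverse)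
qed

lemma det_adjugate:
  fixes M :: "'k::field^'n^'n"
  assumes "det M = 1"
  shows "det (adjugate M) = 1"
  using arg_cong[OF matrix_mul_adjugate(1)[OF assms], of det] assms
  by (simp add: det_mul)

lemma adjugate_unique:
  fixes M :: "'k::field^'n^'n"
  assumes "det M = 1" "M ** N = mat 1"
  shows "N = adjugate M"
  using matrix_mul_adjugate(2)[OF assms(1)] assms(2)
  by (metis matrix_mul_assoc matrix_mul_lid matrix_mul_rid)

lemma int_poly_adjugate:
  fixes f :: "'n::finite \<Rightarrow> 'n \<Rightarrow> ('v \<Rightarrow> 'a::comm_ring_1) \<Rightarrow> 'a"
    and h :: "'n \<Rightarrow> 'n \<Rightarrow> ('v \<Rightarrow> 'b::comm_ring_1) \<Rightarrow> 'b"
  assumes "\<And>i j. int_poly (f i j) (h i j)"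
  shows "int_poly (\<lambda>x. adjugate (\<chi> i j. f i j x) $ r $ c) (\<lambda>x. adjugate (\<chi> i j. h i j x) $ r $ c)"
proof -
  \<comment> \<open>The conditional selects between functions, so that every case is visibly an
    integer polynomial; \<open>if_distribR\<close> then moves the argument inside.\<close>
  have "int_poly (\<lambda>x. det (\<chi> k l. (if l = r then \<lambda>x. if k = c then 1 else 0 else f k l) x))
     (\<lambda>x. det (\<chi> k l. (if l = r then \<lambda>x. if k = c then 1 else 0 else h k l) x))"
    by (rule int_poly_det) (auto intro: assms int_poly_0 int_poly_1)
  then show ?thesis
    unfolding adjugate_def by (simp add: if_distribR cong: if_cong)
qed

section \<open>Determinants on the complex Chevalley group\<close>

lemma matrix_inv_inverse:
  assumes "invertible A"
  shows "A ** matrix_inv A = mat 1" "matrix_inv A ** A = mat 1"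
  using someI_ex[OF assms[unfolded invertible_def]] unfolding matrix_inv_def by blast+

section \<open>Nilpotent matrices and unipotent determinants\<close>

definition mpow :: "'k::comm_ring_1^'n^'n \<Rightarrow> nat \<Rightarrow> 'k^'n^'n" where
  "mpow X k = ((**) X ^^ k) (mat 1)"

lemma mpow_0 [simp]: "mpow X 0 = mat 1"
  by (simp add: mpow_def)

lemma mpow_Suc [simp]: "mpow X (Suc k) = X ** mpow X k"
  by (simp add: mpow_def)

lemma mpow_commute: "X ** Y = Y ** X \<Longrightarrow> mpow X k ** Y = Y ** mpow X k"
proof (induction k)
  case (Suc k)
  have "mpow X (Suc k) ** Y = X ** (mpow X k ** Y)"
    by (simp add: matrix_mul_assoc)
  also have "\<dots> = (X ** Y) ** mpow X k"
    by (simp only: Suc matrix_mul_assoc)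
  also have "\<dots> = Y ** mpow X (Suc k)"
    by (simp only: Suc.prems mpow_Suc matrix_mul_assoc)
  finally show ?case .
qed simp

lemma mpow_mult:
  assumes "X ** Y = Y ** X" shows "mpow (X ** Y) k = mpow X k ** mpow Y k"
proof (induction k)
  case (Suc k)
  have "mpow (X ** Y) (Suc k) = X ** (Y ** mpow X k) ** mpow Y k"
    by (simp add: Suc matrix_mul_assoc)
  also have "Y ** mpow X k = mpow X k ** Y"
    using mpow_commute[OF assms] by simp
  finally show ?case by (simp add: matrix_mul_assoc)
qed simp

lemma mpow_eq_0:
  assumes "mpow X K = 0" "K \<le> k" shows "mpow X k = 0"
  using assms(2) by (induction rule: dec_induct) (auto simp: assms(1))

definition poly_fun :: "('k::comm_ring_1 \<Rightarrow> 'k) \<Rightarrow> bool" where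
  "poly_fun f \<longleftrightarrow> (\<exists>p. \<forall>s. f s = poly p s)"

lemma poly_fun_const: "poly_fun (\<lambda>s. c)"
  unfolding poly_fun_def by (rule exI[of _ "[:c:]"]) simp

lemma poly_fun_id: "poly_fun (\<lambda>s. s)"
  unfolding poly_fun_def by (rule exI[of _ "[:0, 1:]"]) simp

lemma poly_fun_add:
  assumes "poly_fun f" "poly_fun g" shows "poly_fun (\<lambda>s. f s + g s)"
proof -
  obtain p q where "\<And>s. f s = poly p s" "\<And>s. g s = poly q s"
    using assms unfolding poly_fun_def by blast
  then show ?thesis unfolding poly_fun_def by (intro exI[of _ "p + q"]) simp
qed

lemma poly_fun_mult:
  assumes "poly_fun f" "poly_fun g" shows "poly_fun (\<lambda>s. f s * g s)"
proof -
  obtain p q where "\<And>s. f s = poly p s" "\<And>s. g s = poly q s"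
    using assms unfolding poly_fun_def by blast
  then show ?thesis unfolding poly_fun_def by (intro exI[of _ "p * q"]) simp
qed

lemma poly_fun_sum: "(\<And>i. i \<in> I \<Longrightarrow> poly_fun (f i)) \<Longrightarrow> poly_fun (\<lambda>s. \<Sum>i\<in>I. f i s)"
  by (induction I rule: infinite_finite_induct) (simp_all add: poly_fun_const poly_fun_add)

lemma poly_fun_prod: "(\<And>i. i \<in> I \<Longrightarrow> poly_fun (f i)) \<Longrightarrow> poly_fun (\<lambda>s. \<Prod>i\<in>I. f i s)"
  by (induction I rule: infinite_finite_induct) (simp_all add: poly_fun_const poly_fun_mult)

lemma poly_fun_power_minus: "poly_fun (\<lambda>s. (- s) ^ n)"
  unfolding poly_fun_def by (rule exI[of _ "(- [:0, 1:]) ^ n"]) (simp only: poly_power poly_minus, simp)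

lemma poly_fun_det:
  assumes "\<And>i j. poly_fun (\<lambda>s. F s $ i $ j)" shows "poly_fun (\<lambda>s. det (F s))"
  unfolding det_def by (intro poly_fun_sum poly_fun_mult poly_fun_prod poly_fun_const assms)

text \<open>
  \<open>det (1 + s N)\<close> is a polynomial in \<open>s\<close> which divides 1, as the geometric series gives an
  inverse of \<open>1 + s N\<close>.
\<close>

lemma det_unipotent:
  fixes N :: "'k::{field, ring_char_0}^'n^'n"
  assumes "mpow N K = 0"
  shows "det (mat 1 + N) = 1"
proof -
  define U where "U s = (\<chi> i j. mat 1 $ i $ j + s * N $ i $ j)" for s
  define V where "V s = (\<chi> i j. \<Sum>k<K. (- s) ^ k * mpow N k $ i $ j)" for s
  have inv: "U s ** V s = mat 1" for s
  proof (intro vec_eq_iff[THEN iffD2] allI)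
    fix i j
    let ?t = "\<lambda>k. (- s) ^ k * mpow N k $ i $ j"
    have "(\<Sum>l\<in>UNIV. N $ i $ l * V s $ l $ j) = (\<Sum>k<K. (- s) ^ k * mpow N (Suc k) $ i $ j)"
      unfolding V_def vec_lambda_beta sum_distrib_left
      by (subst sum.swap) (simp add: matrix_matrix_mult_def sum_distrib_left mult_ac)
    then have "s * (\<Sum>l\<in>UNIV. N $ i $ l * V s $ l $ j) = - (\<Sum>k<K. ?t (Suc k))"
      by (simp add: sum_distrib_left sum_negf[symmetric] mult_ac)
    moreover have "(\<Sum>l\<in>UNIV. mat 1 $ i $ l * V s $ l $ j) = (\<Sum>k<K. ?t k)"
      using arg_cong[OF matrix_mul_lid[of "V s"], of "\<lambda>M. M $ i $ j"]
      by (simp add: matrix_matrix_mult_def V_def)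
    moreover have "(U s ** V s) $ i $ j = (\<Sum>l\<in>UNIV. mat 1 $ i $ l * V s $ l $ j)
        + s * (\<Sum>l\<in>UNIV. N $ i $ l * V s $ l $ j)"
      by (simp add: matrix_matrix_mult_def U_def distrib_right sum.distrib sum_distrib_left mult.assoc)
    \<comment> \<open>Telescoping: \<open>1 + s N\<close> times the truncated geometric series is
      \<open>1 - (- s) ^ K N ^ K\<close>.\<close>
    moreover have "(\<Sum>k<K. ?t k) - (\<Sum>k<K. ?t (Suc k)) = ?t 0 - ?t K"
      by (subst sum_subtractf[symmetric]) (rule sum_lessThan_telescope')
    ultimately show "(U s ** V s) $ i $ j = mat 1 $ i $ j"
      using assms by simp
  qed
  have "poly_fun (\<lambda>s. det (U s))"
    unfolding U_def by (intro poly_fun_det, unfold vec_lambda_beta,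
      intro poly_fun_add poly_fun_mult poly_fun_const poly_fun_id)
  moreover have "poly_fun (\<lambda>s. det (V s))"
    unfolding V_def by (intro poly_fun_det, unfold vec_lambda_beta,
      intro poly_fun_sum poly_fun_mult poly_fun_const poly_fun_power_minus)
  ultimately obtain p q where pq: "\<And>s. det (U s) = poly p s" "\<And>s. det (V s) = poly q s"
    unfolding poly_fun_def by blast
  have "poly (p * q) s = poly 1 s" for s
    using arg_cong[OF inv[of s], of det] by (simp add: det_mul pq)
  \<comment> \<open>Equality of all values gives equality of polynomials, the field being infinite
    in characteristic 0.\<close>
  then have "p * q = 1" by (simp add: poly_eq_poly_eq_iff[symmetric] fun_eq_iff)
  then have "is_unit p" by (metis dvd_triv_left)
  then obtain c where c: "p = [:c:]" by (auto elim: is_unit_polyE)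
  \<comment> \<open>A unit of the polynomial ring is constant, so the determinant at
    \<open>s = 1\<close> equals that at \<open>s = 0\<close>.\<close>
  have "U 0 = mat 1" "U 1 = mat 1 + N"
    by (simp_all add: U_def vec_eq_iff)
  with pq(1)[of 0] pq(1)[of 1] show ?thesis by (simp add: c)
qed

lemma mpow_bound:
  fixes X :: "complex^'n^'n"
  shows "norm (mpow X k $ i $ j) \<le> (\<Sum>i\<in>UNIV. \<Sum>j\<in>UNIV. norm (X $ i $ j)) ^ k" (is "_ \<le> ?c ^ k")
proof (induction k arbitrary: i j)
  case (Suc k)
  have "norm (mpow X (Suc k) $ i $ j) \<le> (\<Sum>l\<in>UNIV. norm (X $ i $ l) * norm (mpow X k $ l $ j))"
    by (simp add: matrix_matrix_mult_def norm_mult[symmetric] sum_norm_le)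
  also have "\<dots> \<le> (\<Sum>l\<in>UNIV. norm (X $ i $ l) * ?c ^ k)"
    by (intro sum_mono mult_left_mono Suc) auto
  also have "\<dots> = (\<Sum>l\<in>UNIV. norm (X $ i $ l)) * ?c ^ k"
    by (simp add: sum_distrib_right)
  also have "\<dots> \<le> ?c * ?c ^ k"
    by (intro mult_right_mono member_le_sum[of i UNIV "\<lambda>i. \<Sum>j\<in>UNIV. norm (X $ i $ j)"])
      (auto intro!: sum_nonneg zero_le_power)
  finally show ?case by simp
qed (simp add: mat_def)

lemma divided_power_eq: "divided_power X k $ i $ j = mpow X k $ i $ j / fact k"
  by (simp add: divided_power_def mpow_def)

lemma divided_power_tendsto_0: "(\<lambda>k. divided_power X k $ i $ j) \<longlonglongrightarrow> 0"
proof -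
  let ?c = "\<Sum>i\<in>UNIV. \<Sum>j\<in>UNIV. norm (X $ i $ j)"
  have "(\<lambda>k. inverse (fact k) * ?c ^ k) \<longlonglongrightarrow> 0"
    by (rule summable_LIMSEQ_zero[OF summable_exp])
  then show ?thesis
    by (rule Lim_null_comparison[rotated])
      (use mpow_bound[of X] in \<open>auto simp: divided_power_eq norm_divide field_simps\<close>)
qed

text \<open>
  The operators \<open>X ^ k / k!\<close> tend to 0 and have integer matrices in the lattice basis, so they
  vanish for large \<open>k\<close>.
\<close>

lemma admissible_nilpotent:
  assumes "admissible_lattice_basis \<Phi> X B" "\<alpha> \<in> \<Phi>"
  shows "\<exists>K. mpow (X \<alpha>) K = 0"
proof -
  define C where "C = matrix_inv B"
  have B: "C ** B = mat 1" "B ** C = mat 1"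
    using assms(1) matrix_inv_inverse[of B] by (auto simp: admissible_lattice_basis_def C_def)
  define M where "M k = C ** divided_power (X \<alpha>) k ** B" for k
  have int: "M k $ i $ j \<in> \<int>" for k i j
  proof -
    \<comment> \<open>Column \<open>j\<close> of \<open>M k\<close> is read off from the image of
      the \<open>j\<close>-th lattice basis vector.\<close>
    have "B *v axis j 1 \<in> lattice_of B"
      by (auto simp: lattice_of_def axis_def intro!: exI[of _ "axis j 1"])
    then have "divided_power (X \<alpha>) k *v (B *v axis j 1) \<in> lattice_of B"
      using assms by (auto simp: admissible_lattice_basis_def)
    then obtain z where z: "divided_power (X \<alpha>) k *v (B *v axis j 1) = B *v z" "\<forall>i. z $ i \<in> \<int>"
      by (auto simp: lattice_of_def)
    have "M k *v axis j 1 = C *v (divided_power (X \<alpha>) k *v (B *v axis j 1))"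
      by (simp add: M_def matrix_vector_mul_assoc matrix_mul_assoc)
    also have "\<dots> = C *v (B *v z)"
      by (simp only: z(1))
    also have "\<dots> = z"
      by (simp add: matrix_vector_mul_assoc B)
    finally have "z = M k *v axis j 1" by simp
    then have "z $ i = M k $ i $ j"
      by (simp add: matrix_vector_mult_def axis_def if_distrib cong: if_cong)
    with z(2) show ?thesis by metis
  qed
  have lim: "(\<lambda>k. M k $ i $ j) \<longlonglongrightarrow> 0" for i j
    unfolding M_def matrix_matrix_mult_def vec_lambda_beta
    by (intro tendsto_null_sum tendsto_mult_left_zero tendsto_mult_right_zero divided_power_tendsto_0)
  have "\<forall>\<^sub>F k in sequentially. norm (M k $ i $ j) < 1" for i j
    using lim[of i j] by (auto dest: tendstoD[of _ _ _ 1] simp: dist_norm)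
  then have "\<forall>\<^sub>F k in sequentially. \<forall>i j. norm (M k $ i $ j) < 1"
    by (intro eventually_all_finite)
  then obtain k where k: "\<And>i j. norm (M k $ i $ j) < 1"
    by (auto simp: eventually_sequentially)
  have "M k $ i $ j = 0" for i j
    using k[of i j] int[of k i j] by (auto elim!: Ints_cases)
  then have "M k = 0" by (simp add: vec_eq_iff)
  have "divided_power (X \<alpha>) k = (B ** C) ** divided_power (X \<alpha>) k ** (B ** C)"
    by (simp add: B)
  also have "\<dots> = B ** M k ** C"
    by (simp add: M_def matrix_mul_assoc)
  finally have "divided_power (X \<alpha>) k = 0" using \<open>M k = 0\<close> by simp
  then have "mpow (X \<alpha>) k = 0"
    by (simp add: vec_eq_iff divided_power_eq)
  then show ?thesis ..
qed

text \<open>The exponential is \<open>1 + X P\<close> with \<open>P\<close> a polynomial in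
  \<open>X\<close>. As \<open>P\<close> commutes with \<open>X\<close>, the product
  \<open>X P\<close> is nilpotent along with \<open>X\<close>.\<close>

lemma det_exp_matrix:
  assumes "mpow X K = 0"
  shows "det (exp_matrix t X) = 1"
proof -
  define P where "P = (\<chi> i j. \<Sum>k<K. t ^ Suc k / fact (Suc k) * mpow X k $ i $ j)"
  have XP: "(X ** P) $ i $ j = (\<Sum>k<K. t ^ Suc k / fact (Suc k) * mpow X (Suc k) $ i $ j)" for i j
    unfolding P_def matrix_matrix_mult_def[of X] vec_lambda_beta sum_distrib_left
    by (subst sum.swap) (simp add: matrix_matrix_mult_def sum_distrib_left mult_ac del: fact_Suc)
  have "(P ** X) $ i $ j = (\<Sum>k<K. t ^ Suc k / fact (Suc k) * (mpow X k ** X) $ i $ j)" for i j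
    unfolding P_def matrix_matrix_mult_def[of _ X] vec_lambda_beta sum_distrib_right
    by (subst sum.swap) (simp add: sum_distrib_left mult_ac del: fact_Suc)
  then have comm: "X ** P = P ** X"
    by (simp add: vec_eq_iff XP mpow_commute[OF refl])
  have "mpow (X ** P) K = 0"
    by (simp add: mpow_mult[OF comm] assms)
  moreover have "exp_matrix t X = mat 1 + X ** P"
  proof (intro vec_eq_iff[THEN iffD2] allI)
    fix i j
    \<comment> \<open>Terms from \<open>K\<close> on vanish; the sum runs to \<open>Suc K\<close> so
      that, with term 0 split off, it has the \<open>K\<close> terms of
      \<open>X ** P\<close>.\<close>
    have "exp_matrix t X $ i $ j = (\<Sum>k<Suc K. t ^ k * divided_power X k $ i $ j)"
      unfolding exp_matrix_def vec_lambda_beta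
      by (rule suminf_finite) (auto simp: divided_power_eq mpow_eq_0[OF assms] simp del: lessThan_Suc)
    also have "\<dots> = mat 1 $ i $ j + (X ** P) $ i $ j"
      by (subst sum.lessThan_Suc_shift) (simp add: divided_power_eq XP del: fact_Suc)
    finally show "exp_matrix t X $ i $ j = (mat 1 + X ** P) $ i $ j" by simp
  qed
  ultimately show ?thesis by (simp add: det_unipotent)
qed

lemma group_invertible_matrices:
  "group (matrix_group {M :: 'k::field^'n^'n. invertible M})"
proof (rule groupI)
  fix M :: "'k^'n^'n" assume "M \<in> carrier (matrix_group {M. invertible M})"
  then obtain N where "M ** N = mat 1" "N ** M = mat 1"
    by (auto simp: matrix_group_def invertible_def)
  then show "\<exists>y\<in>carrier (matrix_group {M. invertible M}).
      y \<otimes>\<^bsub>matrix_group {M. invertible M}\<^esub> M = \<one>\<^bsub>matrix_group {M. invertible M}\<^esub>"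
    by (auto simp: matrix_group_def invertible_def)
next
  have "invertible (mat 1 :: 'k^'n^'n)"
    by (auto simp: invertible_def)
  then show "\<one>\<^bsub>matrix_group {M :: 'k^'n^'n. invertible M}\<^esub> \<in> carrier (matrix_group {M. invertible M})"
    by (simp add: matrix_group_def)
qed (simp_all add: matrix_group_def invertible_mult matrix_mul_assoc)

text \<open>The inverse is a definite description over the carrier, so it is the adjugate as soon as
  \<open>S\<close> contains it, whether or not \<open>S\<close> is known to be a group.\<close>

lemma inv_matrix_group:
  fixes M :: "'k::field^'n^'n"
  assumes "det M = 1" "adjugate M \<in> S"
  shows "inv\<^bsub>matrix_group S\<^esub> M = adjugate M"
  unfolding m_inv_def matrix_group_def
proof (rule the_equality)
  show "adjugate M \<in> carrier \<lparr>carrier = S, mult = (**), one = mat 1\<rparr> \<and>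
    M \<otimes>\<^bsub>\<lparr>carrier = S, mult = (**), one = mat 1\<rparr>\<^esub> adjugate M = \<one>\<^bsub>\<lparr>carrier = S, mult = (**), one = mat 1\<rparr>\<^esub> \<and>
    adjugate M \<otimes>\<^bsub>\<lparr>carrier = S, mult = (**), one = mat 1\<rparr>\<^esub> M = \<one>\<^bsub>\<lparr>carrier = S, mult = (**), one = mat 1\<rparr>\<^esub>"
    using assms matrix_mul_adjugate[OF assms(1)] by simp
qed (simp add: adjugate_unique[OF assms(1)])

context
  fixes \<Phi> :: "'e set" and X :: "'e \<Rightarrow> complex^'n^'n" and B :: "complex^'n^'n"
  assumes adm: "admissible_lattice_basis \<Phi> X B"
begin

text \<open>Conjugation by \<open>B\<close> preserves the determinant, and the root elements are
  exponentials of nilpotent matrices.\<close>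

lemma complex_chevalley_group_det:
  assumes "g \<in> complex_chevalley_group \<Phi> X B"
  shows "det g = 1"
proof -
  let ?G = "matrix_group {M :: complex^'n^'n. invertible M}"
  let ?H = "{matrix_inv B ** exp_matrix t (X \<alpha>) ** B | t \<alpha>. \<alpha> \<in> \<Phi>}"
  have "det (matrix_inv B) * det B = 1"
    using adm matrix_inv_inverse(2)[of B] det_mul[of "matrix_inv B" B]
    by (simp add: admissible_lattice_basis_def)
  then have gen: "det h = 1" if "h \<in> ?H" for h
    using that admissible_nilpotent[OF adm] det_exp_matrix by (fastforce simp: det_mul)
  from assms show ?thesis
    unfolding complex_chevalley_group_def
  proof induction
    case (inv h)
    have "invertible (adjugate h)"
      using det_adjugate[OF gen[OF inv]] by (simp add: invertible_det_nz)
    then show ?case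
      using inv_matrix_group[OF gen[OF inv]] det_adjugate[OF gen[OF inv]] by simp
  qed (use gen in \<open>auto simp: matrix_group_def det_mul\<close>)
qed

lemma complex_chevalley_group_adjugate:
  assumes "g \<in> complex_chevalley_group \<Phi> X B"
  shows "adjugate g \<in> complex_chevalley_group \<Phi> X B"
proof -
  let ?G = "matrix_group {M :: complex^'n^'n. invertible M}"
  interpret G: group ?G by (rule group_invertible_matrices)
  have sub: "{matrix_inv B ** exp_matrix t (X \<alpha>) ** B | t \<alpha>. \<alpha> \<in> \<Phi>} \<subseteq> carrier ?G"
  proof
    fix h assume h: "h \<in> {matrix_inv B ** exp_matrix t (X \<alpha>) ** B | t \<alpha>. \<alpha> \<in> \<Phi>}"
    then have "det h = 1"
      by (intro complex_chevalley_group_det) (auto simp: complex_chevalley_group_def intro: generate.incl)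
    then show "h \<in> carrier ?G" by (simp add: matrix_group_def invertible_det_nz)
  qed
  have "inv\<^bsub>?G\<^esub> g \<in> complex_chevalley_group \<Phi> X B"
    using G.generate_m_inv_closed[OF sub] assms by (simp add: complex_chevalley_group_def)
  moreover have "inv\<^bsub>?G\<^esub> g = adjugate g"
    using complex_chevalley_group_det[OF assms] det_adjugate[of g]
    by (intro inv_matrix_group) (auto simp: invertible_det_nz)
  ultimately show ?thesis by simp
qed

lemma entries_adjugate:
  "entries (adjugate N) = (\<lambda>v. adjugate (\<chi> i j. entries N (i, j)) $ fst v $ snd v)"
  by (simp add: entries_def fun_eq_iff split_beta)

text \<open>If \<open>p\<close> vanishes on the complex group, so does \<open>p\<close> composed
  with the adjugate, because that group contains its inverses. The composite is again an integer
  polynomial, hence vanishes at \<open>M\<close>.\<close>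

lemma chevalley_group_adjugate:
  fixes M :: "'r::field^'n^'n"
  assumes "M \<in> chevalley_group \<Phi> X B UNIV"
  shows "adjugate M \<in> chevalley_group \<Phi> X B UNIV"
proof -
  have det: "det M = 1" using assms by (simp add: chevalley_group_def)
  have "eval_poly p (entries (adjugate M)) = 0"
    if p: "\<forall>g\<in>complex_chevalley_group \<Phi> X B. eval_poly p (entries g) = 0" for p
  proof -
    have "int_poly
        (\<lambda>x :: 'n \<times> 'n \<Rightarrow> complex. eval_poly p (\<lambda>v. adjugate (\<chi> i j. x (i, j)) $ fst v $ snd v))
        (\<lambda>x :: 'n \<times> 'n \<Rightarrow> 'r. eval_poly p (\<lambda>v. adjugate (\<chi> i j. x (i, j)) $ fst v $ snd v))"
      by (intro int_poly_compose[OF int_poly_eval_poly] int_poly_adjugate int_poly.var)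
    from int_poly_imp_eval_poly[OF this, unfolded fun_eq_iff] obtain q where q:
      "\<And>x :: 'n \<times> 'n \<Rightarrow> complex. eval_poly p (\<lambda>v. adjugate (\<chi> i j. x (i, j)) $ fst v $ snd v) = eval_poly q x"
      "\<And>x :: 'n \<times> 'n \<Rightarrow> 'r. eval_poly p (\<lambda>v. adjugate (\<chi> i j. x (i, j)) $ fst v $ snd v) = eval_poly q x"
      by blast
    have "eval_poly q (entries g) = 0" if "g \<in> complex_chevalley_group \<Phi> X B" for g
      using p complex_chevalley_group_adjugate[OF that] unfolding q(1)[symmetric] entries_adjugate[symmetric] by simp
    then have "eval_poly q (entries M) = 0"
      using assms by (simp add: chevalley_group_def)
    then show ?thesis unfolding q(2)[symmetric] entries_adjugate[symmetric] by simp
  qed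
  then show ?thesis
    using det_adjugate[OF det] by (simp add: chevalley_group_def)
qed

end

lemma eval_poly_of_int: "eval_poly p (\<lambda>v. of_int (x v)) = of_int (eval_poly p x)"
  unfolding eval_poly_def by simp

lemma entries_mat_1: "entries (mat 1) = (\<lambda>v. of_int (of_bool (fst v = snd v)))"
  by (auto simp: entries_def mat_def)

text \<open>The value of \<open>p\<close> at the identity is the image of an integer. This integer
  is 0 because its complex image is, whatever the characteristic of the target ring.\<close>

lemma mat_1_chevalley_group:
  assumes "0 \<in> K" "1 \<in> K"
  shows "(mat 1 :: 'r::comm_ring_1^'n^'n) \<in> chevalley_group \<Phi> X B K"
proof -
  have "eval_poly p (entries (mat 1 :: 'r^'n^'n)) = 0"
    if "\<forall>g\<in>complex_chevalley_group \<Phi> X B. eval_poly p (entries g) = 0" for p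
  proof -
    have "mat 1 \<in> complex_chevalley_group \<Phi> X B"
      unfolding complex_chevalley_group_def
      using generate.one[of "matrix_group {M :: complex^'n^'n. invertible M}"]
      by (simp add: matrix_group_def)
    then have "eval_poly p (entries (mat 1 :: complex^'n^'n)) = 0" using that by blast
    then show ?thesis
      unfolding entries_mat_1 eval_poly_of_int of_int_eq_0_iff by simp
  qed
  moreover have "(mat 1 :: 'r^'n^'n) $ i $ j \<in> K" for i j
    using assms by (simp add: mat_def)
  ultimately show ?thesis by (simp add: chevalley_group_def)
qed

section \<open>Translation of group equations\<close>

lemma computable_imp_recursive:
  assumes "computable (f :: 'a::coded \<Rightarrow> nat)"
  shows "\<exists>g. recursive 1 g \<and> (\<forall>x. g [enc x] = f x)"
proof -
  obtain g where g: "recursive 1 g" "\<And>xs. length xs = 1 \<Longrightarrow> g xs = f (dec (xs ! 0))"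
    using assms by (auto simp: computable_def rec_fun_def)
  have "g [enc x] = f x" for x by (simp add: g(2))
  with g(1) show ?thesis by blast
qed

text \<open>The quotient counts the complete blocks of four below \<open>f x\<close>; it is used to
  decode letters.\<close>

lemma computable_div4 [comp]:
  fixes f :: "'a::coded \<Rightarrow> nat"
  assumes "computable f" shows "computable (\<lambda>x. f x div 4)"
proof -
  have "computable (\<lambda>x. length (filter (\<lambda>k. 4 * k + 4 \<le> f x) [0..<f x]))"
    by (intro comp assms computable_compose[OF assms])
  moreover have "length (filter (\<lambda>k. 4 * k + 4 \<le> n) [0..<n]) = n div 4" for n :: nat
  proof -
    have "{i. i < n \<and> 4 * i + 4 \<le> n} = {..<n div 4}" by auto
    then show ?thesis by (simp add: length_filter_conv_card cong: conj_cong)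
  qed
  ultimately show ?thesis by simp
qed

lemma computable_mod4 [comp]:
  fixes f :: "'a::coded \<Rightarrow> nat"
  assumes "computable f" shows "computable (\<lambda>x. f x mod 4)"
proof -
  have "computable (\<lambda>x. f x - 4 * (f x div 4))"
    by (intro comp assms)
  moreover have "n - 4 * (n div 4) = n mod 4" for n :: nat
    by (rule minus_mult_div_eq_mod)
  ultimately show ?thesis by simp
qed

text \<open>Bounds the letter codes in a system, and with them the indices of its variables, by the
  code of the system.\<close>

lemma enc_mem_le: "x \<in> set xs \<Longrightarrow> enc x \<le> enc xs"
proof (induction xs)
  case (Cons a xs)
  then show ?case
    using le_prod_encode_1[of "enc a" "enc xs"] le_prod_encode_2[of "enc xs" "enc a"]
    by (auto simp: enc_list_def intro: le_SucI order_trans)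
qed simp

lemma enc_fst_le: "enc (fst p) \<le> enc p" and enc_snd_le: "enc (snd p) \<le> enc p"
  by (simp_all add: enc_prod_def le_prod_encode_1 le_prod_encode_2)

section \<open>Matrices of polynomials as lists\<close>

definition coord :: "'v::finite \<Rightarrow> nat" where
  "coord = to_nat_on UNIV"

definition uncoord :: "nat \<Rightarrow> 'v::finite" where
  "uncoord = from_nat_into UNIV"

lemma uncoord_coord [simp]: "uncoord (coord v) = v"
  by (simp add: coord_def uncoord_def countable_finite)

lemma coord_less: "coord (v :: 'v::finite) < CARD('v)"
  using bij_betwE[OF to_nat_on_finite[of "UNIV :: 'v set"]] by (simp add: coord_def)

lemma bij_uncoord: "bij_betw (uncoord :: nat \<Rightarrow> 'v::finite) {..<CARD('v)} UNIV"
  using bij_betw_from_nat_into_finite[of "UNIV :: 'v set"] by (simp add: uncoord_def)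

definition tuple_code :: "('v::finite \<Rightarrow> 'c) \<Rightarrow> 'c list" where
  "tuple_code F = map (\<lambda>i. F (uncoord i)) [0..<CARD('v)]"

lemma nth_tuple_code: "nth_default d (tuple_code F) (coord v) = F v"
  using coord_less[of v] by (simp add: tuple_code_def nth_default_def)

lemma set_tuple_code:
  fixes F :: "'v::finite \<Rightarrow> 'c"
  shows "set (tuple_code F) = range F"
proof -
  have "set (tuple_code F) = F ` (uncoord ` {..<CARD('v)})"
    by (auto simp: tuple_code_def)
  then show ?thesis
    using bij_betw_imp_surj_on[OF bij_uncoord[where 'v='v]] by simp
qed

lemma sum_list_tuple_code:
  fixes F :: "'v::finite \<Rightarrow> 'c::comm_monoid_add"
  shows "sum_list (tuple_code F) = (\<Sum>v\<in>UNIV. F v)"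
proof -
  have "sum_list (tuple_code F) = (\<Sum>i<CARD('v). F (uncoord i))"
    by (simp add: tuple_code_def sum_set_upt_conv_sum_list_nat[symmetric] atLeast0LessThan)
  also have "\<dots> = (\<Sum>v\<in>UNIV. F v)"
    by (rule sum.reindex_bij_betw[OF bij_uncoord])
  finally show ?thesis .
qed

lemma computable_tuple_code [comp]:
  fixes F :: "'a::coded \<Rightarrow> 'v::finite \<Rightarrow> 'c::coded"
  assumes "\<And>v. computable (\<lambda>x. F x v)"
  shows "computable (\<lambda>x. tuple_code (F x))"
proof -
  have "computable (\<lambda>x. map (\<lambda>G. G x) (map (\<lambda>i x. F x (uncoord i)) [0..<CARD('v)]))"
    by (rule computable_map_fixed) (auto intro: assms)
  then show ?thesis by (simp add: tuple_code_def comp_def)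
qed

context coded_ring
begin

definition coords :: "(nat \<Rightarrow> 'r) \<Rightarrow> mpoly list \<Rightarrow> 'v::finite \<Rightarrow> 'r" where
  "coords \<sigma> X v = ev \<sigma> (nth_default [] X (coord v))"

definition matrix_of :: "(nat \<Rightarrow> 'r) \<Rightarrow> mpoly list \<Rightarrow> 'r^'n^'n" where
  "matrix_of \<sigma> X = (\<chi> i j. coords \<sigma> X (i, j))"

lemma coords_tuple_code: "coords \<sigma> (tuple_code F) = (\<lambda>v. ev \<sigma> (F v))"
  by (simp add: coords_def fun_eq_iff nth_tuple_code)

lemma entries_matrix_of: "entries (matrix_of \<sigma> X) = coords \<sigma> X"
  by (auto simp: entries_def matrix_of_def)

lemma ev_concat: "ev \<sigma> (concat ps) = sum_list (map (ev \<sigma>) ps)"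
  by (induction ps) auto

text \<open>Provides codes for the integer coefficients of the defining equations.\<close>

lemma surj_of_int: "\<exists>k. \<nu> k = of_int c"
proof (induction c rule: int_induct[of _ 0])
  case base
  show ?case using \<nu>_zero by auto
next
  case (step1 i)
  then obtain k where "\<nu> k = of_int i" by blast
  then have "\<nu> (cadd k cunit) = of_int (i + 1)" by (simp add: \<nu>_add \<nu>_one)
  then show ?case by blast
next
  case (step2 i)
  then obtain k where "\<nu> k = of_int i" by blast
  then have "\<nu> (cadd k (cneg cunit)) = of_int (i - 1)" by (simp add: \<nu>_add \<nu>_one \<nu>_neg)
  then show ?case by blast
qed

text \<open>Lists do not carry the dimension, so a type argument supplies it.\<close>

definition mat_mult :: "'n::finite itself \<Rightarrow> mpoly list \<Rightarrow> mpoly list \<Rightarrow> mpoly list" where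
  "mat_mult t X Y = tuple_code (\<lambda>v :: 'n \<times> 'n. concat (tuple_code (\<lambda>k :: 'n.
     mmul (nth_default [] X (coord (fst v, k))) (nth_default [] Y (coord (k, snd v))))))"

lemma matrix_of_mat_mult:
  "matrix_of \<sigma> (mat_mult TYPE('n::finite) X Y) = (matrix_of \<sigma> X ** matrix_of \<sigma> Y :: 'r^'n^'n)"
proof -
  have "map (ev \<sigma>) (tuple_code F) = tuple_code (\<lambda>k. ev \<sigma> (F k))" for F :: "'n \<Rightarrow> mpoly"
    by (simp add: tuple_code_def)
  then show ?thesis
    by (simp add: matrix_of_def mat_mult_def coords_tuple_code ev_concat sum_list_tuple_code
        matrix_matrix_mult_def) (simp add: coords_def)
qed

text \<open>The \<open>i\<close>-th group variable becomes a generic matrix whose entries are the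
  \<open>i\<close>-th block of consecutive unknowns, one for each matrix position.\<close>

definition var_matrix :: "'n::finite itself \<Rightarrow> nat \<Rightarrow> mpoly list" where
  "var_matrix t i = tuple_code (\<lambda>v :: 'n \<times> 'n.
     [(cunit, replicate (i * CARD('n \<times> 'n) + coord v) 0 @ [1])])"

lemma matrix_of_var_matrix:
  "matrix_of \<sigma> (var_matrix TYPE('n::finite) i) $ r $ c = \<sigma> (i * CARD('n \<times> 'n) + coord (r, c :: 'n))"
proof -
  have "mono \<sigma> (replicate k 0 @ [1]) = \<sigma> k" for k
  proof -
    have "(\<Prod>i<k. \<sigma> i ^ ((replicate k 0 @ [1 :: nat]) ! i)) = 1"
      by (rule prod.neutral) (auto simp: nth_append)
    then show ?thesis by (simp add: mono_def nth_append)
  qed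
  then show ?thesis
    by (simp add: matrix_of_def var_matrix_def coords_tuple_code ev_Cons \<nu>_one)
qed

definition id_matrix :: "'n::finite itself \<Rightarrow> mpoly list" where
  "id_matrix t = tuple_code (\<lambda>v :: 'n \<times> 'n. if fst v = snd v then mconst cunit else [])"

lemma matrix_of_id_matrix: "matrix_of \<sigma> (id_matrix TYPE('n::finite)) = (mat 1 :: 'r^'n^'n)"
  by (simp add: matrix_of_def id_matrix_def coords_tuple_code mat_def vec_eq_iff \<nu>_one)

definition const_matrix :: "('v::finite \<Rightarrow> nat) \<Rightarrow> mpoly list" where
  "const_matrix F = tuple_code (\<lambda>v. mconst (F v))"

lemma coords_const_matrix: "coords \<sigma> (const_matrix F) = (\<lambda>v. \<nu> (F v))"
  by (simp add: const_matrix_def coords_tuple_code)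

end

context computable_field
begin

lemma computable_mat_mult [comp]:
  "computable f \<Longrightarrow> computable g \<Longrightarrow> computable (\<lambda>x. mat_mult TYPE('n::finite) (f x) (g x))"
  unfolding mat_mult_def by (intro comp)

lemma computable_var_matrix [comp]:
  "computable f \<Longrightarrow> computable (\<lambda>x. var_matrix TYPE('n::finite) (f x))"
  unfolding var_matrix_def by (intro comp)

lemma computable_const_matrix [comp]:
  "(\<And>v. computable (\<lambda>x. F x v)) \<Longrightarrow> computable (\<lambda>x. const_matrix (F x))"
  unfolding const_matrix_def by (intro comp)

text \<open>The program follows the inductive construction of the polynomial and substitutes the
  listed polynomials for its variables.\<close>

lemma int_poly_computable:
  fixes h :: "('v::finite \<Rightarrow> 'r) \<Rightarrow> 'r"
  assumes "int_poly f h"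
  shows "\<exists>P. computable P \<and> (\<forall>\<sigma> X. ev \<sigma> (P X) = h (coords \<sigma> X))"
  using assms
proof induction
  case (const c)
  obtain k where "\<nu> k = of_int c" using surj_of_int by blast
  then show ?case by (intro exI[of _ "\<lambda>X. mconst k"]) (auto intro: comp)
next
  case (var v)
  have "computable (\<lambda>X. nth_default [] X (coord v) :: mpoly)" by (intro comp)
  then show ?case by (intro exI[of _ "\<lambda>X. nth_default [] X (coord v)"]) (auto simp: coords_def)
next
  case (add f h f' h')
  then obtain P Q where "computable P" "computable Q"
    "\<forall>\<sigma> X. ev \<sigma> (P X) = h (coords \<sigma> X)" "\<forall>\<sigma> X. ev \<sigma> (Q X) = h' (coords \<sigma> X)" by blast
  then show ?case by (intro exI[of _ "\<lambda>X. P X @ Q X"]) (auto intro: comp)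
next
  case (mult f h f' h')
  then obtain P Q where "computable P" "computable Q"
    "\<forall>\<sigma> X. ev \<sigma> (P X) = h (coords \<sigma> X)" "\<forall>\<sigma> X. ev \<sigma> (Q X) = h' (coords \<sigma> X)" by blast
  then show ?case by (intro exI[of _ "\<lambda>X. mmul (P X) (Q X)"]) (auto intro: comp)
qed

lemma adjugate_computable:
  "\<exists>adj. computable adj \<and> (\<forall>\<sigma> X. matrix_of \<sigma> (adj X) = adjugate (matrix_of \<sigma> X :: 'r^'n^'n))"
proof -
  have "\<forall>v :: 'n \<times> 'n. \<exists>P. computable P \<and> (\<forall>\<sigma> X. ev \<sigma> (P X) =
      adjugate (\<chi> i j. coords \<sigma> X (i, j)) $ fst v $ snd v)"
  proof
    fix v :: "'n \<times> 'n"
    have "int_poly (\<lambda>x :: 'n \<times> 'n \<Rightarrow> int. adjugate (\<chi> i j. x (i, j)) $ fst v $ snd v)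
       (\<lambda>x :: 'n \<times> 'n \<Rightarrow> 'r. adjugate (\<chi> i j. x (i, j)) $ fst v $ snd v)"
      by (intro int_poly_adjugate int_poly.var)
    from int_poly_computable[OF this]
    show "\<exists>P. computable P \<and> (\<forall>\<sigma> X. ev \<sigma> (P X) =
      adjugate (\<chi> i j. coords \<sigma> X (i, j)) $ fst v $ snd v)" .
  qed
  then obtain P where P: "\<And>v. computable (P v)" "\<And>v \<sigma> X. ev \<sigma> (P v X) =
      adjugate (\<chi> i j. coords \<sigma> X (i :: 'n, j :: 'n)) $ fst v $ snd v"
    by metis
  have "computable (\<lambda>X. tuple_code (\<lambda>v. P v X))"
    by (intro comp P)
  moreover have "matrix_of \<sigma> (tuple_code (\<lambda>v. P v X)) = adjugate (matrix_of \<sigma> X :: 'r^'n^'n)" for \<sigma> X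
    by (simp add: matrix_of_def coords_tuple_code P(2) vec_eq_iff)
  ultimately show ?thesis by blast
qed

end

text \<open>The zero test compares with one fixed code of 0.\<close>

lemma computable_enumeration_imp_field:
  fixes \<nu> :: "nat \<Rightarrow> 'r::alg_closed_field"
  assumes "computable_enumeration \<nu> A"
  shows "\<exists>cadd cmul cneg czero cunit. computable_field \<nu> cadd cmul cneg czero cunit"
proof -
  have ops: "computable_operation \<nu> 0 (\<lambda>xs. 0)" "computable_operation \<nu> 0 (\<lambda>xs. 1)"
     "computable_operation \<nu> 2 (\<lambda>xs. xs ! 0 + xs ! 1)" "computable_operation \<nu> 1 (\<lambda>xs. - (xs ! 0))"
     "computable_operation \<nu> 2 (\<lambda>xs. xs ! 0 * xs ! 1)" "computable_predicate \<nu> 2 (\<lambda>xs. xs ! 0 = xs ! 1)"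
    using assms by (simp_all add: computable_enumeration_def)
  obtain z :: "nat list \<Rightarrow> nat" where z: "\<forall>xs. length xs = 0 \<longrightarrow> 0 = \<nu> (z xs)"
    using ops(1)[unfolded computable_operation_def] by blast
  obtain o' :: "nat list \<Rightarrow> nat" where o': "\<forall>xs. length xs = 0 \<longrightarrow> 1 = \<nu> (o' xs)"
    using ops(2)[unfolded computable_operation_def] by blast
  obtain a where a: "recursive 2 a" "\<forall>xs. length xs = 2 \<longrightarrow> map \<nu> xs ! 0 + map \<nu> xs ! 1 = \<nu> (a xs)"
    using ops(3)[unfolded computable_operation_def] by blast
  obtain n where n: "recursive 1 n" "\<forall>xs. length xs = 1 \<longrightarrow> - (map \<nu> xs ! 0) = \<nu> (n xs)"
    using ops(4)[unfolded computable_operation_def] by blast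
  obtain m where m: "recursive 2 m" "\<forall>xs. length xs = 2 \<longrightarrow> map \<nu> xs ! 0 * map \<nu> xs ! 1 = \<nu> (m xs)"
    using ops(5)[unfolded computable_operation_def] by blast
  obtain q where q: "recursive 2 q"
    "\<forall>xs. length xs = 2 \<longrightarrow> q xs = of_bool (map \<nu> xs ! 0 = map \<nu> xs ! 1)"
    using ops(6)[unfolded computable_predicate_def] by blast
  have z0: "\<nu> (z []) = 0" and o1: "\<nu> (o' []) = 1" using z o' by simp_all
  have "computable (\<lambda>p. a [fst p, snd p])" "computable (\<lambda>p. m [fst p, snd p])"
    "computable (\<lambda>c. n [c])" "computable (\<lambda>c. q [c, z []])"
    by (intro computable_recursive1 computable_recursive2 a(1) m(1) n(1) q(1) comp)+
  moreover have "q [c, z []] = of_bool (\<nu> c = 0)" for c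
    using q(2)[rule_format, of "[c, z []]"] z0 by simp
  moreover have "\<nu> (a [x, y]) = \<nu> x + \<nu> y" "\<nu> (m [x, y]) = \<nu> x * \<nu> y" "\<nu> (n [x]) = - \<nu> x" for x y
    using a(2)[rule_format, of "[x, y]"] m(2)[rule_format, of "[x, y]"] n(2)[rule_format, of "[x]"]
    by simp_all
  ultimately have "computable_field \<nu> (\<lambda>x y. a [x, y]) (\<lambda>x y. m [x, y]) (\<lambda>x. n [x]) (z []) (o' [])"
    by unfold_locales (simp_all add: z0 o1)
  then show ?thesis by blast
qed

section \<open>Finitely many defining equations\<close>

lemma int_poly_polynomial_function:
  assumes "int_poly f h" "set vs = UNIV"
  shows "h \<in> polynomial_functions vs"
  using assms(1)
proof induction
  case (add f h f' h')
  then show ?case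
    using subringD(4)[OF subring_polynomial_functions[of vs]] unfolding plus_fun_def by blast
next
  case (mult f h f' h')
  then show ?case
    using subringD(5)[OF subring_polynomial_functions[of vs]] unfolding times_fun_def by blast
qed (auto intro: const_polynomial_functions var_polynomial_functions simp: assms(2))

text \<open>The determinant condition is counted among the equations. The set \<open>K\<close>
  restricts only the entries, so one finite subsystem serves all \<open>K\<close>.\<close>

lemma chevalley_group_finite_system:
  fixes X :: "'e \<Rightarrow> complex^'n^'n"
  shows "\<exists>F :: (('n \<times> 'n \<Rightarrow> 'r::field) \<Rightarrow> 'r) set. finite F \<and>
    (\<forall>h\<in>F. \<exists>f :: ('n \<times> 'n \<Rightarrow> int) \<Rightarrow> int. int_poly f h) \<and>
    (\<forall>K M. M \<in> chevalley_group \<Phi> X B K \<longleftrightarrow>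
       (\<forall>i j. M $ i $ j \<in> K) \<and> (\<forall>h\<in>F. h (entries M) = 0))"
proof -
  define D :: "('n \<times> 'n \<Rightarrow> 'r) \<Rightarrow> 'r" where "D x = det (\<chi> i j. x (i, j)) + of_int (- 1)" for x
  define Y :: "(('n \<times> 'n \<Rightarrow> 'r) \<Rightarrow> 'r) set" where
    "Y = insert D (eval_poly ` {p. \<forall>g\<in>complex_chevalley_group \<Phi> X B. eval_poly p (entries g) = 0})"
  have "int_poly (\<lambda>x :: 'n \<times> 'n \<Rightarrow> int. det (\<chi> i j. x (i, j)) + of_int (- 1)) D"
    unfolding D_def by (intro int_poly.add int_poly.const int_poly_det int_poly.var)
  then have Y: "\<exists>f :: ('n \<times> 'n \<Rightarrow> int) \<Rightarrow> int. int_poly f h" if "h \<in> Y" for h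
    using that int_poly_eval_poly unfolding Y_def by blast
  obtain vs :: "('n \<times> 'n) list" where vs: "set vs = UNIV"
    using finite_list[of "UNIV :: ('n \<times> 'n) set"] by auto
  have "Y \<subseteq> polynomial_functions vs"
    using Y int_poly_polynomial_function[OF _ vs] by blast
  from finite_subsystem[OF this] obtain F where F: "F \<subseteq> Y" "finite F"
    "\<forall>x. (\<forall>h\<in>F. h x = 0) \<longrightarrow> (\<forall>h\<in>Y. h x = 0)"
    by blast
  have "D (entries M) = 0 \<longleftrightarrow> det M = 1" for M
    by (simp add: D_def entries_def)
  then have M: "M \<in> chevalley_group \<Phi> X B K \<longleftrightarrow> (\<forall>i j. M $ i $ j \<in> K) \<and> (\<forall>h\<in>Y. h (entries M) = 0)" for M K
    by (simp add: chevalley_group_def Y_def)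
  have "(\<forall>h\<in>F. h x = 0) \<longleftrightarrow> (\<forall>h\<in>Y. h x = 0)" for x
    using F(1,3) by blast
  with M have "\<forall>K M. M \<in> chevalley_group \<Phi> X B K \<longleftrightarrow>
       (\<forall>i j. M $ i $ j \<in> K) \<and> (\<forall>h\<in>F. h (entries M) = 0)"
    by simp
  moreover have "\<forall>h\<in>F. \<exists>f :: ('n \<times> 'n \<Rightarrow> int) \<Rightarrow> int. int_poly f h"
    using Y F(1) by blast
  ultimately show ?thesis using F(2) by blast
qed

locale chevalley_matrices = computable_field \<nu> cadd cmul cneg czero cunit
  for \<nu> :: "nat \<Rightarrow> 'r::alg_closed_field" and cadd cmul cneg czero cunit +
  fixes \<Phi> :: "'e set" and X :: "'e \<Rightarrow> complex^'n^'n" and B :: "complex^'n^'n"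
    and Ps :: "(mpoly list \<Rightarrow> mpoly) list"
  assumes adm: "admissible_lattice_basis \<Phi> X B"
    and computable_Ps: "P \<in> set Ps \<Longrightarrow> computable P"
    and chevalley_group_iff: "matrix_of \<sigma> Z \<in> chevalley_group \<Phi> X B (K :: 'r set) \<longleftrightarrow>
      (\<forall>i j. (matrix_of \<sigma> Z :: 'r^'n^'n) $ i $ j \<in> K) \<and> (\<forall>P\<in>set Ps. ev \<sigma> (P Z) = 0)"
begin

abbreviation G :: "'r set \<Rightarrow> ('r^'n^'n) set" where
  "G \<equiv> chevalley_group \<Phi> X B"

definition in_group :: "mpoly list \<Rightarrow> bool" where
  "in_group Z \<longleftrightarrow> list_all (\<lambda>p. ev (\<lambda>_. 0) p = 0) (map (\<lambda>P. P Z) Ps)"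

lemma decidable_in_group [comp]: "computable f \<Longrightarrow> decidable (\<lambda>x. in_group (f x))"
  unfolding in_group_def
  by (intro comp) (rule computable_compose[OF computable_map_fixed], auto intro: computable_Ps)

text \<open>A number is read as a list of codes for the matrix entries. The defining equations at
  these constants can be tested, and matrices that violate them are replaced by the
  identity.\<close>

lemma ex_proper_enumeration:
  assumes \<nu>: "computable_enumeration \<nu> A" and A: "0 \<in> A" "1 \<in> A"
  shows "\<exists>\<mu>. proper_enumeration A (G A) \<mu>"
proof -
  define F where "F k v = nth_default czero (dec k) (coord (v :: 'n \<times> 'n))" for k v
  define f where "f k v = (if in_group (const_matrix (F k)) then F k v
      else if fst v = snd v then cunit else czero)" for k v
  define \<mu> :: "nat \<Rightarrow> 'r^'n^'n" where "\<mu> k = (\<chi> i j. \<nu> (f k (i, j)))" for k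
  have range: "range \<nu> = A" using \<nu> by (simp add: computable_enumeration_def)
  have mat: "matrix_of (\<lambda>_. 0) (const_matrix (F k)) = (\<chi> i j. \<nu> (F k (i, j)))" for k
    by (simp add: matrix_of_def coords_const_matrix)
  have iff: "(\<chi> i j. \<nu> (F k (i, j))) \<in> G A \<longleftrightarrow> in_group (const_matrix (F k))" for k
    using chevalley_group_iff[of "\<lambda>_. 0" "const_matrix (F k)" A] range
    by (auto simp: in_group_def list_all_iff mat)
  have \<mu>_eq: "\<mu> k = (if in_group (const_matrix (F k)) then (\<chi> i j. \<nu> (F k (i, j))) else mat 1)" for k
    by (auto simp: \<mu>_def f_def vec_eq_iff mat_def \<nu>_one \<nu>_zero)
  have "range \<mu> = G A"
  proof
    show "range \<mu> \<subseteq> G A"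
      using mat_1_chevalley_group[OF A] by (auto simp: \<mu>_eq iff)
    show "G A \<subseteq> range \<mu>"
    proof
      fix M assume M: "M \<in> G A"
      then have "\<forall>v. \<exists>c. \<nu> c = M $ fst v $ snd v"
        using range by (auto simp: chevalley_group_def image_iff) metis
      then obtain c where c: "\<And>v. \<nu> (c v) = M $ fst v $ snd v" by metis
      have "F (enc (tuple_code c)) = c"
        by (simp add: F_def fun_eq_iff nth_tuple_code)
      then have "(\<chi> i j. \<nu> (F (enc (tuple_code c)) (i, j))) = M"
        by (simp add: c vec_eq_iff)
      with M iff[of "enc (tuple_code c)"] have "\<mu> (enc (tuple_code c)) = M"
        by (simp add: \<mu>_eq)
      then show "M \<in> range \<mu>" by blast
    qed
  qed
  moreover have "\<exists>g. recursive 1 g \<and> (\<forall>k. \<mu> k $ i $ j = \<nu> (g [k]))" for i j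
  proof -
    have "computable (\<lambda>k. f k (i, j))"
      unfolding f_def F_def by (intro comp)
    from computable_imp_recursive[OF this] obtain g
      where "recursive 1 g" "\<And>k :: nat. g [enc k] = f k (i, j)" by blast
    then show ?thesis by (intro exI[of _ g]) (simp add: \<mu>_def)
  qed
  ultimately have "proper_enumeration A (G A) \<mu>"
    using \<nu> unfolding proper_enumeration_def by blast
  then show ?thesis by blast
qed

end

section \<open>Group equations as polynomial equations\<close>

locale coded_equations = chevalley_matrices \<nu> cadd cmul cneg czero cunit \<Phi> X B Ps
  for \<nu> :: "nat \<Rightarrow> 'r::alg_closed_field" and cadd cmul cneg czero cunit
    and \<Phi> :: "'e set" and X :: "'e \<Rightarrow> complex^'n^'n" and B Ps +
  fixes \<mu> :: "nat \<Rightarrow> 'r^'n^'n" and c :: "'n \<times> 'n \<Rightarrow> nat \<Rightarrow> nat" and adj :: "mpoly list \<Rightarrow> mpoly list"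
  assumes \<mu>: "\<mu> k \<in> G UNIV" and c: "\<mu> k $ i $ j = \<nu> (c (i, j) k)"
    and computable_c: "computable (c v)"
    and computable_adj: "computable adj"
    and adj: "matrix_of \<sigma> (adj Z) = adjugate (matrix_of \<sigma> Z :: 'r^'n^'n)"
begin

text \<open>Decodes \<open>letter_code\<close>: the residue modulo 4 tells variables from constants,
  and odd residues mark inverses.\<close>

definition letter_matrix :: "nat \<Rightarrow> mpoly list" where
  "letter_matrix l = (let Z = if l mod 4 \<le> 1 then var_matrix TYPE('n) (l div 4)
       else const_matrix (\<lambda>v. c v (l div 4))
     in if l mod 4 = 0 \<or> l mod 4 = 2 then Z else adj Z)"

definition word_matrix :: "nat list \<Rightarrow> mpoly list" where
  "word_matrix w = foldr (\<lambda>l Z. mat_mult TYPE('n) (letter_matrix l) Z) w (id_matrix TYPE('n))"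

text \<open>Every variable index in \<open>S\<close> is at most \<open>enc S\<close>, so membership
  in the group is imposed on the matrices with indices up to \<open>enc S\<close>, whether or not
  they occur.\<close>

definition system_eqs :: "(nat list \<times> nat list) list \<Rightarrow> mpoly list" where
  "system_eqs S = concat (map (\<lambda>p. tuple_code (\<lambda>v :: 'n \<times> 'n.
       nth_default [] (word_matrix (fst p)) (coord v) @
       mneg (nth_default [] (word_matrix (snd p)) (coord v)))) S) @
     concat (map (\<lambda>i. map (\<lambda>P. P (var_matrix TYPE('n) i)) Ps) [0..<Suc (enc S)])"

definition var_bound :: "(nat list \<times> nat list) list \<Rightarrow> nat" where
  "var_bound S = Suc (enc S) * CARD('n \<times> 'n)"

lemma computable_word_matrix [comp]: "computable f \<Longrightarrow> computable (\<lambda>x. word_matrix (f x))"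
  by (rule computable_compose)
    (unfold word_matrix_def letter_matrix_def Let_def,
      intro comp computable_compose[OF computable_adj] computable_compose[OF computable_c])

lemma computable_system_eqs: "computable system_eqs"
  unfolding system_eqs_def
  by (intro comp, rule computable_compose[OF computable_map_fixed], auto intro!: comp computable_Ps)

lemma computable_var_bound: "computable var_bound"
  unfolding var_bound_def by (intro comp)

lemma matrix_of_const: "matrix_of \<sigma> (const_matrix (\<lambda>v. c v k)) = \<mu> k"
  by (simp add: matrix_of_def coords_const_matrix vec_eq_iff c)

lemma inv_G: "M \<in> G UNIV \<Longrightarrow> inv\<^bsub>matrix_group (G UNIV)\<^esub> M = adjugate M"
  using chevalley_group_adjugate[OF adm, of M]
  by (intro inv_matrix_group) (auto simp: chevalley_group_def)

lemma letter_value: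
  assumes "\<And>i. i \<le> b \<Longrightarrow> matrix_of \<sigma> (var_matrix TYPE('n) i) = \<tau> i" "\<And>i. \<tau> i \<in> G UNIV"
    and "letter_code l \<le> b"
  shows "letter_value (matrix_group (G UNIV)) \<mu> \<tau> l = matrix_of \<sigma> (letter_matrix (letter_code l))"
proof (cases l)
  case (Var i)
  then have "i \<le> b" using assms(3) by simp
  then show ?thesis using Var assms(1) by (simp add: letter_matrix_def)
next
  case (Var_inv i)
  then have "i \<le> b" "letter_code l mod 4 = 1" "letter_code l div 4 = i" using assms(3) by auto
  then show ?thesis using Var_inv assms(1) by (simp add: letter_matrix_def adj inv_G assms(2))
next
  case (Const k)
  then have "letter_code l = 4 * k + 2" by simp
  then have "letter_code l mod 4 = 2" "letter_code l div 4 = k" by presburger+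
  then show ?thesis using Const by (simp add: letter_matrix_def matrix_of_const)
next
  case (Const_inv k)
  then have "letter_code l = 4 * k + 3" by simp
  then have "letter_code l mod 4 = 3" "letter_code l div 4 = k" by presburger+
  then show ?thesis using Const_inv by (simp add: letter_matrix_def matrix_of_const adj inv_G \<mu>)
qed

lemma word_value:
  assumes "\<And>i. i \<le> b \<Longrightarrow> matrix_of \<sigma> (var_matrix TYPE('n) i) = \<tau> i" "\<And>i. \<tau> i \<in> G UNIV"
    and "\<And>l. l \<in> set w \<Longrightarrow> letter_code l \<le> b"
  shows "word_value (matrix_group (G UNIV)) \<mu> \<tau> w = matrix_of \<sigma> (word_matrix (map letter_code w))"
  using assms(3)
proof (induction w)
  case Nil
  show ?case by (simp add: word_value_def word_matrix_def matrix_group_def matrix_of_id_matrix)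
next
  case (Cons l w)
  have "letter_value (matrix_group (G UNIV)) \<mu> \<tau> l = matrix_of \<sigma> (letter_matrix (letter_code l))"
    by (rule letter_value[OF assms(1,2)]) (use Cons.prems in auto)
  with Cons show ?case
    by (simp add: word_value_def word_matrix_def matrix_of_mat_mult) (simp add: matrix_group_def)
qed

text \<open>Replacing letters by their codes gives data of a \<open>coded\<close> type with the same
  code number as the original system.\<close>

definition number_system :: "equation list \<Rightarrow> (nat list \<times> nat list) list" where
  "number_system S = map (\<lambda>p. (map letter_code (fst p), map letter_code (snd p))) S"

lemma enc_number_system: "enc (number_system S) = system_code S"
proof -
  have "enc (map letter_code w) = word_code w" for w
    by (simp add: enc_list_def word_code_def)
  then show ?thesis
    by (simp add: system_code_def number_system_def enc_list_def[of "map _ S"] enc_prod_def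
        comp_def case_prod_unfold)
qed

lemma letter_code_le:
  assumes "(u, w) \<in> set S" "l \<in> set u \<or> l \<in> set w"
  shows "letter_code l \<le> enc (number_system S)"
proof -
  let ?p = "(map letter_code u, map letter_code w)"
  have "?p \<in> set (number_system S)"
    using assms(1) by (force simp: number_system_def)
  then have le: "enc ?p \<le> enc (number_system S)" by (rule enc_mem_le)
  have "letter_code l \<le> enc (map letter_code u) \<or> letter_code l \<le> enc (map letter_code w)"
    using assms(2) enc_mem_le[of "letter_code l"] by auto
  with le enc_fst_le[of ?p] enc_snd_le[of ?p] show ?thesis by auto
qed

text \<open>The inequation \<open>mconst cunit\<close> says that 1 is nonzero; it merely gives a
  system of equations the shape of a \<open>conj\<close>.\<close>

lemma sat_system_eqs:
  "sat \<sigma> (system_eqs S, mconst cunit) \<longleftrightarrow>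
    (\<forall>(u, w)\<in>set S. (matrix_of \<sigma> (word_matrix u) :: 'r^'n^'n) = matrix_of \<sigma> (word_matrix w)) \<and>
    (\<forall>i\<le>enc S. matrix_of \<sigma> (var_matrix TYPE('n) i) \<in> G UNIV)"
proof -
  have "(matrix_of \<sigma> Y :: 'r^'n^'n) = matrix_of \<sigma> Z \<longleftrightarrow>
     (\<forall>v :: 'n \<times> 'n. ev \<sigma> (nth_default [] Y (coord v) @ mneg (nth_default [] Z (coord v))) = 0)" for Y Z
    by (simp add: matrix_of_def vec_eq_iff coords_def)
  moreover have "(\<forall>p\<in>set (system_eqs S). ev \<sigma> p = 0) \<longleftrightarrow>
      (\<forall>q\<in>set S. \<forall>v :: 'n \<times> 'n. ev \<sigma> (nth_default [] (word_matrix (fst q)) (coord v) @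
        mneg (nth_default [] (word_matrix (snd q)) (coord v))) = 0) \<and>
      (\<forall>i\<in>{..enc S}. \<forall>P\<in>set Ps. ev \<sigma> (P (var_matrix TYPE('n) i)) = 0)"
    by (simp only: system_eqs_def set_append set_concat set_map set_tuple_code ball_Un ball_UN
        ball_simps image_iff set_upt atLeast0LessThan lessThan_Suc_atMost)
  ultimately show ?thesis
    by (simp add: sat_def \<nu>_one chevalley_group_iff case_prod_unfold Ball_def[of "{..enc S}"]
        del: ev_append ev_mneg)
qed

lemma has_solution_iff:
  "has_solution (matrix_group (G UNIV)) \<mu> S \<longleftrightarrow>
    (\<exists>\<sigma>. (\<forall>i\<ge>var_bound (number_system S). \<sigma> i = 0) \<and>
      sat \<sigma> (system_eqs (number_system S), mconst cunit))"
proof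
  let ?b = "enc (number_system S)" and ?m = "CARD('n \<times> 'n)"
  have carrier: "carrier (matrix_group (G UNIV)) = G UNIV" by (simp add: matrix_group_def)
  {
    assume "has_solution (matrix_group (G UNIV)) \<mu> S"
    then obtain \<tau> where \<tau>: "\<And>i. \<tau> i \<in> G UNIV" "\<And>u w. (u, w) \<in> set S \<Longrightarrow>
        word_value (matrix_group (G UNIV)) \<mu> \<tau> u = word_value (matrix_group (G UNIV)) \<mu> \<tau> w"
      unfolding has_solution_def carrier by blast
    \<comment> \<open>Entries of the solution are spread over the blocks of unknowns: the quotient
      by \<open>?m\<close> is the group variable, the remainder the matrix position.\<close>
    define \<sigma> where "\<sigma> k = (if k < Suc ?b * ?m then entries (\<tau> (k div ?m)) (uncoord (k mod ?m)) else 0)" for k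
    have var: "matrix_of \<sigma> (var_matrix TYPE('n) i) = \<tau> i" if "i \<le> ?b" for i
    proof (intro vec_eq_iff[THEN iffD2] allI)
      fix r s :: 'n
      have less: "coord (r, s) < ?m" by (rule coord_less)
      have "i * ?m + coord (r, s) < i * ?m + ?m" using less by simp
      also have "\<dots> \<le> Suc ?b * ?m" using that mult_le_mono1[of "Suc i" "Suc ?b" ?m] by simp
      finally have "i * ?m + coord (r, s) < Suc ?b * ?m" .
      moreover have "(i * ?m + coord (r, s)) div ?m = i" "(i * ?m + coord (r, s)) mod ?m = coord (r, s)"
        using less by (simp_all add: div_nat_eqI)
      ultimately show "matrix_of \<sigma> (var_matrix TYPE('n) i) $ r $ s = \<tau> i $ r $ s"
        unfolding matrix_of_var_matrix \<sigma>_def by (simp add: entries_def del: mult_Suc)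
    qed
    have "sat \<sigma> (system_eqs (number_system S), mconst cunit)"
      unfolding sat_system_eqs
    proof (intro conjI allI impI ballI)
      fix i assume "i \<le> ?b"
      then show "matrix_of \<sigma> (var_matrix TYPE('n) i) \<in> G UNIV" using var \<tau>(1) by simp
    next
      fix p assume "p \<in> set (number_system S)"
      then obtain u w where uw: "(u, w) \<in> set S" "p = (map letter_code u, map letter_code w)"
        by (auto simp: number_system_def)
      have "matrix_of \<sigma> (word_matrix (map letter_code u)) = (matrix_of \<sigma> (word_matrix (map letter_code w)) :: 'r^'n^'n)"
        using \<tau>(2)[OF uw(1)] word_value[OF var \<tau>(1)] letter_code_le[OF uw(1)] by metis
      then show "case p of (u, w) \<Rightarrow> (matrix_of \<sigma> (word_matrix u) :: 'r^'n^'n) = matrix_of \<sigma> (word_matrix w)"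
        by (simp add: uw(2))
    qed
    moreover have "\<forall>i\<ge>var_bound (number_system S). \<sigma> i = 0"
      by (simp add: \<sigma>_def var_bound_def)
    ultimately show "\<exists>\<sigma>. (\<forall>i\<ge>var_bound (number_system S). \<sigma> i = 0) \<and>
      sat \<sigma> (system_eqs (number_system S), mconst cunit)" by blast
  next
    assume "\<exists>\<sigma>. (\<forall>i\<ge>var_bound (number_system S). \<sigma> i = 0) \<and>
      sat \<sigma> (system_eqs (number_system S), mconst cunit)"
    then obtain \<sigma> where \<sigma>: "sat \<sigma> (system_eqs (number_system S), mconst cunit)" by blast
    \<comment> \<open>A group assignment is total; variables beyond the bound do not occur in
      \<open>S\<close> and receive the identity.\<close>
    define \<tau> where "\<tau> i = (if i \<le> ?b then matrix_of \<sigma> (var_matrix TYPE('n) i) else mat 1 :: 'r^'n^'n)" for i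
    have \<tau>: "\<tau> i \<in> G UNIV" for i
      using \<sigma>[unfolded sat_system_eqs] by (simp add: \<tau>_def mat_1_chevalley_group)
    have "word_value (matrix_group (G UNIV)) \<mu> \<tau> u = word_value (matrix_group (G UNIV)) \<mu> \<tau> w"
      if uw: "(u, w) \<in> set S" for u w
    proof -
      have wv: "word_value (matrix_group (G UNIV)) \<mu> \<tau> x = matrix_of \<sigma> (word_matrix (map letter_code x))"
        if "x = u \<or> x = w" for x
        by (rule word_value[of ?b, OF _ \<tau>]) (use that letter_code_le[OF uw] in \<open>auto simp: \<tau>_def\<close>)
      have "(map letter_code u, map letter_code w) \<in> set (number_system S)"
        using uw by (force simp: number_system_def)
      then have "(matrix_of \<sigma> (word_matrix (map letter_code u)) :: 'r^'n^'n)
          = matrix_of \<sigma> (word_matrix (map letter_code w))"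
        using \<sigma> unfolding sat_system_eqs by blast
      then show ?thesis by (simp add: wv)
    qed
    then show "has_solution (matrix_group (G UNIV)) \<mu> S"
      unfolding has_solution_def carrier using \<tau> by blast
  }
qed

lemma decidable_diophantine: "diophantine_decidable (matrix_group (G UNIV)) \<mu>"
proof -
  have "decidable (\<lambda>S. \<exists>\<sigma>. (\<forall>i\<ge>var_bound S. \<sigma> i = 0) \<and> sat \<sigma> (system_eqs S, mconst cunit))"
    by (intro decidable_solvable comp computable_var_bound computable_system_eqs)
  from computable_imp_recursive[OF this] obtain f where f: "recursive 1 f"
    "\<And>S. f [enc S] = of_bool (\<exists>\<sigma>. (\<forall>i\<ge>var_bound S. \<sigma> i = 0) \<and> sat \<sigma> (system_eqs S, mconst cunit))"
    by blast
  have "f [system_code S] = of_bool (has_solution (matrix_group (G UNIV)) \<mu> S)" for S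
    unfolding has_solution_iff enc_number_system[symmetric] by (rule f(2))
  with f(1) show ?thesis unfolding diophantine_decidable_def by blast
qed

end

lemma ex_chevalley_matrices:
  fixes \<nu> :: "nat \<Rightarrow> 'r::alg_closed_field" and X :: "'e \<Rightarrow> complex^'n^'n"
  assumes "computable_field \<nu> cadd cmul cneg czero cunit" "admissible_lattice_basis \<Phi> X B"
  shows "\<exists>Ps. chevalley_matrices \<nu> cadd cmul cneg czero cunit \<Phi> X B Ps"
proof -
  interpret computable_field \<nu> cadd cmul cneg czero cunit by fact
  obtain F :: "(('n \<times> 'n \<Rightarrow> 'r) \<Rightarrow> 'r) set" where F: "finite F"
    "\<And>h. h \<in> F \<Longrightarrow> \<exists>f :: ('n \<times> 'n \<Rightarrow> int) \<Rightarrow> int. int_poly f h"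
    "\<And>K M. M \<in> chevalley_group \<Phi> X B K \<longleftrightarrow>
       (\<forall>i j. M $ i $ j \<in> K) \<and> (\<forall>h\<in>F. h (entries M) = 0)"
    using chevalley_group_finite_system[of \<Phi> X B] by metis
  have "\<forall>h\<in>F. \<exists>P. computable P \<and> (\<forall>\<sigma> Z. ev \<sigma> (P Z) = h (coords \<sigma> Z))"
    using F(2) int_poly_computable by blast
  then obtain P where P: "\<And>h. h \<in> F \<Longrightarrow> computable (P h)"
    "\<And>h \<sigma> Z. h \<in> F \<Longrightarrow> ev \<sigma> (P h Z) = h (coords \<sigma> Z)" by metis
  obtain hs where hs: "set hs = F" using finite_list[OF F(1)] by blast
  have "chevalley_matrices \<nu> cadd cmul cneg czero cunit \<Phi> X B (map P hs)"
    by unfold_locales (auto simp: assms(2) P hs F(3) entries_matrix_of)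
  then show ?thesis ..
qed

text \<open>The existence part keeps the statement about all proper enumerations from being
  vacuous.\<close>

theorem mainTheorem7:
  fixes \<Phi> :: "'e::euclidean_space set"
    and scale :: "complex \<Rightarrow> 'g::ab_group_add \<Rightarrow> 'g"
    and bracket :: "'g \<Rightarrow> 'g \<Rightarrow> 'g"
    and H :: "'g set"
    and \<rho> :: "'e \<Rightarrow> 'g \<Rightarrow> complex"
    and e :: "'e \<Rightarrow> 'g"
    and \<pi> :: "'g \<Rightarrow> complex^'n^'n"
    and B :: "complex^'n^'n"
    and A :: "'r::alg_closed_field set"
  assumes "root_system \<Phi>" and "indecomposable \<Phi>" and "dim \<Phi> > 1"
    and "complex_lie_algebra scale bracket"
    and "complex_lie_algebra.semisimple scale bracket"
    and "complex_lie_algebra.cartan_subalgebra scale bracket H"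
    and "complex_lie_algebra.root_system_iso scale bracket \<Phi> H \<rho>"
    and "complex_lie_algebra.chevalley_basis scale bracket \<Phi> H \<rho> e"
    and "complex_lie_algebra.faithful_representation scale bracket \<pi>"
    and "admissible_lattice_basis \<Phi> (\<pi> \<circ> e) B"
    and "computable_subfield A"
  shows "(\<exists>\<mu>. proper_enumeration A (chevalley_group \<Phi> (\<pi> \<circ> e) B A) \<mu>) \<and>
    (\<forall>\<mu>. proper_enumeration A (chevalley_group \<Phi> (\<pi> \<circ> e) B A) \<mu> \<longrightarrow>
       diophantine_decidable (matrix_group (chevalley_group \<Phi> (\<pi> \<circ> e) B UNIV)) \<mu>)"
proof (intro conjI allI impI)
  note adm = \<open>admissible_lattice_basis \<Phi> (\<pi> \<circ> e) B\<close>
  have A: "0 \<in> A" "1 \<in> A" "\<exists>\<nu>. computable_enumeration \<nu> A"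
    using \<open>computable_subfield A\<close> by (auto simp: computable_subfield_def is_subfield_def)
  obtain \<nu> cadd cmul cneg czero cunit where
    \<nu>: "computable_enumeration \<nu> A" "computable_field \<nu> cadd cmul cneg czero cunit"
    using A(3) computable_enumeration_imp_field by metis
  obtain Ps where "chevalley_matrices \<nu> cadd cmul cneg czero cunit \<Phi> (\<pi> \<circ> e) B Ps"
    using ex_chevalley_matrices[OF \<nu>(2) adm] by blast
  then show "\<exists>\<mu>. proper_enumeration A (chevalley_group \<Phi> (\<pi> \<circ> e) B A) \<mu>"
    by (rule chevalley_matrices.ex_proper_enumeration) fact+
next
  note adm = \<open>admissible_lattice_basis \<Phi> (\<pi> \<circ> e) B\<close>
  fix \<mu> :: "nat \<Rightarrow> 'r^'n^'n"
  assume \<mu>: "proper_enumeration A (chevalley_group \<Phi> (\<pi> \<circ> e) B A) \<mu>"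
  \<comment> \<open>The coefficients are coded by the enumeration of \<open>A\<close> that belongs
    to \<open>\<mu>\<close>, so that the entries of the constants are computable from their
    numbers.\<close>
  then obtain \<nu> where \<nu>: "computable_enumeration \<nu> A"
    "\<And>i j. \<exists>f. recursive 1 f \<and> (\<forall>k. \<mu> k $ i $ j = \<nu> (f [k]))"
    unfolding proper_enumeration_def by blast
  obtain cadd cmul cneg czero cunit where K: "computable_field \<nu> cadd cmul cneg czero cunit"
    using computable_enumeration_imp_field[OF \<nu>(1)] by metis
  interpret computable_field \<nu> cadd cmul cneg czero cunit by fact
  obtain Ps where Ps: "chevalley_matrices \<nu> cadd cmul cneg czero cunit \<Phi> (\<pi> \<circ> e) B Ps"
    using ex_chevalley_matrices[OF K adm] by blast
  obtain f where f: "\<And>i j. recursive 1 (f i j)" "\<And>i j k. \<mu> k $ i $ j = \<nu> (f i j [k])"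
    using \<nu>(2) by metis
  obtain adj where adj: "computable adj"
    "\<And>\<sigma> Z. matrix_of \<sigma> (adj Z) = adjugate (matrix_of \<sigma> Z :: 'r^'n^'n)"
    using adjugate_computable by blast
  \<comment> \<open>Points over \<open>A\<close> are points over the whole field, since the ring
    enters only through the condition on the entries.\<close>
  have "\<mu> k \<in> chevalley_group \<Phi> (\<pi> \<circ> e) B UNIV" for k
  proof -
    have "\<mu> k \<in> chevalley_group \<Phi> (\<pi> \<circ> e) B A"
      using \<mu> by (auto simp: proper_enumeration_def)
    then show ?thesis by (simp add: chevalley_group_def)
  qed
  moreover have "computable (\<lambda>k. f (fst v) (snd v) [k])" for v
    by (intro computable_recursive1 f(1) comp)
  ultimately have "coded_equations \<nu> cadd cmul cneg czero cunit \<Phi> (\<pi> \<circ> e) B Ps \<mu>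
      (\<lambda>v k. f (fst v) (snd v) [k]) adj"
    by (intro coded_equations.intro coded_equations_axioms.intro Ps) (simp_all add: f(2) adj)
  then show "diophantine_decidable (matrix_group (chevalley_group \<Phi> (\<pi> \<circ> e) B UNIV)) \<mu>"
    by (rule coded_equations.decidable_diophantine)
qed

end
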